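(* Given $t_f>0$, let $\vec p_0=(\phi_0,\phi_1(\cdot),\phi_2(\cdot))^T\in X$ and $\vec p^*=(p_0^*,p_1^*(\cdot),p_2^*(\cdot))^T\in X$ be non-negative initial and desired states, respectively, with $\|\vec p_0\|_X=\|\vec p^*\|_X=1$. Assume that $\vec p^*$ satisfies: - $p_1^*,p_2^*\in W^{1,1}(0,L)$; - $p_1^*(0)=\lambda_1p_0^*$, $\;p_2^*(0)=\lambda_2p_0^*+\lambda_2\int_0^Lp_1^*(x)\,dx$, and $p_i^*(L)=0$ for $i=1,2$; - $p_0^*=1-\sum_{i=1}^2\int_0^Lp_i^*(x)\,dx$; - $p_i^*(x)\ge0$ for all $x\in[0,L]$, $i=1,2$; - for some $\epsilon>0$, $\;\frac{dp_1^*(x)}{dx}\le-\epsilon<0$ and $\frac{dp_2^*(x)}{dx}<0$ for all $x\in(0,L)$. Then there exists a vector of space-time dependent repair rates $\vec\mu(x,t)=(\mu_1(x,t),\mu_2(x,t))^T$ of the feedback form $$\mu_1(x,t)=-\frac{1}{p_1(x,t)}\frac{\partial p_1(x,t)}{\partial x}+\alpha_1 j\,\frac{1}{p_1(x,t)}\frac{\partial(g_1(x)p_1(x,t))}{\partial x}-\lambda_2,$$ $$\mu_2(x,t)=-\frac{1}{p_2(x,t)}\frac{\partial p_2(x,t)}{\partial x}+\alpha_2 j\,\frac{1}{p_2(x,t)}\frac{\partial(g_2(x)p_2(x,t))}{\partial x},$$ for $t\in\big[r_0\sum_{k=1}^{j-1}\frac1{k^2},\,r_0\sum_{k=1}^{j}\frac1{k^2}\big)$,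 $j\in\mathbb{Z}^+$ (with $g_i$, $r_0$, $\alpha_i$ as in the context), such that the solution $\vec p(\cdot,t)$ of the repairable system with these repair rates and initial state $\vec p_0$ satisfies $\vec p(\cdot,t_f)=(p_0^*,p_1^*(\cdot),p_2^*(\cdot))^T$.
   Context: Let $0<L<\infty$, $\lambda_1>0$, $\lambda_2>0$, and $X=\mathbb{R}\times L^1(0,L)\times L^1(0,L)$ with norm $\|(p_0,p_1,p_2)\|_X=|p_0|+\|p_1\|_{L^1(0,L)}+\|p_2\|_{L^1(0,L)}$. Repairable system with space-time dependent repair rates $\mu_i(x,t)$: $$\dot p_0(t)=-(\lambda_1+\lambda_2)p_0(t)+\sum_{i=1}^2\int_0^L\mu_i(x,t)p_i(x,t)\,dx,$$ $$\partial_tp_1+\partial_xp_1=-(\mu_1(x,t)+\lambda_2)p_1,\qquad \partial_tp_2+\partial_xp_2=-\mu_2(x,t)p_2,$$ with boundary conditions $p_1(0,t)=\lambda_1p_0(t)$, $p_2(0,t)=\lambda_2p_0(t)+\lambda_2\int_0^Lp_1(x,t)\,dx$, and initial conditions $p_0(0)=\phi_0$, $p_i(x,0)=\phi_i(x)$, $i=1,2$. In the feedback law, $g_i(x)=1/p_i^*(x)$; $r_0=6t_f/\pi^2$, so that $r_0\sum_{k=1}^\infty\frac1{k^2}=t_f$; and $\alpha_1,\alpha_2>0$ are constants chosen with $\alpha_1\ge\max\{\frac{\lambda_2}{\epsilon}(p_1^*(0))^2,\,p_1^*(0)\}$ and $\alpha_2\ge p_2^*(0)$. Put $t_j=r_0\sum_{k=1}^j\frac1{k^2}$,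 $t_0=0$. Inserting the feedback law yields the closed-loop system, in whose (mild/characteristics) sense the solution is understood: on each $(t_{j-1},t_j)$, $j\in\mathbb{Z}^+$, $$\frac{dp_0(t)}{dt}=j\sum_{i=1}^2\alpha_i\int_0^L\frac{\partial(g_i(x)p_i(x,t))}{\partial x}\,dx,\qquad \frac{\partial p_i(x,t)}{\partial t}=-j\alpha_i\frac{\partial(g_i(x)p_i(x,t))}{\partial x},\ i=1,2,$$ with the same boundary conditions, initial state $\vec p_0$ at $t=0$, and state at $t_{j-1}$ on the $j$-th interval equal to the terminal state of the preceding interval. The state at $t_f$ is the limit in $X$ as $t\to t_f^-$. *)

theory Defs
  imports "HOL-Analysis.Analysis"
begin

text \<open>Functions on \<open>(0,L)\<close> are represented by functions \<open>real \<Rightarrow> real\<close>; only their values on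
  \<open>{0<..<L}\<close>, up to null sets, matter. \<open>W\<^sup>1\<^sup>,\<^sup>1(0,L)\<close> is defined by testing against
  \<open>C\<^sup>1\<close> functions with compact support in \<open>(0,L)\<close>.\<close>

definition L1 :: "real \<Rightarrow> (real \<Rightarrow> real) \<Rightarrow> bool" where
  "L1 L u \<longleftrightarrow> set_integrable lborel {0<..<L} u"

definition test_function :: "real \<Rightarrow> (real \<Rightarrow> real) \<Rightarrow> (real \<Rightarrow> real) \<Rightarrow> bool" where
  "test_function L \<psi> \<psi>' \<longleftrightarrow>
     (\<forall>x. (\<psi> has_real_derivative \<psi>' x) (at x)) \<and> continuous_on UNIV \<psi>' \<and>
     (\<exists>a b. 0 < a \<and> b < L \<and> (\<forall>x. x \<notin> {a..b} \<longrightarrow> \<psi> x = 0))"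

definition has_wderiv :: "real \<Rightarrow> (real \<Rightarrow> real) \<Rightarrow> (real \<Rightarrow> real) \<Rightarrow> bool" where
  "has_wderiv L u v \<longleftrightarrow> L1 L u \<and> L1 L v \<and>
     (\<forall>\<psi> \<psi>'. test_function L \<psi> \<psi>' \<longrightarrow>
        (LINT x:{0<..<L}|lborel. u x * \<psi>' x) = - (LINT x:{0<..<L}|lborel. v x * \<psi> x))"

definition W11 :: "real \<Rightarrow> (real \<Rightarrow> real) \<Rightarrow> bool" where
  "W11 L u \<longleftrightarrow> (\<exists>v. has_wderiv L u v)"

text \<open>For \<open>u\<close> in \<open>W\<^sup>1\<^sup>,\<^sup>1(0,L)\<close> this is well defined up to null sets.\<close>

definition wderiv :: "real \<Rightarrow> (real \<Rightarrow> real) \<Rightarrow> real \<Rightarrow> real" where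
  "wderiv L u = (SOME v. has_wderiv L u v)"

text \<open>The value at 0 of the continuous representative of \<open>u\<close> is \<open>c\<close>.\<close>

definition trace0 :: "real \<Rightarrow> (real \<Rightarrow> real) \<Rightarrow> real \<Rightarrow> bool" where
  "trace0 L u c \<longleftrightarrow>
     (\<exists>v. continuous_on {0..L} v \<and> (AE x in lborel. x \<in> {0<..<L} \<longrightarrow> v x = u x) \<and> v 0 = c)"

type_synonym state = "real \<times> (real \<Rightarrow> real) \<times> (real \<Rightarrow> real)"

fun in_X :: "real \<Rightarrow> state \<Rightarrow> bool" where
  "in_X L (z0, z1, z2) \<longleftrightarrow> L1 L z1 \<and> L1 L z2"

fun norm_X :: "real \<Rightarrow> state \<Rightarrow> real" where
  "norm_X L (z0, z1, z2) =
     \<bar>z0\<bar> + (LINT x:{0<..<L}|lborel. \<bar>z1 x\<bar>) + (LINT x:{0<..<L}|lborel. \<bar>z2 x\<bar>)"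

fun dist_X :: "real \<Rightarrow> state \<Rightarrow> state \<Rightarrow> real" where
  "dist_X L (z0, z1, z2) (w0, w1, w2) =
     norm_X L (z0 - w0, \<lambda>x. z1 x - w1 x, \<lambda>x. z2 x - w2 x)"

definition nonneg_X :: "real \<Rightarrow> state \<Rightarrow> bool" where
  "nonneg_X L z \<longleftrightarrow> (case z of (z0, z1, z2) \<Rightarrow>
     0 \<le> z0 \<and> (AE x in lborel. x \<in> {0<..<L} \<longrightarrow> 0 \<le> z1 x \<and> 0 \<le> z2 x))"

text \<open>The right-hand side and the boundary conditions of the repairable system at a frozen time,
  for repair rates \<open>m1, m2\<close> (functions of \<open>x\<close>): the state \<open>z\<close> satisfies the boundary conditions
  and the right-hand side of the system at \<open>z\<close> is \<open>w\<close>.\<close>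

fun repairable_op ::
  "real \<Rightarrow> real \<Rightarrow> real \<Rightarrow> (real \<Rightarrow> real) \<Rightarrow> (real \<Rightarrow> real) \<Rightarrow> state \<Rightarrow> state \<Rightarrow> bool" where
  "repairable_op L lam1 lam2 m1 m2 (z0, z1, z2) (w0, w1, w2) \<longleftrightarrow>
     W11 L z1 \<and> W11 L z2 \<and> L1 L (\<lambda>x. m1 x * z1 x) \<and> L1 L (\<lambda>x. m2 x * z2 x) \<and>
     trace0 L z1 (lam1 * z0) \<and>
     trace0 L z2 (lam2 * z0 + lam2 * (LINT x:{0<..<L}|lborel. z1 x)) \<and>
     w0 = - (lam1 + lam2) * z0 + (LINT x:{0<..<L}|lborel. m1 x * z1 x)
                           + (LINT x:{0<..<L}|lborel. m2 x * z2 x) \<and>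
     (AE x in lborel. x \<in> {0<..<L} \<longrightarrow> w1 x = - wderiv L z1 x - (m1 x + lam2) * z1 x) \<and>
     (AE x in lborel. x \<in> {0<..<L} \<longrightarrow> w2 x = - wderiv L z2 x - m2 x * z2 x)"

text \<open>A feedback law is a pair \<open>\<mu>1, \<mu>2\<close>; on the \<open>j\<close>-th time interval the repair rates are
  \<open>\<mu>\<^sub>i(x,t) = \<mu>i j (p\<^sub>i(\<cdot>,t)) x\<close>. Nothing is prescribed where the state vanishes: only the
  products \<open>\<mu>\<^sub>i p\<^sub>i\<close> enter the system, and the derivatives of \<open>p\<^sub>i\<close> and \<open>g\<^sub>i p\<^sub>i\<close> vanish almost
  everywhere on the zero set of \<open>p\<^sub>i\<close>.\<close>

type_synonym feedback = "nat \<Rightarrow> (real \<Rightarrow> real) \<Rightarrow> real \<Rightarrow> real"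

definition feedback_form ::
  "real \<Rightarrow> real \<Rightarrow> real \<Rightarrow> real \<Rightarrow> (real \<Rightarrow> real) \<Rightarrow> (real \<Rightarrow> real) \<Rightarrow> feedback \<Rightarrow> feedback \<Rightarrow> bool" where
  "feedback_form L lam2 \<alpha>1 \<alpha>2 g1 g2 \<mu>1 \<mu>2 \<longleftrightarrow>
     (\<forall>j\<ge>1. \<forall>z. W11 L z \<and> W11 L (\<lambda>x. g1 x * z x) \<longrightarrow>
        (\<forall>x\<in>{0<..<L}. z x \<noteq> 0 \<longrightarrow>
           \<mu>1 j z x = - (1 / z x) * wderiv L z x
                      + \<alpha>1 * real j * (1 / z x) * wderiv L (\<lambda>y. g1 y * z y) x - lam2)) \<and>
     (\<forall>j\<ge>1. \<forall>z. W11 L z \<and> W11 L (\<lambda>x. g2 x * z x) \<longrightarrow>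
        (\<forall>x\<in>{0<..<L}. z x \<noteq> 0 \<longrightarrow>
           \<mu>2 j z x = - (1 / z x) * wderiv L z x
                      + \<alpha>2 * real j * (1 / z x) * wderiv L (\<lambda>y. g2 y * z y) x))"

text \<open>The repairable system with the feedback law inserted.\<close>

fun controlled_op ::
  "real \<Rightarrow> real \<Rightarrow> real \<Rightarrow> (real \<Rightarrow> real) \<Rightarrow> (real \<Rightarrow> real) \<Rightarrow> feedback \<Rightarrow> feedback \<Rightarrow>
   nat \<Rightarrow> state \<Rightarrow> state \<Rightarrow> bool" where
  "controlled_op L lam1 lam2 g1 g2 \<mu>1 \<mu>2 j (z0, z1, z2) w \<longleftrightarrow>
     W11 L (\<lambda>x. g1 x * z1 x) \<and> W11 L (\<lambda>x. g2 x * z2 x) \<and>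
     repairable_op L lam1 lam2 (\<mu>1 j z1) (\<mu>2 j z2) (z0, z1, z2) w"

text \<open>The closed-loop system in simplified form.\<close>

fun closed_loop_op ::
  "real \<Rightarrow> real \<Rightarrow> real \<Rightarrow> real \<Rightarrow> real \<Rightarrow> (real \<Rightarrow> real) \<Rightarrow> (real \<Rightarrow> real) \<Rightarrow>
   nat \<Rightarrow> state \<Rightarrow> state \<Rightarrow> bool" where
  "closed_loop_op L lam1 lam2 \<alpha>1 \<alpha>2 g1 g2 j (z0, z1, z2) (w0, w1, w2) \<longleftrightarrow>
     W11 L (\<lambda>x. g1 x * z1 x) \<and> W11 L (\<lambda>x. g2 x * z2 x) \<and>
     trace0 L z1 (lam1 * z0) \<and>
     trace0 L z2 (lam2 * z0 + lam2 * (LINT x:{0<..<L}|lborel. z1 x)) \<and>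
     w0 = real j * (\<alpha>1 * (LINT x:{0<..<L}|lborel. wderiv L (\<lambda>y. g1 y * z1 y) x)
                    + \<alpha>2 * (LINT x:{0<..<L}|lborel. wderiv L (\<lambda>y. g2 y * z2 y) x)) \<and>
     (AE x in lborel. x \<in> {0<..<L} \<longrightarrow> w1 x = - real j * \<alpha>1 * wderiv L (\<lambda>y. g1 y * z1 y) x) \<and>
     (AE x in lborel. x \<in> {0<..<L} \<longrightarrow> w2 x = - real j * \<alpha>2 * wderiv L (\<lambda>y. g2 y * z2 y) x)"

definition switch_time :: "real \<Rightarrow> nat \<Rightarrow> real" where
  "switch_time r0 j = r0 * (\<Sum>k=1..j. 1 / (real k)\<^sup>2)"

text \<open>Mild solutions. \<open>A j z w\<close> stands for ``\<open>z\<close> is in the domain of the \<open>j\<close>-th (linear) operator and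
  is mapped to \<open>w\<close>''. Since a state in \<open>X\<close> need not be differentiable, the equation
  \<open>p' = A\<^sub>j p\<close> on the \<open>j\<close>-th interval \<open>[a,b]\<close> is imposed in the form
  \<open>p(t) - p(a) = A\<^sub>j (\<integral>\<^sub>a\<^sup>t p(s) ds)\<close>, as usual for abstract Cauchy problems; the boundary conditions
  are part of the domain. Note that the densities \<open>\<mu>\<^sub>i[z] z\<close> resulting from the feedback law
  are linear in \<open>z\<close>. Continuity on all of \<open>[0, t\<^sub>f)\<close> links consecutive intervals, and
  joint measurability makes the pointwise time integrals represent the integral in \<open>X\<close>.\<close>

definition mild_solution ::
  "real \<Rightarrow> real \<Rightarrow> real \<Rightarrow> (nat \<Rightarrow> state \<Rightarrow> state \<Rightarrow> bool) \<Rightarrow> state \<Rightarrow>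
   (real \<Rightarrow> real) \<Rightarrow> (real \<Rightarrow> real \<Rightarrow> real) \<Rightarrow> (real \<Rightarrow> real \<Rightarrow> real) \<Rightarrow> bool" where
  "mild_solution L tf r0 A \<phi> p0 p1 p2 \<longleftrightarrow>
     (let p = (\<lambda>t. (p0 t, \<lambda>x. p1 x t, \<lambda>x. p2 x t)) in
       (\<forall>t\<in>{0..<tf}. in_X L (p t)) \<and>
       set_borel_measurable borel ({0<..<L} \<times> {0..<tf}) (\<lambda>(x, t). p1 x t) \<and>
       set_borel_measurable borel ({0<..<L} \<times> {0..<tf}) (\<lambda>(x, t). p2 x t) \<and>
       (\<forall>t\<in>{0..<tf}. ((\<lambda>s. dist_X L (p s) (p t)) \<longlongrightarrow> 0) (at t within {0..<tf})) \<and>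
       dist_X L (p 0) \<phi> = 0 \<and>
       (\<forall>j\<ge>1. let a = switch_time r0 (j - 1); b = switch_time r0 j in
          \<forall>t\<in>{a..b}.
            A j (LINT s:{a..t}|lborel. p0 s,
                 \<lambda>x. LINT s:{a..t}|lborel. p1 x s,
                 \<lambda>x. LINT s:{a..t}|lborel. p2 x s)
                (p0 t - p0 a, \<lambda>x. p1 x t - p1 x a, \<lambda>x. p2 x t - p2 x a)))"

end

theory Submission
  imports Defs
begin

text \<open>After the change of time with slope \<open>j\<close> on the \<open>j\<close>-th interval the closed loop is autonomous, and
  the final time becomes infinity because the harmonic series diverges. Each \<open>g\<^sub>i p\<^sub>i\<close> is constant
  along characteristics of finite total travel time \<open>T\<^sub>i\<close>, so past that time \<open>p\<^sub>i\<close> is \<open>p\<^sub>i\<^sup>*\<close> times the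
  delayed boundary values of \<open>g\<^sub>i p\<^sub>i\<close>. Conservation of mass turns this into
  \<open>s + \<beta> \<integral> s = m\<close>, the integral being over the last \<open>T\<^sub>i\<close> units of time: first for
  \<open>s = p\<^sub>0 + \<integral> p\<^sub>1\<close> with \<open>m = 1\<close> the total mass, then for \<open>s = p\<^sub>0\<close> with \<open>m\<close> the previous unknown.
  Over successive windows the oscillation of the primitive of \<open>s\<close> contracts, so \<open>s\<close> converges, and the
  limits are the boundary values of the desired state.

  Conversely, solving these two delay equations and transporting the initial and boundary data along the
  characteristics gives a mild solution. The feedback law reproduces the closed loop also
  where the state vanishes, since a function in \<open>W\<^sup>1\<^sup>,\<^sup>1\<close> has zero derivative almost everywhere on its
  zero set.\<close>

section \<open>Integrable and absolutely continuous functions on an interval\<close>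

text \<open>A state is only integrable in space, and the mild equation controls only time integrals
  within one switching interval, so no step may differentiate a density. The proof therefore works
  with cumulated masses, which are jointly continuous, and returns to densities only because
  integrands with equal primitives agree almost everywhere. The weights \<open>1 / p1s\<close> and
  \<open>1 / p2s\<close> are singular at \<open>L\<close>. What tames them is that membership of the
  weighted state in \<open>W11\<close> provides a representative bounded up to \<open>L\<close>, and
  that the travel time integrates the reciprocal of the unbounded speed. The two delay equations
  decouple because the boundary condition of the second density sees \<open>p0\<close> and the first
  mass only through their sum. In them \<beta> is the gain times the reciprocal of the desired
  boundary datum, so \<beta> times the travel time is a ratio of desired masses; this is why the
  limits \<open>m / (1 + \<beta> * T)\<close> are the desired data. Convergence is proved for every
  mild solution, independently of how one is constructed.\<close>

lemma L1_set_integrable_Icc: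
  assumes "L1 L v"
  shows "set_integrable lborel {0..L} v"
proof -
  have "{0..L} \<subseteq> {0<..<L} \<union> {0, L}" by auto
  moreover have "set_integrable lborel ({0<..<L} \<union> {0, L}) v"
    using assms unfolding L1_def
    using set_integrable_Un[of lborel "{0}" v "{L}"] by (intro set_integrable_Un) (auto simp: insert_commute)
  ultimately show ?thesis by (rule set_integrable_subset[rotated 2]) auto
qed

text \<open>The bridge from integrals over \<open>lborel\<close>, in which the statement is written,
  to the gauge integral, whose fundamental theorem and convergence theorems are used throughout. The
  passage through \<open>lebesgue\<close> is the completion.\<close>

lemma L1_absolutely_integrable:
  assumes "L1 L v" "{a..b} \<subseteq> {0..L}"
  shows "v absolutely_integrable_on {a..b}"
proof -
  have i: "integrable lborel (\<lambda>x. indicat_real {0..L} x *\<^sub>R v x)"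
    using L1_set_integrable_Icc[OF assms(1)] unfolding set_integrable_def .
  then have "integrable lebesgue (\<lambda>x. indicat_real {0..L} x *\<^sub>R v x)"
    using integrable_completion[OF borel_measurable_integrable[OF i]] by simp
  then have "v absolutely_integrable_on {0..L}"
    by (simp add: set_integrable_def)
  with assms(2) show ?thesis
    using absolutely_integrable_on_subinterval by blast
qed

lemma L1_integrable_on:
  assumes "L1 L v" "0 \<le> a" "b \<le> L"
  shows "v integrable_on {a..b}"
  using L1_absolutely_integrable[OF assms(1), of a b] assms
    by (auto simp: absolutely_integrable_on_def)

lemma L1_indefinite_continuous:
  assumes "L1 L v"
  shows "continuous_on {0..L} (\<lambda>x. integral {0..x} v)"
  by (rule indefinite_integral_continuous_1, rule L1_integrable_on[OF assms]) auto

lemma L1_LINT_Ioo: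
  assumes "L1 L v" "0 \<le> a" "b \<le> L"
  shows "(LINT x:{a<..<b}|lborel. v x) = integral {a..b} v"
proof -
  have "set_integrable lborel {a<..<b} v"
    using assms(1) unfolding L1_def
    by (rule set_integrable_subset) (use assms in auto)
  from set_borel_integral_eq_integral(2)[OF this] show ?thesis
    by (simp add: integral_open_interval_real)
qed

lemma L1_LINT:
  assumes "L1 L v"
  shows "(LINT x:{0<..<L}|lborel. v x) = integral {0..L} v"
  by (rule L1_LINT_Ioo) (use assms in auto)

lemma continuous_L1:
  assumes "continuous_on {0..L} w"
  shows "L1 L w"
  unfolding L1_def
  by (rule set_integrable_subset[OF borel_integrable_atLeastAtMost'[OF assms]]) auto

lemma L1_diff: "L1 L u \<Longrightarrow> L1 L v \<Longrightarrow> L1 L (\<lambda>x. u x - v x)"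
  unfolding L1_def by (rule set_integral_diff)

lemma L1_add: "L1 L u \<Longrightarrow> L1 L v \<Longrightarrow> L1 L (\<lambda>x. u x + v x)"
  unfolding L1_def by (rule set_integral_add)

lemma L1_cmult: "L1 L u \<Longrightarrow> L1 L (\<lambda>x. c * u x)"
  unfolding L1_def by simp

lemma L1_mult_continuous:
  assumes "L1 L v" "continuous_on {0..L} w"
  shows "L1 L (\<lambda>x. v x * w x)"
proof -
  have "compact (w ` {0..L})"
    using assms(2) by (intro compact_continuous_image) auto
  then obtain B where B: "\<And>x. x \<in> {0..L} \<Longrightarrow> \<bar>w x\<bar> \<le> B"
    using compact_imp_bounded bounded_real by (metis image_eqI)
  have "set_borel_measurable lborel {0<..<L} w"
    using continuous_L1[OF assms(2)]
    unfolding L1_def set_integrable_def set_borel_measurable_def by (rule borel_measurable_integrable)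
  moreover have "set_borel_measurable lborel {0<..<L} v"
    using assms(1) unfolding L1_def set_integrable_def set_borel_measurable_def by (rule borel_measurable_integrable)
  ultimately have "(\<lambda>x. (indicat_real {0<..<L} x *\<^sub>R v x) * (indicat_real {0<..<L} x *\<^sub>R w x)) \<in> borel_measurable lborel"
    unfolding set_borel_measurable_def by measurable
  then have meas: "set_borel_measurable lborel {0<..<L} (\<lambda>x. v x * w x)"
    unfolding set_borel_measurable_def
    by (rule measurable_cong[THEN iffD1, rotated]) (auto simp: indicator_def)
  show ?thesis
    unfolding L1_def
  proof (rule set_integrable_bound[OF _ meas])
    show "set_integrable lborel {0<..<L} (\<lambda>x. B * v x)"
      using assms(1) unfolding L1_def by simp
    show "AE x in lborel. x \<in> {0<..<L} \<longrightarrow> norm (v x * w x) \<le> norm (B * v x)"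
    proof (intro AE_I2 impI)
      fix x assume "x \<in> {0<..<L}"
      then have "\<bar>w x\<bar> \<le> \<bar>B\<bar>" using B[of x] by force
      then show "norm (v x * w x) \<le> norm (B * v x)"
        by (simp add: abs_mult mult.commute[of "\<bar>v x\<bar>"] mult_right_mono)
    qed
  qed
qed

text \<open>Negligible sets are the null sets of the completion; this and the converse below
  translate between \<open>AE\<close> statements and the spike rules of the gauge integral.\<close>

lemma AE_lborel_negligible:
  assumes "AE x in lborel. P (x::real)"
  obtains N where "negligible N" "\<And>x. x \<notin> N \<Longrightarrow> P x"
proof -
  have "AE x in lebesgue. P x" using assms by (rule AE_completion)
  then obtain N where "N \<in> null_sets lebesgue" "{x. \<not> P x} \<subseteq> N"
    unfolding eventually_ae_filter by auto
  then show ?thesis using that[of N] by (auto simp: negligible_iff_null_sets)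
qed

lemma negligible_AE_lborel:
  assumes "negligible N" "\<And>x. x \<notin> N \<Longrightarrow> P x"
  shows "AE x in lborel. P (x::real)"
proof -
  have "AE x in lebesgue. P x"
    using assms by (auto simp: negligible_iff_null_sets intro: AE_I')
  then show ?thesis by (simp add: AE_completion_iff)
qed

lemma AE_integral_cong:
  fixes f g :: "real \<Rightarrow> real"
  assumes "AE x in lborel. x \<in> {0<..<L} \<longrightarrow> f x = g x" "0 \<le> a" "b \<le> L"
  shows "integral {a..b} f = integral {a..b} g"
proof -
  obtain N where N: "negligible N" "\<And>x. x \<notin> N \<Longrightarrow> x \<in> {0<..<L} \<longrightarrow> f x = g x"
    using AE_lborel_negligible[OF assms(1)] by blast
  have "negligible (N \<union> {0, L})" using N(1) by simp
  then show ?thesis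
    by (rule integral_spike) (use N(2) assms(2,3) in force)
qed

lemma AE_LINT_cong:
  fixes f g :: "real \<Rightarrow> real"
  assumes "AE x in lborel. x \<in> {0<..<L} \<longrightarrow> f x = g x" "L1 L f" "L1 L g"
  shows "(LINT x:{0<..<L}|lborel. f x) = (LINT x:{0<..<L}|lborel. g x)"
  using AE_integral_cong[OF assms(1), of 0 L] assms(2,3) by (simp add: L1_LINT)

text \<open>Lebesgue's differentiation theorem. Right difference quotients suffice: they determine
  \<open>v\<close> almost everywhere, and the argument on zero sets below looks only to the
  right.\<close>

lemma L1_right_derivative:
  assumes "L1 L v"
  shows "AE x in lborel. x \<in> {0<..<L} \<longrightarrow>
    ((\<lambda>h. integral {x..x+h} v / h) \<longlongrightarrow> v x) (at_right 0)"
proof -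
  \<comment> \<open>Extension by zero gives integrability on every interval of the line; for small
    \<open>h\<close> the averaging window stays inside \<open>{0..L}\<close>, so the averages are
    those of \<open>v\<close>.\<close>
  define f where "f x = (if x \<in> {0..L} then v x else 0)" for x
  have "v integrable_on {0..L}" using L1_integrable_on[OF assms] by auto
  then have "f integrable_on UNIV" unfolding f_def
    by (rule integrable_restrict_UNIV[THEN iffD2])
  then have "f integrable_on cbox a b" for a b
    by (rule integrable_on_subcbox) simp
  from integrable_ccontinuous_explicit[OF this]
  obtain N where N: "negligible N" and
    d: "\<And>x e. \<lbrakk>x \<notin> N; 0 < e\<rbrakk> \<Longrightarrow> \<exists>d>0. \<forall>h. 0 < h \<and> h < d \<longrightarrow>
                         norm(integral (cbox x (x + h *\<^sub>R One)) f /\<^sub>R h ^ DIM(real) - f x) < e"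
    by blast
  have "((\<lambda>h. integral {x..x+h} v / h) \<longlongrightarrow> v x) (at_right 0)" if x: "x \<notin> N" "x \<in> {0<..<L}" for x
  proof (rule tendstoI)
    fix e :: real assume "0 < e"
    from d[OF x(1) this] obtain d where d0: "d > 0" and
      d: "\<And>h. 0 < h \<Longrightarrow> h < d \<Longrightarrow> norm(integral (cbox x (x + h *\<^sub>R One)) f /\<^sub>R h ^ DIM(real) - f x) < e"
      by blast
    have "dist (integral {x..x+h} v / h) (v x) < e" if "0 < h" "h < min d (L - x)" for h
    proof -
      have "integral {x..x+h} v = integral {x..x+h} f"
        by (rule integral_cong) (use that x in \<open>auto simp: f_def\<close>)
      moreover have "f x = v x" using x by (auto simp: f_def)
      ultimately show ?thesis using d[of h] that
        by (simp add: dist_real_def divide_inverse_commute)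
    qed
    moreover have "0 < min d (L - x)" using d0 x by auto
    ultimately show "\<forall>\<^sub>F h in at_right 0. dist (integral {x..x+h} v / h) (v x) < e"
      unfolding eventually_at_right_field by (intro exI[of _ "min d (L - x)"]) simp
  qed
  then show ?thesis by (intro negligible_AE_lborel[OF N]) auto
qed

lemma L1_AE_zero:
  assumes "L1 L v" "\<And>a b. 0 < a \<Longrightarrow> a < b \<Longrightarrow> b < L \<Longrightarrow> integral {a..b} v = 0"
  shows "AE x in lborel. x \<in> {0<..<L} \<longrightarrow> v x = 0"
  using L1_right_derivative[OF assms(1)]
proof eventually_elim
  case (elim x)
  show ?case
  proof
    assume x: "x \<in> {0<..<L}"
    have z: "integral {x..x+h} v / h = 0" if "0 < h" "h < L - x" for h
      using assms(2)[of x "x+h"] that x by simp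
    have "\<forall>\<^sub>F h in at_right 0. integral {x..x+h} v / h = 0"
      unfolding eventually_at_right_field using z x by (intro exI[of _ "L - x"]) simp
    then have "((\<lambda>h. integral {x..x+h} v / h) \<longlongrightarrow> 0) (at_right 0)"
      by (rule tendsto_eventually)
    moreover have "((\<lambda>h. integral {x..x+h} v / h) \<longlongrightarrow> v x) (at_right 0)"
      using elim x by blast
    ultimately show "v x = 0"
      using tendsto_unique[OF trivial_limit_at_right_real] by blast
  qed
qed

lemma L1_AE_zero_indefinite:
  assumes "L1 L v" "\<And>x. x \<in> {0..L} \<Longrightarrow> integral {0..x} v = 0"
  shows "AE x in lborel. x \<in> {0<..<L} \<longrightarrow> v x = 0"
proof (rule L1_AE_zero[OF assms(1)])
  fix a b :: real assume ab: "0 < a" "a < b" "b < L"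
  have "integral {0..a} v + integral {a..b} v = integral {0..b} v"
    by (rule Henstock_Kurzweil_Integration.integral_combine) (use ab L1_integrable_on[OF assms(1)] in auto)
  then show "integral {a..b} v = 0" using assms(2)[of a] assms(2)[of b] ab by auto
qed

lemma L1_AE_eqI:
  assumes "L1 L v" "L1 L w" "\<And>x. x \<in> {0..L} \<Longrightarrow> integral {0..x} v = integral {0..x} w"
  shows "AE x in lborel. x \<in> {0<..<L} \<longrightarrow> v x = w x"
proof -
  have "integral {0..x} (\<lambda>x. v x - w x) = 0" if "x \<in> {0..L}" for x
    using assms(3)[OF that] that L1_integrable_on[OF assms(1), of 0 x] L1_integrable_on[OF assms(2), of 0 x]
    by (simp add: Henstock_Kurzweil_Integration.integral_diff)
  from L1_AE_zero_indefinite[OF L1_diff[OF assms(1,2)] this] show ?thesis by auto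
qed

text \<open>Absolute continuity is encoded by the integral identity itself, with the density
  \<open>v\<close> as a parameter. So \<open>u\<close> is the continuous representative on the
  closed interval, endpoint values included, and \<open>v\<close> is fixed only up to null
  sets.\<close>

definition abs_cont :: "real \<Rightarrow> (real \<Rightarrow> real) \<Rightarrow> (real \<Rightarrow> real) \<Rightarrow> bool" where
  "abs_cont L u v \<longleftrightarrow> L1 L v \<and> (\<forall>x\<in>{0..L}. u x = u 0 + integral {0..x} v)"

lemma abs_cont_L1: "abs_cont L u v \<Longrightarrow> L1 L v"
  unfolding abs_cont_def by blast

lemma abs_cont_eq: "abs_cont L u v \<Longrightarrow> x \<in> {0..L} \<Longrightarrow> u x = u 0 + integral {0..x} v"
  unfolding abs_cont_def by blast

lemma abs_cont_continuous: "abs_cont L u v \<Longrightarrow> continuous_on {0..L} u"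
proof -
  assume u: "abs_cont L u v"
  then have "continuous_on {0..L} (\<lambda>x. u 0 + integral {0..x} v)"
    by (intro continuous_intros L1_indefinite_continuous) (rule abs_cont_L1)
  then show ?thesis by (rule continuous_on_eq) (rule abs_cont_eq[OF u, symmetric])
qed

lemma abs_cont_diff:
  assumes "abs_cont L u v" "0 \<le> a" "a \<le> b" "b \<le> L"
  shows "u b - u a = integral {a..b} v"
proof -
  have "integral {0..a} v + integral {a..b} v = integral {0..b} v"
    using assms abs_cont_L1[OF assms(1)]
    by (intro Henstock_Kurzweil_Integration.integral_combine L1_integrable_on) auto
  moreover have "u b = u 0 + integral {0..b} v" "u a = u 0 + integral {0..a} v"
    using assms by (auto intro!: abs_cont_eq[OF assms(1)])
  ultimately show ?thesis by linarith
qed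

text \<open>Both factors are merely integrable, so this is Fubini for \<open>V y * K r\<close> on
  the square over \<open>{0<..<X}\<close>, cut along the diagonal: each term on the left is the
  integral over one of the two triangles, and the whole square gives the product.\<close>

lemma integral_mult_by_parts:
  assumes v: "L1 L v" and k: "L1 L k" and X: "X \<in> {0..L}"
  shows "integral {0..X} (\<lambda>y. v y * integral {0..y} k) + integral {0..X} (\<lambda>y. k y * integral {0..y} v)
    = integral {0..X} v * integral {0..X} k"
proof -
  define V where "V = (\<lambda>y. indicat_real {0<..<X} y * v y)"
  define K where "K = (\<lambda>y. indicat_real {0<..<X} y * k y)"
  have intV: "integrable lborel V"
  proof -
    have "set_integrable lborel {0<..<X} v"
      using v unfolding L1_def by (rule set_integrable_subset) (use X in auto)
    then show ?thesis by (simp add: set_integrable_def V_def)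
  qed
  have intK: "integrable lborel K"
  proof -
    have "set_integrable lborel {0<..<X} k"
      using k unfolding L1_def by (rule set_integrable_subset) (use X in auto)
    then show ?thesis by (simp add: set_integrable_def K_def)
  qed
  have [measurable]: "V \<in> borel_measurable borel" "K \<in> borel_measurable borel"
    using borel_measurable_integrable[OF intV] borel_measurable_integrable[OF intK] by simp_all
  have cK: "continuous_on {0..L} (\<lambda>y. integral {0..y} k)"
    and cV: "continuous_on {0..L} (\<lambda>y. integral {0..y} v)"
    by (rule L1_indefinite_continuous[OF k], rule L1_indefinite_continuous[OF v])
  have prod: "integrable (lborel \<Otimes>\<^sub>M lborel) (\<lambda>(y, r). V y * K r)"
  proof (rule lborel_pair.Fubini_integrable)
    show "integrable lborel (\<lambda>x. \<integral>y. norm (case (x, y) of (y, r) \<Rightarrow> V y * K r) \<partial>lborel)"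
      using intV by (simp add: abs_mult)
    show "AE x in lborel. integrable lborel (\<lambda>y. case (x, y) of (y, r) \<Rightarrow> V y * K r)"
      using intK by simp
  qed measurable
  have dom: "integrable (lborel \<Otimes>\<^sub>M lborel) (\<lambda>(y, r). indicat_real {(y,r). r < y} (y,r) * (V y * K r))"
    by (rule Bochner_Integration.integrable_bound[OF prod]) (auto simp: indicator_def split_beta')
  have dom': "integrable (lborel \<Otimes>\<^sub>M lborel) (\<lambda>(y, r). indicat_real {(y,r). y \<le> r} (y,r) * (V y * K r))"
    by (rule Bochner_Integration.integrable_bound[OF prod]) (auto simp: indicator_def split_beta')
  have inner1: "(\<integral>r. indicat_real {(y,r). r < y} (y,r) * (V y * K r) \<partial>lborel)
     = indicat_real {0<..<X} y *\<^sub>R (v y * integral {0..y} k)" for y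
  proof (cases "y \<in> {0<..<X}")
    case True
    have "(\<integral>r. indicat_real {(y,r). r < y} (y,r) * (V y * K r) \<partial>lborel)
       = (\<integral>r. v y * (indicat_real {0<..<y} r *\<^sub>R k r) \<partial>lborel)"
      using True by (intro Bochner_Integration.integral_cong) (auto simp: V_def K_def indicator_def)
    also have "\<dots> = v y * (LINT r:{0<..<y}|lborel. k r)"
      by (simp add: set_lebesgue_integral_def)
    also have "\<dots> = v y * integral {0..y} k"
      using L1_LINT_Ioo[OF k, of 0 y] True X by simp
    finally show ?thesis using True by simp
  qed (simp add: V_def)
  have inner2: "(\<integral>y. indicat_real {(y,r). y \<le> r} (y,r) * (V y * K r) \<partial>lborel)
     = indicat_real {0<..<X} r *\<^sub>R (k r * integral {0..r} v)" for r
  proof (cases "r \<in> {0<..<X}")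
    case True
    have "(\<integral>y. indicat_real {(y,r). y \<le> r} (y,r) * (V y * K r) \<partial>lborel)
       = (\<integral>y. k r * (indicat_real {0<..<r} y *\<^sub>R v y) \<partial>lborel)"
    proof (rule integral_cong_AE)
      show "(\<lambda>y. k r * indicat_real {0<..<r} y *\<^sub>R v y) \<in> borel_measurable lborel"
      proof -
        have "(\<lambda>y. k r * (indicat_real {0<..<r} y * V y)) \<in> borel_measurable lborel" by measurable
        then show ?thesis
          by (rule measurable_cong[THEN iffD1, rotated]) (use True in \<open>auto simp: V_def indicator_def\<close>)
      qed
      show "AE y in lborel. indicat_real {(y,r). y \<le> r} (y,r) * (V y * K r) = k r * indicat_real {0<..<r} y *\<^sub>R v y"
        using AE_lborel_singleton[of r]
        by eventually_elim (use True in \<open>auto simp: V_def K_def indicator_def\<close>)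
    qed measurable
    also have "\<dots> = k r * (LINT r:{0<..<r}|lborel. v r)"
      by (simp add: set_lebesgue_integral_def)
    also have "\<dots> = k r * integral {0..r} v"
      using L1_LINT_Ioo[OF v, of 0 r] True X by simp
    finally show ?thesis using True by simp
  qed (simp add: K_def)
  have "integral {0..X} (\<lambda>y. v y * integral {0..y} k) =
      (LINT y:{0<..<X}|lborel. v y * integral {0..y} k)"
    using L1_LINT_Ioo[OF L1_mult_continuous[OF v cK], of 0 X] X by simp
  also have "\<dots> = (\<integral>y. (\<integral>r. indicat_real {(y,r). r < y} (y,r) * (V y * K r) \<partial>lborel) \<partial>lborel)"
    unfolding set_lebesgue_integral_def inner1 ..
  also have "\<dots> = (\<integral>(y,r). indicat_real {(y,r). r < y} (y,r) * (V y * K r) \<partial>(lborel \<Otimes>\<^sub>M lborel))"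
    by (rule lborel_pair.integral_fst[OF dom])
  finally have 1: "integral {0..X} (\<lambda>y. v y * integral {0..y} k) = \<dots>" .
  have "integral {0..X} (\<lambda>y. k y * integral {0..y} v) =
      (LINT y:{0<..<X}|lborel. k y * integral {0..y} v)"
    using L1_LINT_Ioo[OF L1_mult_continuous[OF k cV], of 0 X] X by simp
  also have "\<dots> = (\<integral>r. (\<integral>y. indicat_real {(y,r). y \<le> r} (y,r) * (V y * K r) \<partial>lborel) \<partial>lborel)"
    unfolding set_lebesgue_integral_def inner2 ..
  also have "\<dots> = (\<integral>(y,r). indicat_real {(y,r). y \<le> r} (y,r) * (V y * K r) \<partial>(lborel \<Otimes>\<^sub>M lborel))"
    by (rule lborel_pair.integral_snd[OF dom'])
  finally have 2: "integral {0..X} (\<lambda>y. k y * integral {0..y} v) = \<dots>" .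
  have "integral {0..X} (\<lambda>y. v y * integral {0..y} k) + integral {0..X} (\<lambda>y. k y * integral {0..y} v)
    = (\<integral>(y,r). V y * K r \<partial>(lborel \<Otimes>\<^sub>M lborel))"
    unfolding 1 2 Bochner_Integration.integral_add[OF dom dom', symmetric]
    by (intro Bochner_Integration.integral_cong) (auto simp: indicator_def)
  also have "\<dots> = (\<integral>y. (\<integral>r. V y * K r \<partial>lborel) \<partial>lborel)"
    by (rule lborel_pair.integral_fst[OF prod, symmetric])
  also have "\<dots> = (\<integral>y. V y \<partial>lborel) * (\<integral>r. K r \<partial>lborel)"
    by simp
  also have "(\<integral>y. V y \<partial>lborel) = integral {0..X} v"
    using L1_LINT_Ioo[OF v, of 0 X] X by (simp add: V_def set_lebesgue_integral_def)
  also have "(\<integral>y. K y \<partial>lborel) = integral {0..X} k"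
    using L1_LINT_Ioo[OF k, of 0 X] X by (simp add: K_def set_lebesgue_integral_def)
  finally show ?thesis .
qed

text \<open>With both factors written as value at 0 plus primitive, the product of the two
  primitives is the only term that is not linear in them, and \<open>integral_mult_by_parts\<close>
  settles it.\<close>

lemma abs_cont_mult:
  assumes "abs_cont L u v" "abs_cont L w k"
  shows "abs_cont L (\<lambda>x. u x * w x) (\<lambda>x. v x * w x + k x * u x)"
  unfolding abs_cont_def
proof
  note v = abs_cont_L1[OF assms(1)] and k = abs_cont_L1[OF assms(2)]
  note cu = abs_cont_continuous[OF assms(1)] and cw = abs_cont_continuous[OF assms(2)]
  have Lv: "L1 L (\<lambda>x. v x * w x)" and Lk: "L1 L (\<lambda>x. k x * u x)"
    by (rule L1_mult_continuous[OF v cw], rule L1_mult_continuous[OF k cu])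
  then show "L1 L (\<lambda>x. v x * w x + k x * u x)" by (rule L1_add)
  have cK: "continuous_on {0..L} (\<lambda>y. integral {0..y} k)"
    and cV: "continuous_on {0..L} (\<lambda>y. integral {0..y} v)"
    by (rule L1_indefinite_continuous[OF k], rule L1_indefinite_continuous[OF v])
  note Lv' = L1_mult_continuous[OF v cK] and Lk' = L1_mult_continuous[OF k cV]
  show "\<forall>x\<in>{0..L}. u x * w x = u 0 * w 0 + integral {0..x} (\<lambda>x. v x * w x + k x * u x)"
  proof
    fix x assume x: "x \<in> {0..L}"
    have "integral {0..x} (\<lambda>x. v x * w x + k x * u x) =
      integral {0..x} (\<lambda>y. w 0 * v y + u 0 * k y + (v y * integral {0..y} k + k y * integral {0..y} v))"
    proof (rule integral_cong)
      fix y assume "y \<in> {0..x}"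
      then have "w y = w 0 + integral {0..y} k" "u y = u 0 + integral {0..y} v"
        using x abs_cont_eq[OF assms(2), of y] abs_cont_eq[OF assms(1), of y] by auto
      then show "v y * w y + k y * u y = w 0 * v y + u 0 * k y + (v y * integral {0..y} k + k y * integral {0..y} v)"
        by (simp only: algebra_simps)
    qed
    also have "\<dots> = w 0 * integral {0..x} v + u 0 * integral {0..x} k +
       (integral {0..x} (\<lambda>y. v y * integral {0..y} k) + integral {0..x} (\<lambda>y. k y * integral {0..y} v))"
    proof (rule integral_unique, intro has_integral_add has_integral_mult_right integrable_integral)
      show "v integrable_on {0..x}" "k integrable_on {0..x}"
        "(\<lambda>y. v y * integral {0..y} k) integrable_on {0..x}"
        "(\<lambda>y. k y * integral {0..y} v) integrable_on {0..x}"
        using x by (auto intro: L1_integrable_on[OF v] L1_integrable_on[OF k] L1_integrable_on[OF Lv'] L1_integrable_on[OF Lk'])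
    qed
    also have "\<dots> = (u 0 + integral {0..x} v) * (w 0 + integral {0..x} k) - u 0 * w 0"
      using integral_mult_by_parts[OF v k x] by (simp add: algebra_simps)
    also have "\<dots> = u x * w x - u 0 * w 0"
      using abs_cont_eq[OF assms(2) x] abs_cont_eq[OF assms(1) x] by simp
    finally show "u x * w x = u 0 * w 0 + integral {0..x} (\<lambda>x. v x * w x + k x * u x)" by simp
  qed
qed

section \<open>Weak derivatives\<close>

text \<open>Almost everywhere equal functions have equal primitives; differentiating these,
  one-sidedly at the endpoints, gives the values back.\<close>

lemma continuous_AE_eq:
  fixes f g :: "real \<Rightarrow> real"
  assumes "0 < L" "continuous_on {0..L} f" "continuous_on {0..L} g"
    and "AE x in lborel. x \<in> {0<..<L} \<longrightarrow> f x = g x" and x: "x \<in> {0..L}"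
  shows "f x = g x"
proof -
  have *: "integral {0..y} f = integral {0..y} g" if "y \<in> {0..L}" for y
    using AE_integral_cong[OF assms(4), of 0 y] that by auto
  have "((\<lambda>y. integral {0..y} g) has_vector_derivative g x) (at x within {0..L})"
    by (rule integral_has_vector_derivative) fact+
  then have "((\<lambda>y. integral {0..y} f) has_vector_derivative g x) (at x within {0..L})"
    by (rule has_vector_derivative_transform[OF x, rotated]) (simp add: *)
  moreover have "((\<lambda>y. integral {0..y} f) has_vector_derivative f x) (at x within {0..L})"
    by (rule integral_has_vector_derivative) fact+
  ultimately show ?thesis
    using vector_derivative_unique_within_closed_interval[of 0 L x] assms(1) x by simp
qed

lemma abs_cont_DERIV:
  assumes "\<And>x. x \<in> {0..L} \<Longrightarrow> (\<psi> has_real_derivative \<psi>' x) (at x within {0..L})" "continuous_on {0..L} \<psi>'"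
  shows "abs_cont L \<psi> \<psi>'"
  unfolding abs_cont_def
proof
  show "L1 L \<psi>'" by (rule continuous_L1) fact
  show "\<forall>x\<in>{0..L}. \<psi> x = \<psi> 0 + integral {0..x} \<psi>'"
  proof
    fix x assume x: "x \<in> {0..L}"
    have "(\<psi>' has_integral (\<psi> x - \<psi> 0)) {0..x}"
    proof (rule fundamental_theorem_of_calculus)
      show "(\<psi> has_vector_derivative \<psi>' y) (at y within {0..x})" if "y \<in> {0..x}" for y
        using assms(1)[of y] that x has_field_derivative_subset[of \<psi> "\<psi>' y" y "{0..L}" "{0..x}"]
        by (auto simp: has_real_derivative_iff_has_vector_derivative[symmetric])
    qed (use x in auto)
    then show "\<psi> x = \<psi> 0 + integral {0..x} \<psi>'" by (simp add: integral_unique)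
  qed
qed

lemma test_function_abs_cont:
  assumes "test_function L \<psi> \<psi>'"
  shows "abs_cont L \<psi> \<psi>'" "\<psi> 0 = 0" "\<psi> L = 0"
proof -
  show "abs_cont L \<psi> \<psi>'"
  proof (rule abs_cont_DERIV)
    show "(\<psi> has_real_derivative \<psi>' x) (at x within {0..L})" for x
      using assms unfolding test_function_def by (blast intro: has_field_derivative_at_within)
    show "continuous_on {0..L} \<psi>'"
      using assms continuous_on_subset[of UNIV \<psi>' "{0..L}"] unfolding test_function_def by simp
  qed
  show "\<psi> 0 = 0" "\<psi> L = 0"
  proof -
    obtain a b where "0 < a" "b < L" "\<And>x. x \<notin> {a..b} \<Longrightarrow> \<psi> x = 0"
      using assms unfolding test_function_def by blast
    then show "\<psi> 0 = 0" "\<psi> L = 0" by auto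
  qed
qed

lemma abs_cont_has_wderiv:
  assumes u: "abs_cont L u v" and "0 < L"
  shows "has_wderiv L u v"
  unfolding has_wderiv_def
proof (intro conjI allI impI)
  note v = abs_cont_L1[OF u] and cu = abs_cont_continuous[OF u]
  show Lu: "L1 L u" by (rule continuous_L1[OF cu])
  show "L1 L v" by fact
  fix \<psi> \<psi>' assume "test_function L \<psi> \<psi>'"
  note \<psi> = test_function_abs_cont[OF this]
  note m = abs_cont_mult[OF u \<psi>(1)]
  note L2 = L1_mult_continuous[OF v abs_cont_continuous[OF \<psi>(1)]]
  note L3 = L1_mult_continuous[OF abs_cont_L1[OF \<psi>(1)] cu]
  have "integral {0..L} (\<lambda>x. v x * \<psi> x + \<psi>' x * u x) = 0"
    using abs_cont_eq[OF m, of L] \<psi> assms(2) by simp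
  then have "integral {0..L} (\<lambda>x. v x * \<psi> x) + integral {0..L} (\<lambda>x. \<psi>' x * u x) = 0"
    using L1_integrable_on[OF L2, of 0 L] L1_integrable_on[OF L3, of 0 L]
    by (simp add: Henstock_Kurzweil_Integration.integral_add)
  then show "(LINT x:{0<..<L}|lborel. u x * \<psi>' x) = - (LINT x:{0<..<L}|lborel. v x * \<psi> x)"
    using L1_LINT[OF L2] L1_LINT[OF L3] by (simp add: mult.commute[of "u _"])
qed

lemma LBINT_DERIV:
  fixes f :: "real \<Rightarrow> real"
  assumes f: "continuous_on UNIV f"
  shows "((\<lambda>u. LBINT y=0..u. f y) has_real_derivative f x) (at x)"
proof -
  define c where "c = \<bar>x\<bar> + 1"
  have "((\<lambda>u. LBINT y=0..u. f y) has_vector_derivative f x) (at x within {-c..c})"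
    unfolding zero_ereal_def
    by (rule interval_integral_FTC2) (auto simp: c_def intro: continuous_on_subset[OF f])
  then have "((\<lambda>u. LBINT y=0..u. f y) has_vector_derivative f x) (at x)"
    by (subst (asm) at_within_interior) (auto simp: c_def)
  then show ?thesis by (simp add: has_real_derivative_iff_has_vector_derivative)
qed

text \<open>The vanishing mean brings the primitive back to zero beyond the support of
  \<open>f\<close>, so it has compact support in the open interval.\<close>

lemma test_function_antiderivative:
  assumes f: "continuous_on UNIV f" and ab: "0 < a" "a < b" "b < L" "\<And>x. x \<notin> {a..b} \<Longrightarrow> f x = 0"
    and 0: "integral {0..L} f = 0"
  obtains \<psi> where "test_function L \<psi> f"
proof -
  define \<psi> where "\<psi> u = (LBINT y=0..u. f y)" for u :: real
  have D: "(\<psi> has_real_derivative f x) (at x)" for x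
    unfolding \<psi>_def by (rule LBINT_DERIV[OF f])
  have I: "integral {u..v} f = \<psi> v - \<psi> u" if "u \<le> v" for u v
    using that D by (intro integral_unique fundamental_theorem_of_calculus)
      (auto simp: has_real_derivative_iff_has_vector_derivative has_vector_derivative_at_within)
  have p0: "\<psi> 0 = 0" by (simp add: \<psi>_def zero_ereal_def)
  have pL: "\<psi> L = 0" using I[of 0 L] 0 p0 ab by simp
  have "\<psi> x = 0" if "x \<notin> {a..b}" for x
  proof (cases "x < a")
    case True
    have "integral {min x 0..max x 0} f = integral {min x 0..max x 0} (\<lambda>x. 0)"
      by (rule integral_cong, rule ab) (use True ab in auto)
    then show ?thesis using I[of x 0] I[of 0 x] p0 by (cases "x \<le> 0") (auto simp: min_def max_def)
  next
    case False
    have "integral {min x L..max x L} f = integral {min x L..max x L} (\<lambda>x. 0)"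
      by (rule integral_cong, rule ab) (use that False ab in auto)
    then show ?thesis using I[of x L] I[of L x] pL by (cases "x \<le> L") (auto simp: min_def max_def)
  qed
  then have "test_function L \<psi> f"
    unfolding test_function_def using D f ab by (intro conjI allI exI[of _ a] exI[of _ b]) auto
  then show ?thesis by (rule that)
qed

text \<open>Derivatives of test functions have mean zero, so an arbitrary continuous \<theta> with
  compact support is corrected by a multiple of a fixed bump \<rho>; the effect of the correction is
  the constant \<open>c\<close>. Letting \<theta> tend to indicators of intervals shows that all
  averages of \<open>w - c\<close> vanish.\<close>

lemma du_Bois_Reymond:
  assumes w: "L1 L w" and L: "0 < L"
    and z: "\<And>\<psi> \<psi>'. test_function L \<psi> \<psi>' \<Longrightarrow> (LINT x:{0<..<L}|lborel. w x * \<psi>' x) = 0"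
  obtains c where "AE x in lborel. x \<in> {0<..<L} \<longrightarrow> w x = c"
proof -
  \<comment> \<open>A tent over the middle third. Continuity is enough, because \<rho> becomes part
    of the derivative of a test function.\<close>
  define \<rho> where "\<rho> x = max 0 (min (x - L/3) (2*L/3 - x))" for x
  have c\<rho>: "continuous_on A \<rho>" for A unfolding \<rho>_def by (intro continuous_intros)
  define r where "r = integral {0..L} \<rho>"
  have "r \<noteq> 0"
  proof
    assume "r = 0"
    then have "\<forall>x\<in>{0..L}. \<rho> x = 0"
      unfolding r_def using L integral_eq_0_iff[OF c\<rho>[of "{0..L}"]] by (simp add: \<rho>_def)
    moreover have "L/2 \<in> {0..L}" "\<rho> (L/2) \<noteq> 0" using L by (auto simp: \<rho>_def)
    ultimately show False by blast
  qed
  define c where "c = integral {0..L} (\<lambda>x. w x * \<rho> x) / r"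
  have key: "integral {0..L} (\<lambda>x. (w x - c) * \<theta> x) = 0"
    if \<theta>: "continuous_on UNIV \<theta>" "0 < a" "b < L" "\<And>x. x \<notin> {a..b} \<Longrightarrow> \<theta> x = 0" for \<theta> a b
  proof -
    define m where "m = integral {0..L} \<theta> / r"
    define f where "f x = \<theta> x - m * \<rho> x" for x
    have i\<theta>: "\<theta> integrable_on {0..L}" and i\<rho>: "\<rho> integrable_on {0..L}"
      by (auto intro!: integrable_continuous_real c\<rho> continuous_on_subset[OF \<theta>(1)])
    have cf: "continuous_on UNIV f" unfolding f_def by (intro continuous_intros \<theta> c\<rho>)
    have "integral {0..L} f = 0"
      unfolding f_def using i\<theta> i\<rho> \<open>r \<noteq> 0\<close>
      by (simp add: Henstock_Kurzweil_Integration.integral_diff integrable_on_mult_right m_def r_def)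
    moreover have "f x = 0" if "x \<notin> {min a (L/3)..max b (2*L/3)}" for x
    proof -
      have "\<theta> x = 0" by (rule \<theta>(4)) (use that in auto)
      then show ?thesis using that by (auto simp: f_def \<rho>_def)
    qed
    moreover have "0 < min a (L/3)" "min a (L/3) < max b (2*L/3)" "max b (2*L/3) < L"
      using \<theta>(2,3) L by (auto simp: min_def max_def)
    ultimately obtain \<psi> where "test_function L \<psi> f"
      using test_function_antiderivative[OF cf, of "min a (L/3)" "max b (2*L/3)" L] by blast
    from z[OF this] have "(LINT x:{0<..<L}|lborel. w x * f x) = 0" .
    moreover have "L1 L (\<lambda>x. w x * f x)"
      by (rule L1_mult_continuous[OF w continuous_on_subset[OF cf]]) auto
    ultimately have 0: "integral {0..L} (\<lambda>x. w x * f x) = 0" by (simp add: L1_LINT)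
    have iw\<theta>: "(\<lambda>x. w x * \<theta> x) integrable_on {0..L}"
      by (rule L1_integrable_on[OF L1_mult_continuous[OF w continuous_on_subset[OF \<theta>(1)]]]) auto
    have iw\<rho>: "(\<lambda>x. w x * \<rho> x) integrable_on {0..L}"
      by (rule L1_integrable_on[OF L1_mult_continuous[OF w c\<rho>]]) auto
    have "integral {0..L} (\<lambda>x. w x * f x) = integral {0..L} (\<lambda>x. w x * \<theta> x - m * (w x * \<rho> x))"
      by (rule integral_cong) (simp add: f_def algebra_simps)
    also have "\<dots> = integral {0..L} (\<lambda>x. w x * \<theta> x) - m * integral {0..L} (\<lambda>x. w x * \<rho> x)"
      using iw\<theta> iw\<rho> by (simp add: Henstock_Kurzweil_Integration.integral_diff integrable_on_mult_right)
    also have "m * integral {0..L} (\<lambda>x. w x * \<rho> x) = c * integral {0..L} \<theta>"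
      by (simp add: m_def c_def)
    also have "integral {0..L} (\<lambda>x. w x * \<theta> x) - c * integral {0..L} \<theta> =
       integral {0..L} (\<lambda>x. w x * \<theta> x - c * \<theta> x)"
      using iw\<theta> i\<theta> by (simp add: Henstock_Kurzweil_Integration.integral_diff integrable_on_mult_right)
    finally show ?thesis using 0 by (simp add: left_diff_distrib)
  qed
  have wc: "L1 L (\<lambda>x. w x - c)"
    by (rule L1_diff[OF w continuous_L1]) simp
  have "AE x in lborel. x \<in> {0<..<L} \<longrightarrow> w x - c = 0"
  proof (rule L1_AE_zero[OF wc])
    fix a b :: real assume ab: "0 < a" "a < b" "b < L"
    \<comment> \<open>Trapezoids with flanks of slope \<open>n\<close>, supported in
      \<open>{a..b}\<close> and converging pointwise to the indicator of the open interval; their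
      values in \<open>{0..1}\<close> give the majorant for dominated convergence.\<close>
    define \<theta> where "\<theta> n x = max 0 (min 1 (min (real n * (x - a)) (real n * (b - x))))" for n x
    have c\<theta>: "continuous_on A (\<theta> n)" for n A unfolding \<theta>_def by (intro continuous_intros)
    have 0: "integral {0..L} (\<lambda>x. (w x - c) * \<theta> n x) = 0" for n
    proof (rule key[OF c\<theta> ab(1,3)])
      fix x assume "x \<notin> {a..b}"
      then have "real n * (x - a) \<le> 0 \<or> real n * (b - x) \<le> 0"
        by (auto simp: mult_le_0_iff)
      then show "\<theta> n x = 0" by (auto simp: \<theta>_def)
    qed
    have "(\<lambda>n. integral {0..L} (\<lambda>x. (w x - c) * \<theta> n x)) \<longlonglongrightarrow>
        integral {0..L} (\<lambda>x. (w x - c) * indicator {a<..<b} x)"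
    proof (rule dominated_convergence(2)[where h = "\<lambda>x. \<bar>w x - c\<bar>"])
      show "(\<lambda>x. (w x - c) * \<theta> n x) integrable_on {0..L}" for n
        by (rule L1_integrable_on[OF L1_mult_continuous[OF wc c\<theta>]]) auto
      show "(\<lambda>x. \<bar>w x - c\<bar>) integrable_on {0..L}"
        using L1_absolutely_integrable[OF wc, of 0 L] by (simp add: absolutely_integrable_on_def)
      show "norm ((w x - c) * \<theta> n x) \<le> \<bar>w x - c\<bar>" for n x
        by (auto simp: abs_mult \<theta>_def intro!: mult_left_le)
      show "(\<lambda>n. (w x - c) * \<theta> n x) \<longlonglongrightarrow> (w x - c) * indicator {a<..<b} x" for x
      proof (intro tendsto_mult_left tendsto_eventually)
        show "\<forall>\<^sub>F n in sequentially. \<theta> n x = indicator {a<..<b} x"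
        proof (cases "x \<in> {a<..<b}")
          case True
          have "\<forall>\<^sub>F n in sequentially. real n \<ge> 1 / (x - a)" "\<forall>\<^sub>F n in sequentially. real n \<ge> 1 / (b - x)"
            using filterlim_real_sequentially by (auto simp: filterlim_at_top)
          then show ?thesis
            by eventually_elim (use True in \<open>auto simp: \<theta>_def field_simps\<close>)
        next
          case False
          have *: "real n * (x - a) \<le> 0 \<or> real n * (b - x) \<le> 0" for n
            using False by (auto simp: mult_le_0_iff)
          have "\<theta> n x = 0" for n
            unfolding \<theta>_def using *[of n] by (intro max_absorb1) (simp add: min_le_iff_disj)
          then show ?thesis using False by simp
        qed
      qed
    qed
    then have "integral {0..L} (\<lambda>x. (w x - c) * indicator {a<..<b} x) = 0"
      unfolding 0 by (simp add: LIMSEQ_const_iff)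
    also have "integral {0..L} (\<lambda>x. (w x - c) * indicator {a<..<b} x) =
       integral {0..L} (\<lambda>x. if x \<in> {a<..<b} then w x - c else 0)"
      by (rule integral_cong) (auto simp: indicator_def)
    also have "\<dots> = integral ({0..L} \<inter> {a<..<b}) (\<lambda>x. w x - c)"
      using Henstock_Kurzweil_Integration.integral_restrict_Int[of "{0..L}" "{a<..<b}" "\<lambda>x. w x - c"]
      by (simp only: Int_commute)
    also have "{0..L} \<inter> {a<..<b} = {a<..<b}" using ab by auto
    finally show "integral {a..b} (\<lambda>x. w x - c) = 0"
      by (simp add: integral_open_interval_real)
  qed
  then show ?thesis using that[of c] by auto
qed

lemma has_wderivD:
  assumes "has_wderiv L u v" "test_function L \<psi> \<psi>'"
  shows "(LINT x:{0<..<L}|lborel. u x * \<psi>' x) = - (LINT x:{0<..<L}|lborel. v x * \<psi> x)"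
  using assms unfolding has_wderiv_def by blast

text \<open>The primitive of \<open>v\<close> has weak derivative \<open>v\<close> as well, so
  \<open>u\<close> minus this primitive is annihilated by all derivatives of test functions and is
  constant almost everywhere.\<close>

lemma has_wderiv_abs_cont:
  assumes "has_wderiv L u v" "0 < L"
  obtains U where "abs_cont L U v" "AE x in lborel. x \<in> {0<..<L} \<longrightarrow> U x = u x"
proof -
  have Lu: "L1 L u" and Lv: "L1 L v" using assms(1) by (auto simp: has_wderiv_def)
  define V where "V x = integral {0..x} v" for x
  have V: "abs_cont L V v" unfolding abs_cont_def V_def using Lv by simp
  have LV: "L1 L V" by (rule continuous_L1[OF abs_cont_continuous[OF V]])
  have wu: "(LINT x:{0<..<L}|lborel. u x * \<psi>' x) = - (LINT x:{0<..<L}|lborel. v x * \<psi> x)"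
    and wV: "(LINT x:{0<..<L}|lborel. V x * \<psi>' x) = - (LINT x:{0<..<L}|lborel. v x * \<psi> x)"
    if "test_function L \<psi> \<psi>'" for \<psi> \<psi>'
    using has_wderivD[OF assms(1) that] has_wderivD[OF abs_cont_has_wderiv[OF V assms(2)] that] .
  have "(LINT x:{0<..<L}|lborel. (u x - V x) * \<psi>' x) = 0" if "test_function L \<psi> \<psi>'" for \<psi> \<psi>'
  proof -
    have c: "continuous_on {0..L} \<psi>'" using that continuous_on_subset[of UNIV \<psi>' "{0..L}"] by (simp add: test_function_def)
    have "(LINT x:{0<..<L}|lborel. (u x - V x) * \<psi>' x) =
      (LINT x:{0<..<L}|lborel. u x * \<psi>' x) - (LINT x:{0<..<L}|lborel. V x * \<psi>' x)"
      unfolding left_diff_distrib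
      by (rule set_integral_diff(2)) (use L1_mult_continuous[OF Lu c] L1_mult_continuous[OF LV c] in \<open>simp_all only: L1_def\<close>)
    also have "\<dots> = 0"
      using wu[OF that] wV[OF that] by simp
    finally show ?thesis .
  qed
  then obtain c where c: "AE x in lborel. x \<in> {0<..<L} \<longrightarrow> u x - V x = c"
    using du_Bois_Reymond[OF L1_diff[OF Lu LV] assms(2)] by metis
  show ?thesis
  proof (rule that[of "\<lambda>x. V x + c"])
    show "abs_cont L (\<lambda>x. V x + c) v" unfolding abs_cont_def V_def using Lv by simp
    show "AE x in lborel. x \<in> {0<..<L} \<longrightarrow> V x + c = u x" using c by eventually_elim force
  qed
qed

lemma abs_cont_deriv_unique:
  assumes "abs_cont L u v" "abs_cont L u' v'" "0 < L" "AE x in lborel. x \<in> {0<..<L} \<longrightarrow> u x = u' x"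
  shows "AE x in lborel. x \<in> {0<..<L} \<longrightarrow> v x = v' x"
proof (rule L1_AE_eqI)
  show "L1 L v" "L1 L v'" using assms abs_cont_L1 by auto
  fix x assume x: "x \<in> {0..L}"
  have eq: "u y = u' y" if "y \<in> {0..L}" for y
    by (rule continuous_AE_eq[OF assms(3) abs_cont_continuous[OF assms(1)] abs_cont_continuous[OF assms(2)] assms(4) that])
  then show "integral {0..x} v = integral {0..x} v'"
    using abs_cont_eq[OF assms(1) x] abs_cont_eq[OF assms(2) x] eq[of 0] eq[OF x] x by auto
qed

lemma W11_has_wderiv: "W11 L u \<Longrightarrow> has_wderiv L u (wderiv L u)"
  unfolding W11_def wderiv_def by (erule someI_ex)

lemma W11_abs_cont:
  assumes "W11 L u" "0 < L"
  obtains U where "abs_cont L U (wderiv L u)" "AE x in lborel. x \<in> {0<..<L} \<longrightarrow> U x = u x"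
  using has_wderiv_abs_cont[OF W11_has_wderiv[OF assms(1)] assms(2)] .

lemma has_wderiv_AE:
  assumes U: "abs_cont L U v" and AE: "AE x in lborel. x \<in> {0<..<L} \<longrightarrow> U x = u x" and u: "L1 L u" and L: "0 < L"
  shows "has_wderiv L u v"
proof -
  note LU = continuous_L1[OF abs_cont_continuous[OF U]]
  note w = abs_cont_has_wderiv[OF U L]
  have "(LINT x:{0<..<L}|lborel. u x * \<psi>' x) = (LINT x:{0<..<L}|lborel. U x * \<psi>' x)"
    if "test_function L \<psi> \<psi>'" for \<psi> \<psi>'
  proof (rule AE_LINT_cong)
    have c: "continuous_on {0..L} \<psi>'" using that continuous_on_subset[of UNIV \<psi>' "{0..L}"] by (simp add: test_function_def)
    show "L1 L (\<lambda>x. u x * \<psi>' x)" "L1 L (\<lambda>x. U x * \<psi>' x)"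
      using L1_mult_continuous[OF u c] L1_mult_continuous[OF LU c] .
  qed (use AE in auto)
  with w u show ?thesis unfolding has_wderiv_def by auto
qed

text \<open>Ties the derivative selected by \<open>SOME\<close> to a concrete density: any
  absolutely continuous representative identifies \<open>wderiv\<close> up to a null set.\<close>

lemma abs_cont_W11:
  assumes U: "abs_cont L U v" and AE: "AE x in lborel. x \<in> {0<..<L} \<longrightarrow> U x = u x" and u: "L1 L u" and L: "0 < L"
  shows "W11 L u" "AE x in lborel. x \<in> {0<..<L} \<longrightarrow> wderiv L u x = v x"
proof -
  show W: "W11 L u" using has_wderiv_AE[OF assms] by (auto simp: W11_def)
  obtain U' where U': "abs_cont L U' (wderiv L u)" "AE x in lborel. x \<in> {0<..<L} \<longrightarrow> U' x = u x"
    using W11_abs_cont[OF W L] .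
  show "AE x in lborel. x \<in> {0<..<L} \<longrightarrow> wderiv L u x = v x"
  proof (rule abs_cont_deriv_unique[OF U'(1) U L])
    show "AE x in lborel. x \<in> {0<..<L} \<longrightarrow> U' x = U x"
      using U'(2) AE by eventually_elim auto
  qed
qed

text \<open>A zero of \<open>u\<close> at which the right derivative of \<open>u\<close> does not vanish is isolated from the right.\<close>

lemma countable_right_isolated:
  fixes N :: "real set"
  shows "countable {x\<in>N. \<exists>y>x. N \<inter> {x<..<y} = {}}"
proof -
  \<comment> \<open>A rational in the gap to the right of a point belongs to that point
    alone.\<close>
  define A where "A q = {x\<in>N. x < of_rat q \<and> N \<inter> {x<..<of_rat q} = {}}" for q :: rat
  have "countable (A q)" for q
  proof -
    have "x = y" if "x \<in> A q" "y \<in> A q" for x y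
      using that unfolding A_def by (cases x y rule: linorder_cases) auto
    then have "A q = {} \<or> (\<exists>x. A q = {x})" by blast
    then show ?thesis by auto
  qed
  moreover have "{x\<in>N. \<exists>y>x. N \<inter> {x<..<y} = {}} \<subseteq> (\<Union>q. A q)"
  proof clarsimp
    fix x y assume x: "x \<in> N" "x < y" "N \<inter> {x<..<y} = {}"
    then obtain q where "x < of_rat q" "of_rat q < y" using of_rat_dense by blast
    with x show "\<exists>q. x \<in> A q" by (intro exI[of _ q]) (auto simp: A_def)
  qed
  ultimately show ?thesis by (rule_tac countable_subset) auto
qed

text \<open>Away from the null set where the right derivative fails to be \<open>v x\<close>, a zero
  with \<open>v x \<noteq> 0\<close> has no further zeros on some interval to its right, because the
  difference quotient of \<open>u\<close> is nonzero there. Only countably many zeros are of this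
  kind.\<close>

lemma abs_cont_zero_set:
  assumes u: "abs_cont L u v"
  shows "AE x in lborel. x \<in> {0<..<L} \<longrightarrow> u x = 0 \<longrightarrow> v x = 0"
proof -
  define N where "N = {x. u x = 0}"
  define I where "I = {x\<in>N. \<exists>y>x. N \<inter> {x<..<y} = {}}"
  have "I \<in> null_sets lborel"
    unfolding I_def by (rule countable_imp_null_set_lborel[OF countable_right_isolated])
  then have "AE x in lborel. x \<notin> I" by (rule AE_not_in)
  with L1_right_derivative[OF abs_cont_L1[OF u]] show ?thesis
  proof eventually_elim
    case (elim x)
    show ?case
    proof (intro impI)
      assume x: "x \<in> {0<..<L}" "u x = 0"
      then have lim: "((\<lambda>h. integral {x..x+h} v / h) \<longlongrightarrow> v x) (at_right 0)" using elim by blast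
      show "v x = 0"
      proof (rule ccontr)
        assume "v x \<noteq> 0"
        have "\<forall>\<^sub>F h in at_right 0. integral {x..x+h} v / h \<noteq> 0"
          using tendsto_imp_eventually_ne[OF lim \<open>v x \<noteq> 0\<close>] .
        then obtain b where b: "b > 0" "\<And>h. 0 < h \<Longrightarrow> h < b \<Longrightarrow> integral {x..x+h} v / h \<noteq> 0"
          unfolding eventually_at_right_field by auto
        define y where "y = x + min b (L - x)"
        have "x < y" using b x by (auto simp: y_def)
        moreover have "u r \<noteq> 0" if "r \<in> {x<..<y}" for r
        proof -
          have "u r - u x = integral {x..x + (r - x)} v"
            using abs_cont_diff[OF u, of x r] x that by (auto simp: y_def)
          moreover have "0 < r - x" "r - x < b" using that by (auto simp: y_def)
          ultimately show ?thesis using b(2)[of "r - x"] x by auto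
        qed
        ultimately have "x \<in> I" unfolding I_def N_def using x by auto
        then show False using elim by blast
      qed
    qed
  qed
qed

text \<open>Continuous representatives coincide up to the boundary, so the existential in
  \<open>trace0\<close> may be evaluated on any of them.\<close>

lemma trace0_abs_cont:
  assumes "trace0 L z c" "continuous_on {0..L} U" "AE x in lborel. x \<in> {0<..<L} \<longrightarrow> U x = z x" "0 < L"
  shows "U 0 = c"
proof -
  obtain v where v: "continuous_on {0..L} v" "AE x in lborel. x \<in> {0<..<L} \<longrightarrow> v x = z x" "v 0 = c"
    using assms(1) unfolding trace0_def by blast
  have "U 0 = v 0"
  proof (rule continuous_AE_eq[OF assms(4,2) v(1)])
    show "AE x in lborel. x \<in> {0<..<L} \<longrightarrow> U x = v x" using v(2) assms(3) by eventually_elim auto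
  qed (use assms in auto)
  then show ?thesis using v by simp
qed

lemma integral_nonpos_AE_Icc:
  assumes "L1 L v" "AE x in lborel. x \<in> {0<..<L} \<longrightarrow> v x \<le> 0" "0 \<le> a" "b \<le> L"
  shows "integral {a..b} v \<le> 0"
proof -
  have "0 \<le> (\<integral>x. indicat_real {a<..<b} x *\<^sub>R - v x \<partial>lborel)"
  proof (rule integral_nonneg_AE)
    show "AE x in lborel. 0 \<le> indicat_real {a<..<b} x *\<^sub>R - v x"
      using assms(2)
    proof eventually_elim
      case (elim x)
      then show ?case using assms(3,4) by (auto simp: indicator_def)
    qed
  qed
  also have "\<dots> = - (LINT x:{a<..<b}|lborel. v x)"
    by (simp add: set_lebesgue_integral_def)
  finally show ?thesis using L1_LINT_Ioo[OF assms(1,3,4)] by simp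
qed

lemma abs_cont_cong:
  assumes "abs_cont L u v" "0 \<le> L" "\<And>x. x \<in> {0..L} \<Longrightarrow> u' x = u x"
  shows "abs_cont L u' v"
  unfolding abs_cont_def
proof (intro conjI ballI)
  show "L1 L v" by (rule abs_cont_L1[OF assms(1)])
  show "u' x = u' 0 + integral {0..x} v" if "x \<in> {0..L}" for x
    using abs_cont_eq[OF assms(1) that] assms(3)[of 0] assms(3)[OF that] assms(2) by simp
qed

section \<open>The feedback law and the closed-loop operator\<close>

text \<open>Common properties of the two desired densities. The sign condition is an
  almost-everywhere one since \<open>wderiv\<close> is determined only up to null sets.\<close>

locale decreasing_profile =
  fixes L :: real and P :: "real \<Rightarrow> real"
  assumes L_pos: "0 < L"
    and P_continuous: "continuous_on {0..L} P"
    and P_W11: "W11 L P"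
    and P_nonneg: "\<And>x. x \<in> {0..L} \<Longrightarrow> 0 \<le> P x"
    and P_L: "P L = 0"
    and P_deriv: "AE x in lborel. x \<in> {0<..<L} \<longrightarrow> wderiv L P x < 0"
begin

lemma P_abs_cont: "abs_cont L P (wderiv L P)"
proof -
  obtain U where U: "abs_cont L U (wderiv L P)" "AE x in lborel. x \<in> {0<..<L} \<longrightarrow> U x = P x"
    using W11_abs_cont[OF P_W11 L_pos] .
  show ?thesis
    by (rule abs_cont_cong[OF U(1)])
      (use L_pos continuous_AE_eq[OF L_pos abs_cont_continuous[OF U(1)] P_continuous U(2)] in simp_all)
qed

lemma P_antimono:
  assumes "0 \<le> a" "a \<le> b" "b \<le> L"
  shows "P b \<le> P a"
proof -
  have "AE x in lborel. x \<in> {0<..<L} \<longrightarrow> wderiv L P x \<le> 0"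
    using P_deriv by eventually_elim auto
  from integral_nonpos_AE_Icc[OF abs_cont_L1[OF P_abs_cont] this assms(1,3)]
  show ?thesis using abs_cont_diff[OF P_abs_cont assms] by simp
qed

text \<open>By monotonicity a zero before \<open>L\<close> would make \<open>P\<close> vanish from
  there on; the derivative would then be zero almost everywhere on an interval of positive length,
  against its strict sign.\<close>

lemma P_pos:
  assumes x: "0 \<le> x" "x < L"
  shows "0 < P x"
proof (rule ccontr)
  assume "\<not> 0 < P x"
  then have 0: "P x = 0" using P_nonneg[of x] x by simp
  have zero: "P y = 0" if "y \<in> {x<..<L}" for y
    using P_antimono[of x y] P_nonneg[of y] x that 0 by simp
  have "AE y in lborel. y \<notin> {x<..<L}"
    using P_deriv abs_cont_zero_set[OF P_abs_cont]
  proof eventually_elim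
    case (elim y)
    show ?case
    proof
      assume y: "y \<in> {x<..<L}"
      then have "y \<in> {0<..<L}" using x by auto
      with elim zero[OF y] show False by simp
    qed
  qed
  then have "{x<..<L} \<in> null_sets lborel"
    by (subst AE_iff_null_sets) auto
  then show False using x by (simp add: null_sets_def)
qed

lemma L1_P_mult_cancel:
  assumes "L1 L (\<lambda>x. 1 / P x * z x)"
  shows "L1 L z"
proof -
  have "L1 L (\<lambda>x. 1 / P x * z x * P x)"
    by (rule L1_mult_continuous[OF assms P_continuous])
  moreover have "1 / P x * z x * P x = z x" if "x \<in> {0<..<L}" for x
    using P_pos[of x] that by simp
  ultimately show ?thesis
    unfolding L1_def by (subst (asm) set_integrable_cong[OF refl refl]) auto
qed

text \<open>Although \<open>1 / P\<close> is unbounded near \<open>L\<close>, the quotient has a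
  continuous representative \<open>U\<close> on the closed interval. Hence \<open>z\<close> is
  represented by \<open>P * U\<close>, which is absolutely continuous by the product rule and
  vanishes at \<open>L\<close>.\<close>

lemma weighted_W11:
  assumes W: "W11 L (\<lambda>x. 1 / P x * z x)"
  obtains U where "abs_cont L U (wderiv L (\<lambda>x. 1 / P x * z x))"
    "AE x in lborel. x \<in> {0<..<L} \<longrightarrow> U x = 1 / P x * z x"
    "abs_cont L (\<lambda>x. P x * U x) (wderiv L z)"
    "AE x in lborel. x \<in> {0<..<L} \<longrightarrow> P x * U x = z x"
    "W11 L z"
proof -
  obtain U where U: "abs_cont L U (wderiv L (\<lambda>x. 1 / P x * z x))"
    "AE x in lborel. x \<in> {0<..<L} \<longrightarrow> U x = 1 / P x * z x"
    using W11_abs_cont[OF W L_pos] .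
  have z: "L1 L z"
    using L1_P_mult_cancel W11_has_wderiv[OF W] by (simp add: has_wderiv_def)
  note m = abs_cont_mult[OF P_abs_cont U(1)]
  have AE: "AE x in lborel. x \<in> {0<..<L} \<longrightarrow> P x * U x = z x"
    using U(2)
  proof eventually_elim
    case (elim x)
    then show ?case using P_pos[of x] by auto
  qed
  note W' = abs_cont_W11[OF m AE z L_pos]
  obtain Z where Z: "abs_cont L Z (wderiv L z)" "AE x in lborel. x \<in> {0<..<L} \<longrightarrow> Z x = z x"
    using W11_abs_cont[OF W'(1) L_pos] .
  have AE': "AE x in lborel. x \<in> {0<..<L} \<longrightarrow> P x * U x = Z x"
    using AE Z(2) by eventually_elim simp
  have "abs_cont L (\<lambda>x. P x * U x) (wderiv L z)"
  proof (rule abs_cont_cong[OF Z(1)])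
    show "P x * U x = Z x" if "x \<in> {0..L}" for x
      by (rule continuous_AE_eq[OF L_pos abs_cont_continuous[OF m] abs_cont_continuous[OF Z(1)] AE' that])
  qed (use L_pos in simp)
  from that[OF U this AE W'(1)] show ?thesis .
qed

text \<open>One formula for both rates: \<open>l\<close> is \<open>lam2\<close> for the first and 0
  for the second. At a zero of \<open>z\<close> the convention \<open>1 / 0 = 0\<close> yields the
  value \<open>- l\<close>, which multiplication by \<open>z\<close> annihilates.\<close>

definition feedback_rate :: "real \<Rightarrow> real \<Rightarrow> nat \<Rightarrow> (real \<Rightarrow> real) \<Rightarrow> real \<Rightarrow> real" where
  "feedback_rate \<alpha> l j z x = - (1 / z x) * wderiv L z x
     + \<alpha> * real j * (1 / z x) * wderiv L (\<lambda>y. 1 / P y * z y) x - l"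

text \<open>Multiplication by \<open>z\<close> undoes the division where \<open>z\<close> is
  nonzero; where it vanishes, so do the representatives \<open>U\<close> and \<open>P * U\<close>,
  and almost everywhere their derivatives. Integrating \<open>- wderiv L z\<close> leaves only the
  boundary value \<open>c\<close>, because the representative is zero at \<open>L\<close>.\<close>

lemma feedback_rate:
  assumes W: "W11 L (\<lambda>x. 1 / P x * z x)"
  shows "AE x in lborel. x \<in> {0<..<L} \<longrightarrow> feedback_rate \<alpha> l j z x * z x =
      - wderiv L z x + \<alpha> * real j * wderiv L (\<lambda>y. 1 / P y * z y) x - l * z x" (is ?AE)
    and "L1 L (\<lambda>x. feedback_rate \<alpha> l j z x * z x)" (is ?L1)
    and "trace0 L z c \<Longrightarrow> (LINT x:{0<..<L}|lborel. feedback_rate \<alpha> l j z x * z x) =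
      c + \<alpha> * real j * (LINT x:{0<..<L}|lborel. wderiv L (\<lambda>y. 1 / P y * z y) x)
        - l * (LINT x:{0<..<L}|lborel. z x)"
proof -
  let ?w = "wderiv L (\<lambda>y. 1 / P y * z y)"
  obtain U where U: "abs_cont L U ?w"
    "AE x in lborel. x \<in> {0<..<L} \<longrightarrow> U x = 1 / P x * z x"
    "abs_cont L (\<lambda>x. P x * U x) (wderiv L z)"
    "AE x in lborel. x \<in> {0<..<L} \<longrightarrow> P x * U x = z x"
    "W11 L z"
    using weighted_W11[OF W] .
  note Lw = abs_cont_L1[OF U(1)] and Ld = abs_cont_L1[OF U(3)]
  have Lz: "L1 L z" using W11_has_wderiv[OF U(5)] by (simp add: has_wderiv_def)
  show AE: ?AE
    using U(2,4) abs_cont_zero_set[OF U(1)] abs_cont_zero_set[OF U(3)]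
  proof eventually_elim
    case (elim x)
    show ?case
    proof
      assume x: "x \<in> {0<..<L}"
      show "feedback_rate \<alpha> l j z x * z x = - wderiv L z x + \<alpha> * real j * ?w x - l * z x"
      proof (cases "z x = 0")
        case True
        then have "?w x = 0" "wderiv L z x = 0" using elim x by auto
        with True show ?thesis by simp
      next
        case False
        then show ?thesis by (simp add: feedback_rate_def field_simps)
      qed
    qed
  qed
  have LR: "L1 L (\<lambda>x. - wderiv L z x + \<alpha> * real j * ?w x - l * z x)"
    using L1_diff[OF L1_add[OF L1_cmult[OF Ld, of "-1"] L1_cmult[OF Lw, of "\<alpha> * real j"]] L1_cmult[OF Lz, of l]]
    by simp
  have meas: "(\<lambda>x. indicat_real {0<..<L} x *\<^sub>R u x) \<in> borel_measurable lborel" if "L1 L u" for u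
    using that unfolding L1_def set_integrable_def by (rule borel_measurable_integrable)
  \<comment> \<open>Equality almost everywhere does not by itself give Borel measurability. The
    product equals the measurable right-hand side exactly where \<open>z\<close> is nonzero, and is
    exactly 0 elsewhere.\<close>
  have "set_borel_measurable lborel {0<..<L} (\<lambda>x. feedback_rate \<alpha> l j z x * z x)"
  proof -
    define Z where "Z x = indicat_real {0<..<L} x *\<^sub>R z x" for x
    define R where "R x = indicat_real {0<..<L} x *\<^sub>R (- wderiv L z x + \<alpha> * real j * ?w x - l * z x)" for x
    have [measurable]: "Z \<in> borel_measurable borel" "R \<in> borel_measurable borel"
      using meas[OF LR] meas[OF Lz] by (simp_all add: Z_def[abs_def] R_def[abs_def])
    have "(\<lambda>x. if Z x = 0 then 0 else R x) \<in> borel_measurable lborel" by measurable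
    then show ?thesis
      unfolding set_borel_measurable_def
      by (rule measurable_cong[THEN iffD1, rotated])
        (auto simp: Z_def R_def feedback_rate_def indicator_def field_simps)
  qed
  then show L: ?L1
    unfolding L1_def set_integrable_def set_borel_measurable_def
  proof (rule integrable_cong_AE_imp[rotated])
    show "integrable lborel (\<lambda>x. indicat_real {0<..<L} x *\<^sub>R (- wderiv L z x + \<alpha> * real j * ?w x - l * z x))"
      using LR unfolding L1_def set_integrable_def .
    show "AE x in lborel. indicat_real {0<..<L} x *\<^sub>R (- wderiv L z x + \<alpha> * real j * ?w x - l * z x) =
      indicat_real {0<..<L} x *\<^sub>R (feedback_rate \<alpha> l j z x * z x)"
      using AE by eventually_elim (simp add: indicator_def)
  qed
  show "(LINT x:{0<..<L}|lborel. feedback_rate \<alpha> l j z x * z x) =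
      c + \<alpha> * real j * (LINT x:{0<..<L}|lborel. ?w x) - l * (LINT x:{0<..<L}|lborel. z x)"
    if c: "trace0 L z c"
  proof -
    have "P 0 * U 0 = c"
      by (rule trace0_abs_cont[OF c abs_cont_continuous[OF U(3)] U(4) L_pos])
    then have d: "(LINT x:{0<..<L}|lborel. wderiv L z x) = - c"
      using abs_cont_eq[OF U(3), of L] P_L L_pos L1_LINT[OF Ld] by simp
    have "(LINT x:{0<..<L}|lborel. feedback_rate \<alpha> l j z x * z x) =
      (LINT x:{0<..<L}|lborel. - wderiv L z x + \<alpha> * real j * ?w x - l * z x)"
      by (rule AE_LINT_cong[OF AE L LR])
    also have "\<dots> = - (LINT x:{0<..<L}|lborel. wderiv L z x)
        + \<alpha> * real j * (LINT x:{0<..<L}|lborel. ?w x) - l * (LINT x:{0<..<L}|lborel. z x)"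
    proof -
      note a = L1_cmult[OF Ld, of "-1"] and b = L1_cmult[OF Lw, of "\<alpha> * real j"] and c = L1_cmult[OF Lz, of l]
      have "(LINT x:{0<..<L}|lborel. - 1 * wderiv L z x + \<alpha> * real j * ?w x - l * z x) =
        (LINT x:{0<..<L}|lborel. - 1 * wderiv L z x) + (LINT x:{0<..<L}|lborel. \<alpha> * real j * ?w x)
          - (LINT x:{0<..<L}|lborel. l * z x)"
        using set_integral_diff(2)[OF L1_add[OF a b, unfolded L1_def] c[unfolded L1_def]]
          set_integral_add(2)[OF a[unfolded L1_def] b[unfolded L1_def]] by simp
      then show ?thesis by (simp add: set_lebesgue_integral_def)
    qed
    finally show ?thesis using d by simp
  qed
qed

end

text \<open>Both sides demand the same traces and weighted regularity. Given these, the boundary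
  values produced by integrating the feedback, \<open>lam1 * z0\<close> and \<open>lam2 * z0\<close>
  plus \<open>lam2\<close> times the mass of \<open>z1\<close>, cancel the loss term
  \<open>(lam1 + lam2) * z0\<close> and the contribution of \<open>- lam2\<close> in the first
  rate.\<close>

lemma controlled_op_iff_closed_loop_op:
  assumes "decreasing_profile L P1" "decreasing_profile L P2"
  shows "controlled_op L lam1 lam2 (\<lambda>x. 1 / P1 x) (\<lambda>x. 1 / P2 x)
      (decreasing_profile.feedback_rate L P1 \<alpha>1 lam2) (decreasing_profile.feedback_rate L P2 \<alpha>2 0) j z w
    \<longleftrightarrow> closed_loop_op L lam1 lam2 \<alpha>1 \<alpha>2 (\<lambda>x. 1 / P1 x) (\<lambda>x. 1 / P2 x) j z w"
proof -
  interpret P1: decreasing_profile L P1 by fact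
  interpret P2: decreasing_profile L P2 by fact
  obtain z0 z1 z2 w0 w1 w2 where zw: "z = (z0, z1, z2)" "w = (w0, w1, w2)"
    by (cases z, cases w) auto
  let ?u1 = "wderiv L (\<lambda>x. 1 / P1 x * z1 x)" and ?u2 = "wderiv L (\<lambda>x. 1 / P2 x * z2 x)"
  show ?thesis
  proof (cases "W11 L (\<lambda>x. 1 / P1 x * z1 x) \<and> W11 L (\<lambda>x. 1 / P2 x * z2 x) \<and> trace0 L z1 (lam1 * z0) \<and>
     trace0 L z2 (lam2 * z0 + lam2 * (LINT x:{0<..<L}|lborel. z1 x))")
    case False
    then show ?thesis unfolding zw by auto
  next
    case True
    note f1 = P1.feedback_rate[where z=z1 and \<alpha>=\<alpha>1 and l=lam2 and j=j]
      and f2 = P2.feedback_rate[where z=z2 and \<alpha>=\<alpha>2 and l=0 and j=j]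
    have W: "W11 L z1" "W11 L z2"
      using True P1.weighted_W11[of z1 "W11 L z1"] P2.weighted_W11[of z2 "W11 L z2"] by blast+
    have "(AE x in lborel. x \<in> {0<..<L} \<longrightarrow> w1 x = - wderiv L z1 x - (P1.feedback_rate \<alpha>1 lam2 j z1 x + lam2) * z1 x)
       \<longleftrightarrow> (AE x in lborel. x \<in> {0<..<L} \<longrightarrow> w1 x = - real j * \<alpha>1 * ?u1 x)"
    proof (rule eventually_cong)
      show "AE x in lborel. x \<in> {0<..<L} \<longrightarrow> P1.feedback_rate \<alpha>1 lam2 j z1 x * z1 x =
         - wderiv L z1 x + \<alpha>1 * real j * ?u1 x - lam2 * z1 x"
        using f1(1) True by blast
    qed (auto simp: algebra_simps)
    moreover have "(AE x in lborel. x \<in> {0<..<L} \<longrightarrow> w2 x = - wderiv L z2 x - P2.feedback_rate \<alpha>2 0 j z2 x * z2 x)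
       \<longleftrightarrow> (AE x in lborel. x \<in> {0<..<L} \<longrightarrow> w2 x = - real j * \<alpha>2 * ?u2 x)"
    proof (rule eventually_cong)
      show "AE x in lborel. x \<in> {0<..<L} \<longrightarrow> P2.feedback_rate \<alpha>2 0 j z2 x * z2 x =
         - wderiv L z2 x + \<alpha>2 * real j * ?u2 x - 0 * z2 x"
        using f2(1) True by blast
    qed (auto simp: algebra_simps)
    moreover have "- (lam1 + lam2) * z0 + (LINT x:{0<..<L}|lborel. P1.feedback_rate \<alpha>1 lam2 j z1 x * z1 x)
           + (LINT x:{0<..<L}|lborel. P2.feedback_rate \<alpha>2 0 j z2 x * z2 x) =
        real j * (\<alpha>1 * (LINT x:{0<..<L}|lborel. ?u1 x) + \<alpha>2 * (LINT x:{0<..<L}|lborel. ?u2 x))"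
      unfolding f1(3)[OF True[THEN conjunct1] True[THEN conjunct2, THEN conjunct2, THEN conjunct1]]
        f2(3)[OF True[THEN conjunct2, THEN conjunct1] True[THEN conjunct2, THEN conjunct2, THEN conjunct2]]
      by (simp add: algebra_simps)
    ultimately show ?thesis
      unfolding zw using True W f1(2) f2(2) by simp
  qed
qed

section \<open>A scalar delay equation\<close>

text \<open>A Gronwall argument: \<open>C = M + \<delta> / \<beta>\<close> is the equilibrium of the
  comparison equation \<open>I' = \<delta> - \<beta> * (I - M)\<close>, so
  \<open>exp (\<beta> * (y - a)) * (I y - C)\<close> is nonincreasing. Since
  \<open>I a \<le> C\<close>, the end of the window is the worst case, and the bound is uniform in
  \<open>x\<close>.\<close>

lemma delay_upper_bound:
  fixes I e :: "real \<Rightarrow> real"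
  assumes \<beta>: "0 < \<beta>" and T: "0 < T"
    and deriv: "\<And>x. a \<le> x \<Longrightarrow> x \<le> a + T \<Longrightarrow> (I has_real_derivative (e x - \<beta> * (I x - I (x - T)))) (at x)"
    and e: "\<And>x. a \<le> x \<Longrightarrow> x \<le> a + T \<Longrightarrow> e x \<le> \<delta>" and \<delta>: "0 \<le> \<delta>"
    and M: "\<And>x. a - T \<le> x \<Longrightarrow> x \<le> a \<Longrightarrow> I x \<le> M"
    and x: "a \<le> x" "x \<le> a + T"
  shows "I x \<le> (1 - exp (- \<beta> * T)) * (M + \<delta> / \<beta>) + exp (- \<beta> * T) * I a"
proof -
  define C where "C = M + \<delta> / \<beta>"
  define G where "G y = exp (\<beta> * (y - a)) * (I y - C)" for y
  have "G x \<le> G a"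
  proof (rule DERIV_nonpos_imp_nonincreasing[OF x(1)])
    fix y assume y: "a \<le> y" "y \<le> x"
    then have y': "y \<le> a + T" using x by simp
    have "(G has_real_derivative (exp (\<beta> * (y - a)) * \<beta> * (I y - C)
       + exp (\<beta> * (y - a)) * (e y - \<beta> * (I y - I (y - T))))) (at y)"
      unfolding G_def by (rule derivative_eq_intros deriv[OF y(1) y'] refl | simp)+
    moreover have "exp (\<beta> * (y - a)) * \<beta> * (I y - C) + exp (\<beta> * (y - a)) * (e y - \<beta> * (I y - I (y - T)))
      = exp (\<beta> * (y - a)) * (\<beta> * (I (y - T) - M) + (e y - \<delta>))"
      using \<beta> by (simp add: C_def field_simps)
    moreover have "I (y - T) \<le> M" using M[of "y - T"] y y' T by simp
    then have "\<beta> * (I (y - T) - M) + (e y - \<delta>) \<le> 0"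
      using e[OF y(1) y'] mult_nonneg_nonpos[of \<beta> "I (y - T) - M"] \<beta> by simp
    then have "exp (\<beta> * (y - a)) * (\<beta> * (I (y - T) - M) + (e y - \<delta>)) \<le> 0"
      by (simp add: mult_le_0_iff)
    ultimately show "\<exists>z. (G has_real_derivative z) (at y) \<and> z \<le> 0" by metis
  qed
  then have "exp (\<beta> * (x - a)) * (I x - C) \<le> I a - C" by (simp add: G_def)
  then have "exp (- \<beta> * (x - a)) * (exp (\<beta> * (x - a)) * (I x - C)) \<le> exp (- \<beta> * (x - a)) * (I a - C)"
    by (intro mult_left_mono) auto
  then have "I x - C \<le> exp (- \<beta> * (x - a)) * (I a - C)"
    by (simp add: mult.assoc[symmetric] exp_add[symmetric])
  also have "\<dots> \<le> exp (- \<beta> * T) * (I a - C)"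
  proof (rule mult_right_mono_neg)
    show "I a - C \<le> 0" using M[of a] T \<delta> \<beta> by (simp add: C_def add_increasing2)
    show "exp (- \<beta> * T) \<le> exp (- \<beta> * (x - a))" using x \<beta> by simp
  qed
  finally show ?thesis by (simp add: C_def algebra_simps)
qed

text \<open>With \<open>\<theta> = exp (- \<beta> * T)\<close>, both bounds for \<open>I\<close> on the next window contain the term \<open>\<theta> * I a\<close>,
  so the oscillation contracts by the factor \<open>1 - \<theta>\<close>.\<close>

lemma delay_oscillation_step:
  fixes I e :: "real \<Rightarrow> real"
  assumes \<beta>: "0 < \<beta>" and T: "0 < T"
    and deriv: "\<And>x. a \<le> x \<Longrightarrow> x \<le> a + T \<Longrightarrow> (I has_real_derivative (e x - \<beta> * (I x - I (x - T)))) (at x)"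
    and e: "\<And>x. a \<le> x \<Longrightarrow> x \<le> a + T \<Longrightarrow> \<bar>e x\<bar> \<le> \<delta>" and \<delta>: "0 \<le> \<delta>"
    and M: "\<And>x y. x \<in> {a - T..a} \<Longrightarrow> y \<in> {a - T..a} \<Longrightarrow> I x - I y \<le> K"
    and x: "x \<in> {a..a+T}" "y \<in> {a..a+T}"
  shows "I x - I y \<le> (1 - exp (- \<beta> * T)) * (K + 2 * \<delta> / \<beta>)"
proof -
  define U where "U = Sup (I ` {a - T..a})"
  define W where "W = Inf (I ` {a - T..a})"
  have bd: "bdd_above (I ` {a - T..a})" "bdd_below (I ` {a - T..a})"
  proof -
    have "I x \<le> K + I a" "I a - K \<le> I x" if "x \<in> {a - T..a}" for x
      using M[OF that, of a] M[OF _ that, of a] T by auto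
    then show "bdd_above (I ` {a - T..a})" "bdd_below (I ` {a - T..a})"
      by (auto intro!: bdd_aboveI2[where M = "K + I a"] bdd_belowI2[where m = "I a - K"])
  qed
  have U: "I z \<le> U" and W: "W \<le> I z" if "z \<in> {a - T..a}" for z
    unfolding U_def W_def using that bd by (auto intro: cSUP_upper cINF_lower)
  have UW: "U \<le> W + K"
  proof -
    have "U \<le> I z + K" if z: "z \<in> {a - T..a}" for z
      unfolding U_def using M z by (intro cSUP_least) (use T in \<open>auto simp: algebra_simps\<close>)
    then have "U - K \<le> W" unfolding W_def using T by (intro cINF_greatest) (auto simp: algebra_simps)
    then show ?thesis by simp
  qed
  have 1: "I x \<le> (1 - exp (- \<beta> * T)) * (U + \<delta> / \<beta>) + exp (- \<beta> * T) * I a"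
    by (rule delay_upper_bound[OF \<beta> T deriv _ \<delta> U]) (use e x in \<open>auto simp: abs_le_iff\<close>)
  \<comment> \<open>The lower bound is the upper bound for \<open>- I\<close>, which solves the same
    equation with \<open>- e\<close>.\<close>
  have 2: "- I y \<le> (1 - exp (- \<beta> * T)) * (- W + \<delta> / \<beta>) + exp (- \<beta> * T) * (- I a)"
  proof (rule delay_upper_bound[OF \<beta> T, where e = "\<lambda>x. - e x" and I = "\<lambda>x. - I x"])
    show "((\<lambda>x. - I x) has_real_derivative - e x - \<beta> * (- I x - - I (x - T))) (at x)" if "a \<le> x" "x \<le> a + T" for x
      using DERIV_minus[OF deriv[OF that]] by (simp add: algebra_simps)
  qed (use e x W \<delta> in \<open>auto simp: abs_le_iff\<close>)
  have "I x - I y \<le> (1 - exp (- \<beta> * T)) * (U - W + 2 * \<delta> / \<beta>)"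
    using add_mono[OF 1 2] by (simp add: algebra_simps diff_divide_distrib)
  also have "\<dots> \<le> (1 - exp (- \<beta> * T)) * (K + 2 * \<delta> / \<beta>)"
    using UW \<beta> T by (intro mult_left_mono) auto
  finally show ?thesis .
qed

text \<open>The one-window contraction is iterated. The inhomogeneity is only small, not zero, but
  its contributions are damped by the same factor and stay bounded by a fixed part of the
  tolerance.\<close>

lemma delay_increment_tendsto_0:
  fixes I e :: "real \<Rightarrow> real"
  assumes \<beta>: "0 < \<beta>" and T: "0 < T" and a: "T \<le> a"
    and cont: "continuous_on {0..} I"
    and deriv: "\<And>x. a \<le> x \<Longrightarrow> (I has_real_derivative (e x - \<beta> * (I x - I (x - T)))) (at x)"
    and e: "(e \<longlongrightarrow> 0) at_top"
  shows "((\<lambda>x. I x - I (x - T)) \<longlongrightarrow> 0) at_top"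
proof (rule tendstoI)
  fix \<epsilon> :: real assume \<epsilon>: "0 < \<epsilon>"
  define \<theta> where "\<theta> = exp (- \<beta> * T)"
  have \<theta>: "0 < \<theta>" "\<theta> < 1" using \<beta> T by (auto simp: \<theta>_def)
  \<comment> \<open>Makes \<open>2 * \<delta> / \<beta>\<close> equal to
    \<open>\<theta> * \<epsilon> / 4\<close>; the share \<open>\<epsilon> / 4\<close> then survives
    the contraction, as \<open>(1 - \<theta>) * (1 + \<theta>) \<le> 1\<close>.\<close>
  define \<delta> where "\<delta> = \<theta> * \<beta> * \<epsilon> / 8"
  have \<delta>: "0 < \<delta>" using \<theta> \<beta> \<epsilon> by (simp add: \<delta>_def)
  obtain b where b: "\<And>x. b \<le> x \<Longrightarrow> \<bar>e x\<bar> < \<delta>"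
    using tendstoD[OF e \<delta>] by (auto simp: eventually_at_top_linorder)
  define c where "c = max a b"
  define w where "w n = {c + real n * T - T..c + real n * T}" for n
  have "compact (I ` w 0)"
    using a by (intro compact_continuous_image continuous_on_subset[OF cont]) (auto simp: w_def c_def)
  then obtain B where B: "\<And>x. x \<in> w 0 \<Longrightarrow> \<bar>I x\<bar> \<le> B"
    using compact_imp_bounded bounded_real by (metis image_eqI)
  have osc: "\<forall>x\<in>w n. \<forall>y\<in>w n. I x - I y \<le> (1 - \<theta>) ^ n * (2 * B) + \<epsilon> / 4" for n
  proof (induction n)
    case 0
    show ?case
    proof (intro ballI)
      fix x y assume "x \<in> w 0" "y \<in> w 0"
      then show "I x - I y \<le> (1 - \<theta>) ^ 0 * (2 * B) + \<epsilon> / 4"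
        using B[of x] B[of y] \<epsilon> by (simp add: abs_le_iff)
    qed
  next
    case (Suc n)
    show ?case
    proof (intro ballI)
      fix x y assume xy: "x \<in> w (Suc n)" "y \<in> w (Suc n)"
      let ?c = "c + real n * T"
      have nT: "0 \<le> real n * T" using T by simp
      have "I x - I y \<le> (1 - exp (- \<beta> * T)) * ((1 - \<theta>) ^ n * (2 * B) + \<epsilon> / 4 + 2 * \<delta> / \<beta>)"
      proof (rule delay_oscillation_step[OF \<beta> T, where a = ?c and e = e and I = I])
        show "(I has_real_derivative e x - \<beta> * (I x - I (x - T))) (at x)" if "?c \<le> x" for x
          using deriv[of x] that nT by (auto simp: c_def)
        show "\<bar>e x\<bar> \<le> \<delta>" if "?c \<le> x" for x
          using b[of x] that nT by (simp add: c_def less_imp_le)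
        show "I x - I y \<le> (1 - \<theta>) ^ n * (2 * B) + \<epsilon> / 4" if "x \<in> {?c - T..?c}" "y \<in> {?c - T..?c}" for x y
          using Suc.IH that by (simp add: w_def)
      qed (use xy \<delta> in \<open>auto simp: w_def algebra_simps\<close>)
      also have "\<dots> = (1 - \<theta>) ^ Suc n * (2 * B) + (1 - \<theta>) * (\<epsilon> / 4 + 2 * \<delta> / \<beta>)"
        unfolding \<theta>_def[symmetric] by (simp add: algebra_simps)
      also have "(1 - \<theta>) * (\<epsilon> / 4 + 2 * \<delta> / \<beta>) \<le> \<epsilon> / 4"
      proof -
        have "(1 - \<theta>) * (\<epsilon> / 4 + 2 * \<delta> / \<beta>) = \<epsilon> / 4 - \<theta> * \<theta> * \<epsilon> / 4"
          using \<beta> by (simp add: \<delta>_def field_simps)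
        then show ?thesis using \<theta> \<epsilon> by simp
      qed
      finally show "I x - I y \<le> (1 - \<theta>) ^ Suc n * (2 * B) + \<epsilon> / 4" by simp
    qed
  qed
  have "(\<lambda>n. (1 - \<theta>) ^ n * (2 * B)) \<longlonglongrightarrow> 0 * (2 * B)"
    using \<theta> by (intro tendsto_mult tendsto_const LIMSEQ_power_zero) auto
  then have "\<forall>\<^sub>F n in sequentially. (1 - \<theta>) ^ n * (2 * B) < \<epsilon> / 8"
    using \<epsilon> by (intro order_tendstoD) auto
  then obtain N where N: "\<And>n. N \<le> n \<Longrightarrow> (1 - \<theta>) ^ n * (2 * B) < \<epsilon> / 8"
    by (auto simp: eventually_sequentially)
  have "dist (I x - I (x - T)) 0 < \<epsilon>" if x: "c + real N * T \<le> x" for x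
  proof -
    define n where "n = nat \<lfloor>(x - c) / T\<rfloor>"
    have Nx: "real N \<le> (x - c) / T" using x T by (simp add: field_simps)
    then have nN: "N \<le> n" unfolding n_def by (simp add: le_nat_floor)
    have n: "real n \<le> (x - c) / T" "(x - c) / T < real n + 1"
      using Nx unfolding n_def by (auto intro!: of_nat_floor order.trans[of 0 "real N"])
    \<comment> \<open>The common endpoint of the adjacent windows containing \<open>x - T\<close>
      and \<open>x\<close>; comparison through it costs two oscillations, each below
      \<open>3 * \<epsilon> / 8\<close>.\<close>
    define y where "y = c + real n * T"
    have y: "y \<le> x" "x \<le> y + T" using n T by (auto simp: y_def field_simps)
    have "x \<in> w (Suc n)" "y \<in> w (Suc n)" "y \<in> w n" "x - T \<in> w n"
      using y T by (auto simp: w_def y_def algebra_simps)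
    then have "\<bar>I x - I y\<bar> \<le> (1 - \<theta>) ^ Suc n * (2 * B) + \<epsilon> / 4" "\<bar>I y - I (x - T)\<bar> \<le> (1 - \<theta>) ^ n * (2 * B) + \<epsilon> / 4"
      using osc by (simp_all only: abs_le_iff minus_diff_eq)
    then show ?thesis using N[OF nN] N[of "Suc n"] nN by (simp add: dist_real_def)
  qed
  then show "\<forall>\<^sub>F x in at_top. dist (I x - I (x - T)) 0 < \<epsilon>"
    unfolding eventually_at_top_linorder by blast
qed

text \<open>The oscillation argument is applied to the primitive of \<open>s\<close>, centred at the expected limit,
  which avoids differentiating \<open>m\<close>.\<close>

lemma delay_equation_tendsto:
  fixes s m :: "real \<Rightarrow> real"
  assumes \<beta>: "0 < \<beta>" and T: "0 < T" and a: "T < a"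
    and s: "continuous_on {0..} s"
    and eq: "\<And>x. a \<le> x \<Longrightarrow> s x + \<beta> * integral {x - T..x} s = m x"
    and m: "(m \<longlongrightarrow> m') at_top"
  shows "(s \<longlongrightarrow> m' / (1 + \<beta> * T)) at_top"
proof -
  define c where "c = m' / (1 + \<beta> * T)"
  have pos: "0 < 1 + \<beta> * T" using \<beta> T by (simp add: add_pos_pos)
  define I where "I x = integral {0..x} s - c * x" for x
  have int: "s integrable_on {u..v}" if "0 \<le> u" for u v
    using that by (intro integrable_continuous_real continuous_on_subset[OF s]) auto
  have DI: "(I has_real_derivative (s x - c)) (at x)" if "0 < x" for x
  proof -
    have "((\<lambda>x. integral {0..x} s) has_real_derivative s x) (at x within {0..x+1})"
      using that by (intro integral_has_real_derivative continuous_on_subset[OF s]) auto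
    then have "((\<lambda>x. integral {0..x} s) has_real_derivative s x) (at x)"
      using that by (subst (asm) at_within_interior) auto
    then show ?thesis unfolding I_def by (auto intro!: derivative_eq_intros)
  qed
  have inc: "I x - I (x - T) = integral {x - T..x} s - c * T" if "T \<le> x" for x
  proof -
    have "integral {0..x - T} s + integral {x - T..x} s = integral {0..x} s"
      using that T by (intro Henstock_Kurzweil_Integration.integral_combine int) auto
    then show ?thesis by (simp add: I_def algebra_simps)
  qed
  have mc: "m' = c + c * \<beta> * T"   proof -
    have "c * (1 + \<beta> * T) = m'" using pos by (simp add: c_def)
    then show ?thesis by (simp add: algebra_simps)
  qed
  have eq': "s x - c = (m x - m') - \<beta> * (I x - I (x - T))" if "a \<le> x" for x
  proof -
    have "T \<le> x" using that a by simp
    from inc[OF this] eq[OF that] show ?thesis by (simp add: mc right_diff_distrib)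
  qed
  have "((\<lambda>x. I x - I (x - T)) \<longlongrightarrow> 0) at_top"
  proof (rule delay_increment_tendsto_0[OF \<beta> T])
    show "T \<le> a" using a by simp
    have "continuous_on {0..} (\<lambda>x. integral {0..x} s)"
      unfolding continuous_on_eq_continuous_within
    proof
      fix x :: real assume x: "x \<in> {0..}"
      have "continuous_on {0..x+1} (\<lambda>x. integral {0..x} s)"
        by (rule indefinite_integral_continuous_1[OF int]) simp
      then have "continuous (at x within {0..x+1}) (\<lambda>x. integral {0..x} s)"
        using x by (simp add: continuous_on_eq_continuous_within)
      moreover have "at x within {0..x+1} = at x within {0..}"
        by (rule at_within_nhd[of x "{..<x+1}"]) auto
      ultimately show "continuous (at x within {0..}) (\<lambda>x. integral {0..x} s)" by simp
    qed
    then show "continuous_on {0..} I" unfolding I_def by (intro continuous_intros)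
    show "(I has_real_derivative m x - m' - \<beta> * (I x - I (x - T))) (at x)" if "a \<le> x" for x
      using DI[of x] eq'[OF that] that a T by simp
    show "((\<lambda>x. m x - m') \<longlongrightarrow> 0) at_top"
      using m by (rule LIM_zero)
  qed
  then have "((\<lambda>x. (m x - m') - \<beta> * (I x - I (x - T)) + c) \<longlongrightarrow> (m' - m') - \<beta> * 0 + c) at_top"
    by (intro tendsto_intros m)
  moreover have "\<forall>\<^sub>F x in at_top. (m x - m') - \<beta> * (I x - I (x - T)) + c = s x"
    using eventually_ge_at_top[of a] by eventually_elim (simp add: eq'[symmetric])
  ultimately have "(s \<longlongrightarrow> (m' - m') - \<beta> * 0 + c) at_top"
    by (rule Lim_transform_eventually)
  then show ?thesis by (simp add: c_def)
qed

text \<open>Method of steps: the iterates stabilize on \<open>{..n * T}\<close> after \<open>n\<close> steps.\<close>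

lemma delay_equation_exists:
  fixes k :: "real \<Rightarrow> real"
  assumes T: "0 < T" and k: "continuous_on {0..} k"
  obtains I where "\<And>x. x \<le> 0 \<Longrightarrow> I x = 0" "continuous_on UNIV I"
    "\<And>x. 0 \<le> x \<Longrightarrow> (I has_real_derivative (k x - \<beta> * (I x - I (x - T)))) (at x within {0..})"
proof -
  \<comment> \<open>Variation of constants: each iterate solves the equation with its predecessor in
    the delayed place. The undelayed term is treated exactly by the exponential, so only the delay
    is iterated.\<close>
  define f :: "nat \<Rightarrow> real \<Rightarrow> real" where "f = rec_nat (\<lambda>x. 0) (\<lambda>_ g x. if x \<le> 0 then 0 else
     exp (- \<beta> * x) * integral {0..x} (\<lambda>y. exp (\<beta> * y) * (k y + \<beta> * g (y - T))))"
  have f0: "f 0 = (\<lambda>x. 0)" by (simp add: f_def)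
  have fS: "f (Suc n) x = (if x \<le> 0 then 0 else
     exp (- \<beta> * x) * integral {0..x} (\<lambda>y. exp (\<beta> * y) * (k y + \<beta> * f n (y - T))))" for n x
    by (simp add: f_def)
  have fS': "f (Suc n) x = exp (- \<beta> * x) * integral {0..x} (\<lambda>y. exp (\<beta> * y) * (k y + \<beta> * f n (y - T)))"
    if "0 \<le> x" for n x
    using that by (cases "x = 0") (auto simp: fS)
  have cg: "continuous_on {0..} (\<lambda>y. exp (\<beta> * y) * (k y + \<beta> * f n (y - T)))" if "continuous_on UNIV (f n)" for n
    by (intro continuous_intros k continuous_on_compose2[OF that]) auto
  have D: "(f (Suc n) has_real_derivative (k x - \<beta> * (f (Suc n) x - f n (x - T)))) (at x within {0..})"
    if c: "continuous_on UNIV (f n)" and x: "0 \<le> x" for n x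
  proof -
    let ?g = "\<lambda>y. exp (\<beta> * y) * (k y + \<beta> * f n (y - T))"
    have "((\<lambda>x. integral {0..x} ?g) has_real_derivative ?g x) (at x within {0..x+1})"
      using x by (intro integral_has_real_derivative continuous_on_subset[OF cg[OF c]]) auto
    moreover have "at x within {0..x+1} = at x within {0..}"
      by (rule at_within_nhd[of x "{..<x+1}"]) auto
    ultimately have "((\<lambda>x. integral {0..x} ?g) has_real_derivative ?g x) (at x within {0..})" by simp
    then have "((\<lambda>x. exp (- \<beta> * x) * integral {0..x} ?g) has_real_derivative
       (exp (- \<beta> * x) * (- \<beta>) * integral {0..x} ?g + exp (- \<beta> * x) * ?g x)) (at x within {0..})"
      by (auto intro!: derivative_eq_intros)
    moreover have "exp (- \<beta> * x) * (- \<beta>) * integral {0..x} ?g + exp (- \<beta> * x) * ?g x =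
       k x - \<beta> * (f (Suc n) x - f n (x - T))"
    proof -
      have "exp (- \<beta> * x) * ?g x = k x + \<beta> * f n (x - T)"
        by (simp add: mult.assoc[symmetric] exp_add[symmetric])
      then show ?thesis
        unfolding fS'[OF x, of n] right_diff_distrib by simp
    qed
    ultimately have "((\<lambda>x. exp (- \<beta> * x) * integral {0..x} ?g) has_real_derivative
       k x - \<beta> * (f (Suc n) x - f n (x - T))) (at x within {0..})" by simp
    then show ?thesis
      by (rule has_field_derivative_transform_within[OF _ zero_less_one]) (use x fS' in auto)
  qed
  have c: "continuous_on UNIV (f n)" for n
  proof (induction n)
    case 0 then show ?case by (simp add: f0)
  next
    case (Suc n)
    have "continuous_on {0..} (f (Suc n))"
      using D[OF Suc] by (intro DERIV_continuous_on) auto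
    moreover have "continuous_on {..0} (f (Suc n))"
      by (rule continuous_on_eq[OF continuous_on_const[of _ 0]]) (simp add: fS)
    ultimately have "continuous_on ({..0} \<union> {0..}) (f (Suc n))"
      by (intro continuous_on_closed_Un) auto
    moreover have "{..0} \<union> {0..} = (UNIV :: real set)" by auto
    ultimately show ?case by simp
  qed
  have stab: "f (Suc n) x = f n x" if "x \<le> real n * T" for n x
    using that
  proof (induction n arbitrary: x)
    case 0 then show ?case by (simp add: f0 fS)
  next
    case (Suc n)
    show ?case
    proof (cases "x \<le> 0")
      case False
      have "integral {0..x} (\<lambda>y. exp (\<beta> * y) * (k y + \<beta> * f (Suc n) (y - T))) =
        integral {0..x} (\<lambda>y. exp (\<beta> * y) * (k y + \<beta> * f n (y - T)))"
      proof (rule integral_cong)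
        fix y assume "y \<in> {0..x}"
        then have "f (Suc n) (y - T) = f n (y - T)"
          using Suc.prems by (intro Suc.IH) (simp add: algebra_simps)
        then show "exp (\<beta> * y) * (k y + \<beta> * f (Suc n) (y - T)) = exp (\<beta> * y) * (k y + \<beta> * f n (y - T))"
          by simp
      qed
      with False show ?thesis by (simp add: fS[of "Suc n"] fS[of n])
    qed (simp add: fS)
  qed
  have stab': "f (n + d) x = f n x" if "x \<le> real n * T" for n d x
  proof (induction d)
    case (Suc d)
    have "real n * T \<le> real (n + d) * T" using T by simp
    then have "f (Suc (n + d)) x = f (n + d) x" using that by (intro stab) linarith
    with Suc show ?case by simp
  qed simp
  \<comment> \<open>An index from which on the iterates agree at \<open>x\<close>; it is 0 for
    \<open>x \<le> 0\<close>, where the value is 0.\<close>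
  define I where "I x = f (nat \<lceil>x / T\<rceil>) x" for x
  have I: "I x = f n x" if "x \<le> real n * T" for n x
  proof -
    define q where "q = nat \<lceil>x / T\<rceil>"
    have "x / T \<le> real q" unfolding q_def by linarith
    then have x: "x \<le> real q * T" using T by (simp add: field_simps)
    have "x / T \<le> real n" using that T by (simp add: field_simps)
    then have "q \<le> n" unfolding q_def by linarith
    then show ?thesis using stab'[OF x, of "n - q"] by (simp add: I_def q_def)
  qed
  have near: "\<exists>n. x < real n * T" for x :: real
    using reals_Archimedean3[OF T] by blast
  show ?thesis
  proof (rule that)
    show "I x = 0" if "x \<le> 0" for x
      using I[of x 0] that by (simp add: f0)
    have "isCont I x" for x
    proof -
      obtain n where n: "x < real n * T" using near by blast
      have "\<forall>\<^sub>F y in nhds x. I y = f n y"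
        using eventually_nhds_in_open[of "{..<real n * T}" x] n
        by (auto intro: I elim!: eventually_mono)
      moreover have "isCont (f n) x" using c[of n] by (simp add: continuous_on_eq_continuous_at)
      ultimately show ?thesis by (simp add: isCont_cong)
    qed
    then show "continuous_on UNIV I" by (simp add: continuous_at_imp_continuous_on)
    show "(I has_real_derivative k x - \<beta> * (I x - I (x - T))) (at x within {0..})" if x: "0 \<le> x" for x
    proof -
      obtain n where n: "x < real n * T" using near by blast
      have n': "real n * T \<le> real (Suc n) * T" using T by simp
      have eq: "I x = f (Suc n) x" "I (x - T) = f n (x - T)"
        by (rule I, use n n' in linarith, rule I, use n T in linarith)
      have D': "(f (Suc n) has_real_derivative (k x - \<beta> * (I x - I (x - T)))) (at x within {0..})"
        using D[OF c x, of n] eq by simp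
      have pos: "0 < real n * T - x" using n by simp
      show ?thesis
        by (rule has_field_derivative_transform_within[OF D' pos])
           (use x n n' in \<open>auto simp: dist_real_def abs_less_iff intro!: I[symmetric]\<close>)
    qed
  qed
qed

section \<open>The change of time\<close>

locale switching =
  fixes tf r0 :: real
  assumes tf_pos: "0 < tf" and r0_eq: "r0 = 6 * tf / pi\<^sup>2"
begin

abbreviation st :: "nat \<Rightarrow> real" where "st \<equiv> switch_time r0"

lemma r0_pos: "0 < r0"
  using tf_pos by (simp add: r0_eq)

lemma st_0: "st 0 = 0"
  by (simp add: switch_time_def)

lemma st_Suc: "st (Suc j) = st j + r0 / (real (Suc j))\<^sup>2"
  by (simp add: switch_time_def algebra_simps)

lemma st_strict_mono: "strict_mono st"
  using r0_pos by (intro strict_monoI_Suc) (simp add: st_Suc add_pos_nonneg)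

lemma st_mono: "i \<le> j \<Longrightarrow> st i \<le> st j"
  using st_strict_mono by (simp add: strict_mono_less_eq)

lemma st_nonneg: "0 \<le> st j"
  using st_mono[of 0 j] by (simp add: st_0)

lemma st_LIMSEQ: "st \<longlonglongrightarrow> tf"
proof -
  have "(\<lambda>n. r0 * (\<Sum>k<n. 1 / (real k + 1)\<^sup>2)) \<longlonglongrightarrow> r0 * (pi\<^sup>2 / 6)"
    using inverse_squares_sums by (intro tendsto_mult_left) (simp add: sums_def add.commute)
  moreover have "st = (\<lambda>n. r0 * (\<Sum>k<n. 1 / (real k + 1)\<^sup>2))"
    unfolding switch_time_def[abs_def] One_nat_def sum.atLeast1_atMost_eq by (simp add: add.commute)
  moreover have "r0 * (pi\<^sup>2 / 6) = tf" by (simp add: r0_eq)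
  ultimately show ?thesis by simp
qed

lemma st_less: "st j < tf"
proof -
  have "st (Suc j) \<le> tf"
    using st_LIMSEQ st_mono by (intro incseq_le) (auto simp: incseq_def)
  then show ?thesis using strict_monoD[OF st_strict_mono, of j "Suc j"] by simp
qed

lemma st_eventually_greater:
  assumes "t < tf"
  obtains N where "t < st N"
  using order_tendstoD(1)[OF st_LIMSEQ assms] by (auto simp: eventually_sequentially)

lemma st_interval:
  assumes "0 \<le> t" "t < tf"
  obtains j where "1 \<le> j" "t \<in> {st (j - 1)..<st j}"
proof -
  obtain N where N: "t < st N" using st_eventually_greater[OF assms(2)] .
  define j where "j = (LEAST n. t < st n)"
  have j: "t < st j" unfolding j_def using N by (rule LeastI)
  then have "j \<noteq> 0" using assms(1) st_0 by (cases j) auto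
  moreover from this have "\<not> t < st (j - 1)" unfolding j_def by (intro not_less_Least) simp
  ultimately show ?thesis using that[of j] j by auto
qed

text \<open>The time change with slope \<open>j\<close> on the \<open>j\<close>-th interval: each switching time passed adds 1 to
  the slope.\<close>

definition tau :: "real \<Rightarrow> real" where
  "tau t = t + (\<Sum>j | 1 \<le> j \<and> st j < t. t - st j)"

text \<open>Later switching times contribute 0, so the range of summation can be fixed on a bounded
  range of \<open>t\<close>. This exhibits \<open>tau\<close> locally as a finite sum of continuous
  nondecreasing functions.\<close>

lemma tau_eq:
  assumes "t \<le> st (Suc N)"
  shows "tau t = t + (\<Sum>j\<in>{1..N}. max 0 (t - st j))"
proof -
  have "{j. 1 \<le> j \<and> st j < t} \<subseteq> {1..N}"
  proof clarsimp
    fix j assume "Suc 0 \<le> j" "st j < t"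
    then have "st j < st (Suc N)" using assms by simp
    then show "j \<le> N" using st_strict_mono by (simp add: strict_mono_less)
  qed
  then have "(\<Sum>j | 1 \<le> j \<and> st j < t. t - st j) = (\<Sum>j\<in>{1..N}. if st j < t then t - st j else 0)"
    by (intro sum.mono_neutral_cong_left) auto
  also have "\<dots> = (\<Sum>j\<in>{1..N}. max 0 (t - st j))"
    by (intro sum.cong) auto
  finally show ?thesis by (simp add: tau_def)
qed

lemma tau_0: "tau 0 = 0"
  using tau_eq[of 0 0] by (simp add: st_nonneg)

text \<open>The leading summand of \<open>tau\<close> is the identity and the others are
  nondecreasing. Injectivity of \<open>tau\<close> and the Lipschitz constant 1 of its inverse come
  from here.\<close>

lemma tau_increasing:
  assumes "a \<le> b" "b < tf"
  shows "b - a \<le> tau b - tau a"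
proof -
  obtain N where N: "b < st N" using st_eventually_greater[OF assms(2)] .
  then have b: "b \<le> st (Suc N)" using st_mono[of N "Suc N"] by simp
  have "(\<Sum>j\<in>{1..N}. max 0 (a - st j)) \<le> (\<Sum>j\<in>{1..N}. max 0 (b - st j))"
    using assms by (intro sum_mono) auto
  then show ?thesis using tau_eq[OF b] tau_eq[of a N] b assms by simp
qed

lemma tau_continuous: "continuous_on {..<tf} tau"
proof -
  have "isCont tau t" if t: "t < tf" for t
  proof -
    obtain N where N: "t < st N" using st_eventually_greater[OF t] .
    have "\<forall>\<^sub>F y in nhds t. y < st N"
      using eventually_nhds_in_open[of "{..<st N}" t] N by simp
    then have "\<forall>\<^sub>F y in nhds t. tau y = y + (\<Sum>j\<in>{1..N}. max 0 (y - st j))"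
    proof eventually_elim
      case (elim y)
      then have "y \<le> st (Suc N)" using st_mono[of N "Suc N"] by simp
      then show ?case by (rule tau_eq)
    qed
    moreover have "isCont (\<lambda>y. y + (\<Sum>j\<in>{1..N}. max 0 (y - st j))) t"
      by (intro continuous_intros)
    ultimately show ?thesis by (simp add: isCont_cong)
  qed
  then show ?thesis by (simp add: continuous_at_imp_continuous_on)
qed

lemma tau_piece:
  assumes j: "1 \<le> j" and t: "t \<in> {st (j - 1)..st j}"
  shows "tau t = tau (st (j - 1)) + real j * (t - st (j - 1))"
proof -
  have *: "tau s = s + (\<Sum>i\<in>{1..j - 1}. s - st i)" if "s \<in> {st (j - 1)..st j}" for s
  proof -
    have "s \<le> st (Suc (j - 1))" using that j by simp
    from tau_eq[OF this] have "tau s = s + (\<Sum>i\<in>{1..j - 1}. max 0 (s - st i))" .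
    also have "(\<Sum>i\<in>{1..j - 1}. max 0 (s - st i)) = (\<Sum>i\<in>{1..j - 1}. s - st i)"
    proof (rule sum.cong)
      fix i assume "i \<in> {1..j - 1}"
      then have "st i \<le> st (j - 1)" by (intro st_mono) simp
      then show "max 0 (s - st i) = s - st i" using that by simp
    qed simp
    finally show ?thesis .
  qed
  have "tau t - tau (st (j - 1)) = (t - st (j - 1)) + ((\<Sum>i\<in>{1..j - 1}. t - st i) - (\<Sum>i\<in>{1..j - 1}. st (j - 1) - st i))"
    using *[OF t] *[of "st (j - 1)"] st_mono[of "j - 1" j] by simp
  also have "(\<Sum>i\<in>{1..j - 1}. t - st i) - (\<Sum>i\<in>{1..j - 1}. st (j - 1) - st i) = real (j - 1) * (t - st (j - 1))"
    unfolding sum_subtractf[symmetric] by simp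
  also have "(t - st (j - 1)) + \<dots> = real j * (t - st (j - 1))"
    using j by (simp add: of_nat_diff algebra_simps)
  finally show ?thesis by simp
qed

text \<open>Slope \<open>j\<close> on an interval of length \<open>r0 / j^2\<close> contributes
  \<open>r0 / j\<close>; the growth of the gain against the shrinking of the intervals thus leaves a
  harmonic sum.\<close>

lemma tau_st: "tau (st n) = r0 * harm n"
proof (induction n)
  case 0 then show ?case by (simp add: st_0 tau_0 harm_def)
next
  case (Suc n)
  have "tau (st (Suc n)) = tau (st n) + real (Suc n) * (st (Suc n) - st n)"
    using tau_piece[of "Suc n" "st (Suc n)"] st_mono[of n "Suc n"] by simp
  also have "real (Suc n) * (st (Suc n) - st n) = r0 / real (Suc n)"
    unfolding st_Suc by (simp add: power2_eq_square)
  finally show ?case unfolding Suc.IH harm_Suc by (simp add: inverse_eq_divide algebra_simps)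
qed

lemma tau_st_at_top: "filterlim (\<lambda>n. tau (st n)) at_top sequentially"
  unfolding tau_st
  by (rule filterlim_tendsto_pos_mult_at_top[OF tendsto_const r0_pos harm_at_top])

lemma tau_at_left: "filterlim tau at_top (at_left tf)"
  unfolding filterlim_at_top
proof
  fix Z
  obtain N where N: "Z \<le> tau (st N)"
    using tau_st_at_top unfolding filterlim_at_top eventually_sequentially by blast
  have "Z \<le> tau t" if "st N < t" "t < tf" for t
    using tau_increasing[of "st N" t] that N by simp
  then show "\<forall>\<^sub>F t in at_left tf. Z \<le> tau t"
    unfolding eventually_at_left_field using st_less by blast
qed

text \<open>The inverse of \<open>tau\<close>, leading from the autonomous time in
  \<open>{0..}\<close> back to \<open>{0..<tf}\<close>; its values at negative arguments carry no
  meaning.\<close>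

definition theta :: "real \<Rightarrow> real" where
  "theta \<sigma> = (SOME t. t \<in> {0..<tf} \<and> tau t = \<sigma>)"

lemma
  assumes "0 \<le> \<sigma>"
  shows theta_range: "theta \<sigma> \<in> {0..<tf}" and tau_theta: "tau (theta \<sigma>) = \<sigma>"
proof -
  obtain N where N: "\<sigma> \<le> tau (st N)"
    using tau_st_at_top unfolding filterlim_at_top eventually_sequentially by blast
  have "\<exists>t\<ge>0. t \<le> st N \<and> tau t = \<sigma>"
  proof (rule IVT')
    show "continuous_on {0..st N} tau"
      by (rule continuous_on_subset[OF tau_continuous]) (use st_less[of N] in auto)
  qed (use assms N tau_0 st_nonneg in auto)
  then have "\<exists>t. t \<in> {0..<tf} \<and> tau t = \<sigma>"
    using st_less[of N] by (metis atLeastLessThan_iff order_le_less_trans)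
  from someI_ex[OF this] show "theta \<sigma> \<in> {0..<tf}" "tau (theta \<sigma>) = \<sigma>"
    unfolding theta_def by auto
qed

lemma tau_nonneg: "t \<in> {0..<tf} \<Longrightarrow> 0 \<le> tau t"
  using tau_increasing[of 0 t] by (simp add: tau_0)

lemma theta_tau:
  assumes "t \<in> {0..<tf}"
  shows "theta (tau t) = t"
proof -
  have "theta (tau t) \<in> {0..<tf}" "tau (theta (tau t)) = tau t"
    using theta_range tau_theta tau_nonneg[OF assms] by auto
  then show ?thesis
    using tau_increasing[of t "theta (tau t)"] tau_increasing[of "theta (tau t)" t] assms by force
qed

lemma theta_mono:
  assumes "0 \<le> a" "a \<le> b"
  shows "theta a \<le> theta b" "theta b - theta a \<le> b - a"
proof -
  have *: "theta a \<in> {0..<tf}" "tau (theta a) = a" "theta b \<in> {0..<tf}" "tau (theta b) = b"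
    using assms theta_range tau_theta by auto
  show 1: "theta a \<le> theta b"
  proof (rule ccontr)
    assume "\<not> theta a \<le> theta b"
    then show False using tau_increasing[of "theta b" "theta a"] * assms by simp
  qed
  show "theta b - theta a \<le> b - a" using tau_increasing[OF 1] * by simp
qed

lemma theta_continuous: "continuous_on {0..} theta"
proof (rule continuous_onI)
  fix x e :: real assume x: "x \<in> {0..}" and e: "0 < e"
  have "dist (theta y) (theta x) \<le> e" if "y \<in> {0..}" "dist y x < e" for y
    using theta_mono[of x y] theta_mono[of y x] that x by (cases "x \<le> y") (auto simp: dist_real_def)
  then show "\<exists>d>0. \<forall>y\<in>{0..}. dist y x < d \<longrightarrow> dist (theta y) (theta x) \<le> e" using e by blast
qed

lemma theta_piece:
  assumes j: "1 \<le> j" and t: "st (j - 1) + s \<in> {st (j - 1)..st j}"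
  shows "theta (tau (st (j - 1)) + real j * s) = st (j - 1) + s"
proof -
  have "tau (st (j - 1) + s) = tau (st (j - 1)) + real j * s"
    using tau_piece[OF j t] by simp
  moreover have "st (j - 1) + s \<in> {0..<tf}"
    using t st_less[of j] st_nonneg[of "j - 1"] by auto
  ultimately show ?thesis using theta_tau by metis
qed

end

section \<open>Mild solutions of the transport equation\<close>

text \<open>One component of the closed loop: the density divided by \<open>P\<close> is transported with speed
  \<open>\<alpha> / P\<close>, and its value at 0 is \<open>\<kappa>\<close> times a boundary function \<open>b\<close>.\<close>

locale transport = switching tf r0 + decreasing_profile L P
  for tf r0 L :: real and P :: "real \<Rightarrow> real" +
  fixes \<alpha> \<kappa> :: real
  assumes \<alpha>_pos: "0 < \<alpha>"
begin

text \<open>The integrand is the reciprocal of the speed \<open>\<alpha> / P\<close>: this is the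
  autonomous time that a characteristic needs from 0 to \<open>x\<close>.\<close>

definition travel :: "real \<Rightarrow> real" where
  "travel x = integral {0..x} (\<lambda>y. P y / \<alpha>)"

lemma travel_0: "travel 0 = 0"
  by (simp add: travel_def)

lemma travel_DERIV:
  assumes "x \<in> {0..L}"
  shows "(travel has_real_derivative P x / \<alpha>) (at x within {0..L})"
  unfolding travel_def using assms \<alpha>_pos
  by (intro integral_has_real_derivative continuous_intros P_continuous) auto

lemma travel_continuous: "continuous_on {0..L} travel"
  using travel_DERIV by (rule DERIV_continuous_on)

lemma travel_diff:
  assumes "0 \<le> x" "x \<le> y" "y \<le> L"
  shows "travel y - travel x = integral {x..y} (\<lambda>y. P y / \<alpha>)"
proof -
  have "(\<lambda>y. P y / \<alpha>) integrable_on {0..y}"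
    using assms \<alpha>_pos by (intro integrable_continuous_real continuous_intros continuous_on_subset[OF P_continuous]) auto
  then have "travel x + integral {x..y} (\<lambda>y. P y / \<alpha>) = travel y"
    unfolding travel_def using assms by (intro Henstock_Kurzweil_Integration.integral_combine) auto
  then show ?thesis by simp
qed

lemma travel_mono:
  assumes "0 \<le> x" "x \<le> y" "y \<le> L"
  shows "travel x \<le> travel y"
proof -
  have "0 \<le> integral {x..y} (\<lambda>y. P y / \<alpha>)"
    using assms \<alpha>_pos P_nonneg
    by (intro integral_nonneg integrable_continuous_real continuous_intros continuous_on_subset[OF P_continuous]) auto
  then show ?thesis using travel_diff[OF assms] by simp
qed

lemma travel_nonneg: "x \<in> {0..L} \<Longrightarrow> 0 \<le> travel x"
  using travel_mono[of 0 x] by (simp add: travel_0)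

lemma travel_L: "\<alpha> * travel L = integral {0..L} P"
  using \<alpha>_pos by (simp add: travel_def)

lemma integral_P_pos: "0 < integral {0..L} P"
proof -
  have "integral {0..L} P \<noteq> 0"
  proof
    assume "integral {0..L} P = 0"
    then have "\<forall>x\<in>{0..L}. P x = 0"
      using integral_eq_0_iff[OF P_continuous L_pos] P_nonneg by blast
    then show False using P_pos[of 0] L_pos by auto
  qed
  moreover have "0 \<le> integral {0..L} P"
    by (rule integral_nonneg[OF integrable_continuous_real[OF P_continuous] P_nonneg])
  ultimately show ?thesis by simp
qed

lemma travel_L_pos: "0 < travel L"
  using integral_P_pos travel_L \<alpha>_pos by (metis zero_less_mult_pos)

end

text \<open>The mild equation of a single component, abstracted from the coupling: \<open>b\<close>
  is \<open>p0\<close> for the first density and \<open>p0\<close> plus the mass of the first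
  density for the second. The factor \<open>P 0 * \<kappa>\<close> will be \<open>lam1\<close> or
  \<open>lam2\<close>. Given solutions as well as the constructed ones are instances.\<close>

locale transport_solution = transport +
  fixes p :: "real \<Rightarrow> real \<Rightarrow> real" and b :: "real \<Rightarrow> real"
  assumes p_L1: "\<And>t. t \<in> {0..<tf} \<Longrightarrow> L1 L (\<lambda>x. p x t)"
    and p_measurable: "set_borel_measurable borel ({0<..<L} \<times> {0..<tf}) (\<lambda>(x, t). p x t)"
    and p_continuous: "\<And>t. t \<in> {0..<tf} \<Longrightarrow>
      ((\<lambda>s. LINT x:{0<..<L}|lborel. \<bar>p x s - p x t\<bar>) \<longlongrightarrow> 0) (at t within {0..<tf})"
    and b_continuous: "continuous_on {0..<tf} b"
    and p_mild: "\<And>j t. 1 \<le> j \<Longrightarrow> t \<in> {st (j - 1)..st j} \<Longrightarrow>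
      W11 L (\<lambda>x. 1 / P x * (LINT s:{st (j - 1)..t}|lborel. p x s)) \<and>
      trace0 L (\<lambda>x. LINT s:{st (j - 1)..t}|lborel. p x s) (P 0 * \<kappa> * integral {st (j - 1)..t} b) \<and>
      (AE x in lborel. x \<in> {0<..<L} \<longrightarrow> p x t - p x (st (j - 1)) =
        - real j * \<alpha> * wderiv L (\<lambda>x. 1 / P x * (LINT s:{st (j - 1)..t}|lborel. p x s)) x)"
begin

definition M :: "real \<Rightarrow> real \<Rightarrow> real" where
  "M x t = integral {0..x} (\<lambda>y. p y t)"

lemma M_diff_bound:
  assumes "x \<in> {0..L}" "s \<in> {0..<tf}" "t \<in> {0..<tf}"
  shows "\<bar>M x s - M x t\<bar> \<le> (LINT x:{0<..<L}|lborel. \<bar>p x s - p x t\<bar>)"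
proof -
  have d: "L1 L (\<lambda>x. p x s - p x t)" by (intro L1_diff p_L1 assms)
  have ad: "L1 L (\<lambda>x. \<bar>p x s - p x t\<bar>)"
    using d unfolding L1_def by (rule set_integrable_abs)
  have "M x s - M x t = integral {0..x} (\<lambda>y. p y s - p y t)"
    unfolding M_def using assms
    by (intro Henstock_Kurzweil_Integration.integral_diff[symmetric] L1_integrable_on[OF p_L1]) auto
  also have "\<bar>\<dots>\<bar> \<le> integral {0..x} (\<lambda>y. \<bar>p y s - p y t\<bar>)"
    using integral_norm_bound_integral[of "\<lambda>y. p y s - p y t" "{0..x}" "\<lambda>y. \<bar>p y s - p y t\<bar>"]
      L1_integrable_on[OF d, of 0 x] L1_integrable_on[OF ad, of 0 x] assms by simp
  also have "\<dots> \<le> integral {0..L} (\<lambda>y. \<bar>p y s - p y t\<bar>)"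
    using L1_integrable_on[OF ad] assms by (intro integral_subset_le) auto
  finally show ?thesis by (simp add: L1_LINT[OF ad])
qed

text \<open>The modulus of continuity in time is an \<open>L^1\<close> distance and hence uniform in
  \<open>x\<close>; combined with continuity in \<open>x\<close> at one fixed time this gives joint
  continuity.\<close>

lemma M_continuous: "continuous_on ({0..L} \<times> {0..<tf}) (\<lambda>(x, t). M x t)"
  unfolding continuous_on_iff
proof (intro ballI allI impI)
  fix q :: "real \<times> real" and e :: real
  assume q: "q \<in> {0..L} \<times> {0..<tf}" and e: "0 < e"
  obtain x t where xt: "q = (x, t)" "x \<in> {0..L}" "t \<in> {0..<tf}" using q by (cases q) auto
  define D where "D s = (LINT x:{0<..<L}|lborel. \<bar>p x s - p x t\<bar>)" for s
  have "(D \<longlongrightarrow> 0) (at t within {0..<tf})" unfolding D_def by (rule p_continuous[OF xt(3)])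
  then have "\<forall>\<^sub>F s in at t within {0..<tf}. D s < e/2"
    using e by (intro order_tendstoD(2)) auto
  then obtain d1 where d1: "0 < d1" "\<And>s. s \<in> {0..<tf} \<Longrightarrow> s \<noteq> t \<Longrightarrow> dist s t < d1 \<Longrightarrow> D s < e/2"
    unfolding eventually_at by blast
  have D0: "D t = 0" by (simp add: D_def)
  have D: "D s < e/2" if "s \<in> {0..<tf}" "dist s t < d1" for s
    using d1(2)[of s] that D0 e by (cases "s = t") auto
  have "continuous_on {0..L} (\<lambda>x. M x t)"
    unfolding M_def by (rule L1_indefinite_continuous[OF p_L1[OF xt(3)]])
  then obtain d2 where d2: "0 < d2" "\<And>y. y \<in> {0..L} \<Longrightarrow> dist y x < d2 \<Longrightarrow> dist (M y t) (M x t) < e/2"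
    unfolding continuous_on_iff using xt(2) e by (meson half_gt_zero)
  show "\<exists>d>0. \<forall>q'\<in>{0..L} \<times> {0..<tf}. dist q' q < d \<longrightarrow>
      dist (case q' of (x, t) \<Rightarrow> M x t) (case q of (x, t) \<Rightarrow> M x t) < e"
  proof (intro exI[of _ "min d1 d2"] conjI ballI impI)
    fix q' assume q': "q' \<in> {0..L} \<times> {0..<tf}" and d: "dist q' q < min d1 d2"
    obtain y s where ys: "q' = (y, s)" "y \<in> {0..L}" "s \<in> {0..<tf}" using q' by (cases q') auto
    have "dist y x < d2" "dist s t < d1"
      using dist_fst_le[of q' q] dist_snd_le[of q' q] d unfolding xt ys by auto
    then have "D s < e/2" "dist (M y t) (M x t) < e/2" using D d2 ys by auto
    moreover have "\<bar>M y s - M y t\<bar> \<le> D s"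
      unfolding D_def by (rule M_diff_bound[OF ys(2,3) xt(3)])
    ultimately have "\<bar>M y s - M x t\<bar> < e" unfolding dist_real_def by linarith
    then show "dist (case q' of (x, t) \<Rightarrow> M x t) (case q of (x, t) \<Rightarrow> M x t) < e"
      by (simp add: xt ys dist_real_def)
  qed (use d1 d2 in auto)
qed

lemma M_continuous_x: "t \<in> {0..<tf} \<Longrightarrow> continuous_on {0..L} (\<lambda>x. M x t)"
  unfolding M_def by (intro L1_indefinite_continuous p_L1)

text \<open>The norm is continuous in time, hence bounded on a compact interval. This supplies the
  majorant for exchanging time and space integrals.\<close>

lemma p_norm_bounded:
  assumes "0 \<le> a" "t < tf"
  obtains B where "\<And>s. s \<in> {a..t} \<Longrightarrow> (LINT x:{0<..<L}|lborel. \<bar>p x s\<bar>) \<le> B"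
proof -
  define N where "N s = (LINT x:{0<..<L}|lborel. \<bar>p x s\<bar>)" for s
  define D where "D s r = (LINT x:{0<..<L}|lborel. \<bar>p x s - p x r\<bar>)" for s r
  have ab: "L1 L (\<lambda>x. \<bar>u x\<bar>)" if "L1 L u" for u
    using that unfolding L1_def by (rule set_integrable_abs)
  have ND: "\<bar>N s - N r\<bar> \<le> D s r" if s: "s \<in> {0..<tf}" and r: "r \<in> {0..<tf}" for s r
  proof -
    note Ls = p_L1[OF s] and Lr = p_L1[OF r]
    have "N s - N r = (LINT x:{0<..<L}|lborel. \<bar>p x s\<bar> - \<bar>p x r\<bar>)"
      unfolding N_def by (rule set_integral_diff(2)[symmetric]) (use ab[OF Ls] ab[OF Lr] in \<open>simp_all only: L1_def\<close>)
    moreover have "(LINT x:{0<..<L}|lborel. \<bar>p x s\<bar> - \<bar>p x r\<bar>) \<le> D s r"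
      unfolding D_def by (rule set_integral_mono)
        (use L1_diff[OF ab[OF Ls] ab[OF Lr]] ab[OF L1_diff[OF Ls Lr]] in \<open>auto simp: L1_def\<close>)
    moreover have "N r - N s = (LINT x:{0<..<L}|lborel. \<bar>p x r\<bar> - \<bar>p x s\<bar>)"
      unfolding N_def by (rule set_integral_diff(2)[symmetric]) (use ab[OF Ls] ab[OF Lr] in \<open>simp_all only: L1_def\<close>)
    moreover have "(LINT x:{0<..<L}|lborel. \<bar>p x r\<bar> - \<bar>p x s\<bar>) \<le> D s r"
      unfolding D_def by (rule set_integral_mono)
        (use L1_diff[OF ab[OF Lr] ab[OF Ls]] ab[OF L1_diff[OF Ls Lr]] in \<open>auto simp: L1_def\<close>)
    ultimately show ?thesis by linarith
  qed
  have "continuous_on {0..<tf} N"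
    unfolding continuous_on_def
  proof
    fix r assume r: "r \<in> {0..<tf}"
    have "((\<lambda>s. N s - N r) \<longlongrightarrow> 0) (at r within {0..<tf})"
    proof (rule Lim_null_comparison)
      show "((\<lambda>s. D s r) \<longlongrightarrow> 0) (at r within {0..<tf})" unfolding D_def by (rule p_continuous[OF r])
      show "\<forall>\<^sub>F s in at r within {0..<tf}. norm (N s - N r) \<le> D s r"
        unfolding eventually_at_filter using ND[OF _ r] by (intro always_eventually) simp
    qed
    then show "(N \<longlongrightarrow> N r) (at r within {0..<tf})" by (rule LIM_zero_cancel)
  qed
  then have "continuous_on {a..t} N" by (rule continuous_on_subset) (use assms in auto)
  then have "compact (N ` {a..t})" by (intro compact_continuous_image) auto
  then obtain B where "\<And>s. s \<in> {a..t} \<Longrightarrow> \<bar>N s\<bar> \<le> B"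
    using compact_imp_bounded bounded_real by (metis image_eqI)
  then show ?thesis using that[of B] unfolding N_def by fastforce
qed

text \<open>Fubini on the rectangle of times in \<open>{a..t}\<close> and positions in
  \<open>{0<..<x}\<close>. It turns the pointwise time integrals of the mild formulation into
  statements about the continuous function \<open>M\<close>.\<close>

lemma
  assumes a: "0 \<le> a" and t: "t < tf"
  shows time_integral_L1: "L1 L (\<lambda>x. LINT s:{a..t}|lborel. p x s)"
    and time_integral_M: "x \<in> {0..L} \<Longrightarrow>
      integral {0..x} (\<lambda>y. LINT s:{a..t}|lborel. p y s) = integral {a..t} (M x)"
proof -
  have key: "L1 L (\<lambda>y. indicat_real {0<..<x} y * (LINT s:{a..t}|lborel. p y s))"
    "integral {0..x} (\<lambda>y. LINT s:{a..t}|lborel. p y s) = integral {a..t} (M x)"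
    if x: "x \<in> {0..L}" for x
  proof -
    \<comment> \<open>Joint measurability is known only on the rectangle, so the density is set to 0
      outside it; the cut-offs in \<open>f\<close> make this invisible.\<close>
    define Q where "Q = (\<lambda>(y, s). indicat_real ({0<..<L} \<times> {0..<tf}) (y, s) *\<^sub>R p y s)"
    have [measurable]: "Q \<in> borel_measurable (borel \<Otimes>\<^sub>M borel)"
      using p_measurable unfolding set_borel_measurable_def borel_prod Q_def
      by (simp add: case_prod_beta')
    define f where "f s y = indicat_real {a..t} s * (indicat_real {0<..<x} y * Q (y, s))" for s y
    have [measurable]: "(\<lambda>(s, y). f s y) \<in> borel_measurable (lborel \<Otimes>\<^sub>M lborel)"
      unfolding f_def by measurable
    have f: "f s y = indicat_real {a..t} s * (indicat_real {0<..<x} y * p y s)" for s y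
      using a t x by (auto simp: f_def Q_def indicator_def)
    obtain B where B: "\<And>s. s \<in> {a..t} \<Longrightarrow> (LINT x:{0<..<L}|lborel. \<bar>p x s\<bar>) \<le> B"
      by (rule p_norm_bounded[OF a t], blast)
    have px: "set_integrable lborel {0<..<x} (\<lambda>y. p y s)" if "s \<in> {a..t}" for s
    proof -
      have "L1 L (\<lambda>y. p y s)" using that a t by (intro p_L1) auto
      then show ?thesis unfolding L1_def by (rule set_integrable_subset) (use x in auto)
    qed
    have int: "integrable (lborel \<Otimes>\<^sub>M lborel) (\<lambda>(s, y). f s y)"
    proof (rule lborel_pair.Fubini_integrable)
      show "AE s in lborel. integrable lborel (\<lambda>y. case (s, y) of (s, y) \<Rightarrow> f s y)"
      proof (rule AE_I2)
        fix s
        show "integrable lborel (\<lambda>y. case (s, y) of (s, y) \<Rightarrow> f s y)"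
          using px[of s] by (cases "s \<in> {a..t}") (auto simp: f set_integrable_def)
      qed
      show "integrable lborel (\<lambda>s. \<integral>y. norm (case (s, y) of (s, y) \<Rightarrow> f s y) \<partial>lborel)"
      proof (rule Bochner_Integration.integrable_bound)
        show "integrable lborel (\<lambda>s. indicat_real {a..t} s * B)"
          by (intro integrable_mult_left integrable_real_indicator) (auto simp: emeasure_lborel_Icc_eq)
        show "(\<lambda>s. \<integral>y. norm (case (s, y) of (s, y) \<Rightarrow> f s y) \<partial>lborel) \<in> borel_measurable lborel"
          by measurable
        show "AE s in lborel. norm (\<integral>y. norm (case (s, y) of (s, y) \<Rightarrow> f s y) \<partial>lborel) \<le> norm (indicat_real {a..t} s * B)"
        proof (rule AE_I2)
          fix s
          show "norm (\<integral>y. norm (case (s, y) of (s, y) \<Rightarrow> f s y) \<partial>lborel) \<le> norm (indicat_real {a..t} s * B)"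
          proof (cases "s \<in> {a..t}")
            case True
            have "L1 L (\<lambda>y. p y s)" using True a t by (intro p_L1) auto
            then have i: "integrable lborel (\<lambda>y. indicat_real {0<..<L} y * \<bar>p y s\<bar>)"
              using set_integrable_abs[of lborel "{0<..<L}" "\<lambda>y. p y s"] unfolding L1_def set_integrable_def by simp
            have "(\<integral>y. norm (f s y) \<partial>lborel) \<le> (\<integral>y. indicat_real {0<..<L} y * \<bar>p y s\<bar> \<partial>lborel)"
              by (rule integral_mono_AE'[OF i]) (use True x in \<open>auto simp: f indicator_def\<close>)
            also have "\<dots> \<le> B" using B[OF True] by (simp add: set_lebesgue_integral_def)
            finally show ?thesis using True by simp
          qed (simp add: f)
        qed
      qed
    qed measurable
    have inner: "(\<integral>s. f s y \<partial>lborel) = indicat_real {0<..<x} y * (LINT s:{a..t}|lborel. p y s)" for y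
    proof -
      have "(\<integral>s. f s y \<partial>lborel) = (\<integral>s. indicat_real {0<..<x} y * (indicat_real {a..t} s *\<^sub>R p y s) \<partial>lborel)"
        by (intro Bochner_Integration.integral_cong) (auto simp: f)
      then show ?thesis by (simp add: set_lebesgue_integral_def)
    qed
    have inner2: "(\<integral>y. f s y \<partial>lborel) = indicat_real {a..t} s *\<^sub>R M x s" for s
    proof (cases "s \<in> {a..t}")
      case True
      have "L1 L (\<lambda>y. p y s)" using True a t by (intro p_L1) auto
      from L1_LINT_Ioo[OF this, of 0 x] True x show ?thesis
        by (simp add: f set_lebesgue_integral_def M_def)
    qed (simp add: f)
    have i2: "integrable lborel (\<lambda>y. indicat_real {0<..<x} y * (LINT s:{a..t}|lborel. p y s))"
      using lborel_pair.integrable_snd[OF int] unfolding inner .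
    have i1: "set_integrable lborel {a..t} (M x)"
      using lborel_pair.integrable_fst[OF int] unfolding inner2 set_integrable_def by simp
    have i3: "set_integrable lborel {0<..<x} (\<lambda>y. LINT s:{a..t}|lborel. p y s)"
      using i2 unfolding set_integrable_def by simp
    have "(\<lambda>y. indicat_real {0<..<L} y *\<^sub>R (indicat_real {0<..<x} y * (LINT s:{a..t}|lborel. p y s))) =
        (\<lambda>y. indicat_real {0<..<x} y * (LINT s:{a..t}|lborel. p y s))"
      using x by (auto simp: indicator_def fun_eq_iff)
    then show "L1 L (\<lambda>y. indicat_real {0<..<x} y * (LINT s:{a..t}|lborel. p y s))"
      unfolding L1_def set_integrable_def using i2 by simp
    have "integral {0..x} (\<lambda>y. LINT s:{a..t}|lborel. p y s) = (LINT y:{0<..<x}|lborel. LINT s:{a..t}|lborel. p y s)"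
      using set_borel_integral_eq_integral(2)[OF i3] by (simp add: integral_open_interval_real)
    also have "\<dots> = (\<integral>y. (\<integral>s. f s y \<partial>lborel) \<partial>lborel)"
      unfolding inner by (simp add: set_lebesgue_integral_def)
    also have "\<dots> = (\<integral>s. (\<integral>y. f s y \<partial>lborel) \<partial>lborel)"
      by (rule lborel_pair.Fubini_integral[OF int])
    also have "\<dots> = (LINT s:{a..t}|lborel. M x s)"
      unfolding inner2 set_lebesgue_integral_def ..
    also have "\<dots> = integral {a..t} (M x)"
      by (rule set_borel_integral_eq_integral(2)[OF i1])
    finally show "integral {0..x} (\<lambda>y. LINT s:{a..t}|lborel. p y s) = integral {a..t} (M x)" .
  qed
  show "integral {0..x} (\<lambda>y. LINT s:{a..t}|lborel. p y s) = integral {a..t} (M x)" if "x \<in> {0..L}"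
    by (rule key(2)[OF that])
  have "L1 L (\<lambda>y. indicat_real {0<..<L} y * (LINT s:{a..t}|lborel. p y s))"
    using key(1)[of L] L_pos by simp
  moreover have "(\<lambda>y. indicat_real {0<..<L} y *\<^sub>R (indicat_real {0<..<L} y * (LINT s:{a..t}|lborel. p y s))) =
     (\<lambda>y. indicat_real {0<..<L} y *\<^sub>R (LINT s:{a..t}|lborel. p y s))"
    by (auto simp: indicator_def fun_eq_iff)
  ultimately show "L1 L (\<lambda>x. LINT s:{a..t}|lborel. p x s)"
    unfolding L1_def set_integrable_def by simp
qed

text \<open>The equation determines the representative \<open>U\<close> of the weighted time
  integral: its derivative is the density increment divided by \<open>- real j * \<alpha>\<close>,
  and its value at 0 is \<kappa> times the integral of \<open>b\<close>. Multiplying by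
  \<open>P\<close> and integrating over space leaves an identity free of derivatives.\<close>

lemma M_time_integral:
  assumes j: "1 \<le> j" and t: "t \<in> {st (j - 1)..st j}" and x: "x \<in> {0..L}"
  defines "a \<equiv> st (j - 1)"
  shows "real j * integral {a..t} (M x) =
    integral {0..x} (\<lambda>y. P y * (real j * \<kappa> * integral {a..t} b - (M y t - M y a) / \<alpha>))"
proof -
  define Z where "Z x = (LINT s:{a..t}|lborel. p x s)" for x
  let ?w = "wderiv L (\<lambda>x. 1 / P x * Z x)"
  have a0: "0 \<le> a" and tf: "t < tf" "a < tf" "a \<le> t" "t \<in> {0..<tf}" "a \<in> {0..<tf}"
    using t st_less[of j] st_less[of "j - 1"] st_nonneg[of "j - 1"] by (auto simp: a_def)
  have W: "W11 L (\<lambda>x. 1 / P x * Z x)" and tr: "trace0 L Z (P 0 * \<kappa> * integral {a..t} b)"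
    and AE: "AE x in lborel. x \<in> {0<..<L} \<longrightarrow> p x t - p x a = - real j * \<alpha> * ?w x"
    using p_mild[OF j t] unfolding Z_def a_def by blast+
  obtain U where U: "abs_cont L U ?w" "AE x in lborel. x \<in> {0<..<L} \<longrightarrow> U x = 1 / P x * Z x"
    "abs_cont L (\<lambda>x. P x * U x) (wderiv L Z)" "AE x in lborel. x \<in> {0<..<L} \<longrightarrow> P x * U x = Z x" "W11 L Z"
    using weighted_W11[OF W] .
  have "P 0 * U 0 = P 0 * \<kappa> * integral {a..t} b"
    by (rule trace0_abs_cont[OF tr abs_cont_continuous[OF U(3)] U(4) L_pos])
  then have U0: "U 0 = \<kappa> * integral {a..t} b" using P_pos[of 0] L_pos by simp
  have jU: "real j * U y = real j * \<kappa> * integral {a..t} b - (M y t - M y a) / \<alpha>" if y: "y \<in> {0..L}" for y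
  proof -
    have "M y t - M y a = integral {0..y} (\<lambda>x. p x t - p x a)"
      unfolding M_def using y tf
      by (intro Henstock_Kurzweil_Integration.integral_diff[symmetric] L1_integrable_on[OF p_L1]) auto
    also have "\<dots> = integral {0..y} (\<lambda>x. - real j * \<alpha> * ?w x)"
      by (rule AE_integral_cong[OF AE]) (use y in auto)
    also have "\<dots> = - real j * \<alpha> * (U y - U 0)"
      using abs_cont_eq[OF U(1) y] by simp
    finally show ?thesis using \<alpha>_pos U0 by (simp add: field_simps)
  qed
  have "real j * integral {a..t} (M x) = real j * integral {0..x} Z"
    using time_integral_M[OF a0 tf(1) x] by (simp add: Z_def[abs_def])
  also have "integral {0..x} Z = integral {0..x} (\<lambda>y. P y * U y)"
    by (rule AE_integral_cong[symmetric, OF U(4)]) (use x in auto)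
  also have "real j * \<dots> = integral {0..x} (\<lambda>y. P y * (real j * U y))"
    by (simp add: mult.left_commute[of _ "real j"])
  also have "\<dots> = integral {0..x} (\<lambda>y. P y * (real j * \<kappa> * integral {a..t} b - (M y t - M y a) / \<alpha>))"
    by (rule integral_cong) (use x jU in simp)
  finally show ?thesis .
qed

end

section \<open>Primitives on the half-line and passage to the autonomous time\<close>

lemma indefinite_integral_DERIV_atLeast:
  fixes f :: "real \<Rightarrow> real"
  assumes "continuous_on {0..} f" "0 \<le> x"
  shows "((\<lambda>x. integral {0..x} f) has_real_derivative f x) (at x within {0..})"
proof -
  have "((\<lambda>x. integral {0..x} f) has_real_derivative f x) (at x within {0..x+1})"
    using assms by (intro integral_has_real_derivative continuous_on_subset[OF assms(1)]) auto
  moreover have "at x within {0..x+1} = at x within {0..}"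
    by (rule at_within_nhd[of x "{..<x+1}"]) auto
  ultimately show ?thesis by simp
qed

lemma indefinite_integral_continuous_atLeast:
  fixes f :: "real \<Rightarrow> real"
  assumes "continuous_on {0..} f"
  shows "continuous_on {0..} (\<lambda>x. integral {0..x} f)"
  by (rule DERIV_continuous_on, rule indefinite_integral_DERIV_atLeast[OF assms]) auto

lemma integral_diff_atLeast:
  fixes f :: "real \<Rightarrow> real"
  assumes "continuous_on {0..} f" "0 \<le> u" "u \<le> v"
  shows "integral {0..v} f - integral {0..u} f = integral {u..v} f"
proof -
  have "f integrable_on {0..v}"
    by (rule integrable_continuous_real[OF continuous_on_subset[OF assms(1)]]) auto
  then have "integral {0..u} f + integral {u..v} f = integral {0..v} f"
    using assms by (intro Henstock_Kurzweil_Integration.integral_combine) auto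
  then show ?thesis by simp
qed

context switching
begin

text \<open>On the image of the \<open>j\<close>-th interval \<open>theta\<close> is affine with
  slope \<open>1 / j\<close>. This substitution absorbs the factor \<open>j\<close> of the closed
  loop.\<close>

lemma integral_theta:
  fixes f :: "real \<Rightarrow> real"
  assumes f: "continuous_on {0..<tf} f" and j: "1 \<le> j" and t: "t \<in> {st (j - 1)..st j}"
  shows "integral {tau (st (j - 1))..tau t} (\<lambda>\<sigma>. f (theta \<sigma>)) = real j * integral {st (j - 1)..t} f"
proof -
  define a where "a = st (j - 1)"
  define c where "c = a - tau a / real j"
  have j0: "0 < real j" using j by simp
  have at: "0 \<le> a" "a \<le> t" "t < tf" using t st_less[of j] st_nonneg[of "j - 1"] by (auto simp: a_def)
  have taut: "tau t = tau a + real j * (t - a)" using tau_piece[OF j t] by (simp add: a_def)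
  have "f integrable_on {a..t}"
    by (rule integrable_continuous_real[OF continuous_on_subset[OF f]]) (use at in auto)
  then have "(f has_integral integral {a..t} f) (cbox a t)" by (simp add: integrable_integral)
  from has_integral_affinity'[OF this, of "1 / real j" c] j0
  have "((\<lambda>x. f (x / real j + c)) has_integral real j * integral {a..t} f) {(a - c) * real j..(t - c) * real j}"
    by (simp add: field_simps)
  moreover have "(a - c) * real j = tau a" "(t - c) * real j = tau t"
  proof -
    have "c * real j = a * real j - tau a" using j0 by (simp add: c_def left_diff_distrib)
    then show "(a - c) * real j = tau a" "(t - c) * real j = tau t"
      using taut by (simp_all add: left_diff_distrib right_diff_distrib mult.commute)
  qed
  ultimately have "((\<lambda>x. f (x / real j + c)) has_integral real j * integral {a..t} f) {tau a..tau t}" by simp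
  then have "((\<lambda>\<sigma>. f (theta \<sigma>)) has_integral real j * integral {a..t} f) {tau a..tau t}"
  proof (rule has_integral_eq[rotated])
    fix \<sigma> assume \<sigma>: "\<sigma> \<in> {tau a..tau t}"
    define s where "s = (\<sigma> - tau a) / real j"
    have s: "0 \<le> s" "s \<le> t - a" "\<sigma> = tau a + real j * s"
      using \<sigma> j0 taut by (auto simp: s_def field_simps)
    have "theta \<sigma> = a + s"
      using theta_piece[OF j, of s] s t by (auto simp: a_def)
    also have "\<dots> = \<sigma> / real j + c" by (simp add: s_def c_def diff_divide_distrib)
    finally show "f (\<sigma> / real j + c) = f (theta \<sigma>)" by simp
  qed
  then show ?thesis by (simp add: integral_unique a_def)
qed

lemma comp_theta_continuous:
  assumes "continuous_on {0..<tf} f"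
  shows "continuous_on {0..} (\<lambda>\<sigma>. f (theta \<sigma>))"
  by (rule continuous_on_compose2[OF assms theta_continuous], rule image_subsetI, rule theta_range) simp

end

section \<open>Characteristics and explicit formulas after the travel time\<close>

context transport_solution
begin

text \<open>Everything is now taken along \<open>theta\<close>, i.e. in the time in which the closed loop is autonomous.
  The density is only integrable, but \<open>V\<close>, the time integral of the mass accumulated up to \<open>x\<close>, is
  continuously differentiable in both variables, so that characteristics can be used classically.\<close>

definition m :: "real \<Rightarrow> real \<Rightarrow> real" where "m x \<sigma> = M x (theta \<sigma>)"
definition B :: "real \<Rightarrow> real" where "B \<sigma> = b (theta \<sigma>)"
definition S :: "real \<Rightarrow> real" where "S \<sigma> = integral {0..\<sigma>} B"
definition V :: "real \<Rightarrow> real \<Rightarrow> real" where "V x \<sigma> = integral {0..\<sigma>} (m x)"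

lemma B_continuous: "continuous_on {0..} B"
  unfolding B_def by (rule comp_theta_continuous[OF b_continuous])

lemma S_continuous: "continuous_on {0..} S"
  unfolding S_def by (rule indefinite_integral_continuous_atLeast[OF B_continuous])

lemma M_continuous_t: "x \<in> {0..L} \<Longrightarrow> continuous_on {0..<tf} (M x)"
proof -
  assume x: "x \<in> {0..L}"
  have "continuous_on {0..<tf} (\<lambda>t. (x, t))" by (intro continuous_intros)
  moreover have "(\<lambda>t. (x, t)) ` {0..<tf} \<subseteq> {0..L} \<times> {0..<tf}" using x by auto
  ultimately have "continuous_on {0..<tf} (\<lambda>t. case (x, t) of (x, t) \<Rightarrow> M x t)"
    by (rule continuous_on_compose2[OF M_continuous])
  then show ?thesis by simp
qed

lemma m_joint_continuous: "continuous_on ({0..L} \<times> {0..}) (\<lambda>(x, \<sigma>). m x \<sigma>)"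
proof -
  have "continuous_on ({0..L} \<times> {0..}) (\<lambda>q :: real \<times> real. theta (snd q))"
    by (rule continuous_on_compose2[OF theta_continuous]) (auto intro: continuous_intros)
  then have "continuous_on ({0..L} \<times> {0..}) (\<lambda>q. (fst q, theta (snd q)))"
    by (intro continuous_intros)
  then have "continuous_on ({0..L} \<times> {0..}) (\<lambda>q. (\<lambda>(x, t). M x t) (fst q, theta (snd q)))"
  proof (rule continuous_on_compose2[OF M_continuous])
    show "(\<lambda>q. (fst q, theta (snd q))) ` ({0..L} \<times> {0..}) \<subseteq> {0..L} \<times> {0..<tf}"
      by (rule image_subsetI) (simp add: mem_Times_iff theta_range del: atLeastLessThan_iff)
  qed
  then show ?thesis by (simp add: m_def case_prod_beta)
qed

lemma m_continuous: "x \<in> {0..L} \<Longrightarrow> continuous_on {0..} (m x)"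
  unfolding m_def by (rule comp_theta_continuous[OF M_continuous_t])

lemma m_continuous_x: "0 \<le> \<sigma> \<Longrightarrow> continuous_on {0..L} (\<lambda>x. m x \<sigma>)"
  unfolding m_def by (rule M_continuous_x[OF theta_range])

text \<open>In the new time the factor \<open>j\<close> is gone, so the integrated equations of
  consecutive intervals have the same form and telescope. The induction covers all times because the
  images of the switching times are unbounded.\<close>

lemma V_eq:
  assumes "0 \<le> \<sigma>" "x \<in> {0..L}"
  shows "V x \<sigma> = integral {0..x} (\<lambda>y. P y * (\<kappa> * S \<sigma> - (m y \<sigma> - m y 0) / \<alpha>))"
proof -
  have "\<forall>\<sigma>\<in>{0..tau (st n)}. V x \<sigma> = integral {0..x} (\<lambda>y. P y * (\<kappa> * S \<sigma> - (m y \<sigma> - m y 0) / \<alpha>))" for n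
  proof (induction n)
    case 0
    show ?case by (simp add: V_def S_def st_0 tau_0)
  next
    case (Suc n)
    define a where "a = st n"
    have a: "a \<in> {0..<tf}" "a \<le> st (Suc n)" using st_less[of n] st_nonneg[of n] st_mono[of n "Suc n"] by (auto simp: a_def)
    have ta: "0 \<le> tau a" by (rule tau_nonneg[OF a(1)])
    show ?case
    proof
      fix \<sigma> assume \<sigma>: "\<sigma> \<in> {0..tau (st (Suc n))}"
      show "V x \<sigma> = integral {0..x} (\<lambda>y. P y * (\<kappa> * S \<sigma> - (m y \<sigma> - m y 0) / \<alpha>))"
      proof (cases "\<sigma> \<le> tau a")
        case True then show ?thesis using Suc \<sigma> by (auto simp: a_def)
      next
        case False
        define t where "t = theta \<sigma>"
        have \<sigma>': "\<sigma> = tau t" using tau_theta[of \<sigma>] \<sigma> by (simp add: t_def)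
        have t: "t \<in> {a..st (Suc n)}"
          using theta_mono(1)[of "tau a" \<sigma>] theta_mono(1)[of \<sigma> "tau (st (Suc n))"] False \<sigma> ta
            theta_tau[OF a(1)] theta_tau[of "st (Suc n)"] st_less[of "Suc n"] st_nonneg[of "Suc n"]
          by (auto simp: t_def)
        have t': "t \<in> {st (Suc n - 1)..st (Suc n)}" using t by (simp add: a_def)
        have "V x \<sigma> - V x (tau a) = integral {tau a..tau t} (m x)"
          unfolding V_def \<sigma>' using False \<sigma>' by (intro integral_diff_atLeast m_continuous assms ta) simp
        also have "\<dots> = real (Suc n) * integral {a..t} (M x)"
          using integral_theta[OF M_continuous_t[OF assms(2)] _ t'] by (simp add: m_def[abs_def] a_def)
        also have "\<dots> = integral {0..x} (\<lambda>y. P y * (real (Suc n) * \<kappa> * integral {a..t} b - (M y t - M y a) / \<alpha>))"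
          using M_time_integral[OF _ t' assms(2)] by (simp add: a_def)
        also have "(\<lambda>y. P y * (real (Suc n) * \<kappa> * integral {a..t} b - (M y t - M y a) / \<alpha>)) =
          (\<lambda>y. P y * (\<kappa> * S \<sigma> - (m y \<sigma> - m y 0) / \<alpha>) - P y * (\<kappa> * S (tau a) - (m y (tau a) - m y 0) / \<alpha>))"
        proof
          fix y
          have "S \<sigma> - S (tau a) = integral {tau a..tau t} B"
            unfolding S_def \<sigma>' using False \<sigma>' by (intro integral_diff_atLeast B_continuous ta) simp
          also have "\<dots> = real (Suc n) * integral {a..t} b"
            using integral_theta[OF b_continuous _ t'] by (simp add: B_def[abs_def] a_def)
          finally have "real (Suc n) * \<kappa> * integral {a..t} b = \<kappa> * S \<sigma> - \<kappa> * S (tau a)"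
            by (simp add: algebra_simps)
          moreover have "m y \<sigma> = M y t" "m y (tau a) = M y a"
            by (simp_all add: m_def t_def theta_tau[OF a(1)])
          ultimately show "P y * (real (Suc n) * \<kappa> * integral {a..t} b - (M y t - M y a) / \<alpha>) =
            P y * (\<kappa> * S \<sigma> - (m y \<sigma> - m y 0) / \<alpha>) - P y * (\<kappa> * S (tau a) - (m y (tau a) - m y 0) / \<alpha>)"
            by (simp add: right_diff_distrib diff_divide_distrib)
        qed
        also have "integral {0..x} \<dots> = integral {0..x} (\<lambda>y. P y * (\<kappa> * S \<sigma> - (m y \<sigma> - m y 0) / \<alpha>)) -
           integral {0..x} (\<lambda>y. P y * (\<kappa> * S (tau a) - (m y (tau a) - m y 0) / \<alpha>))"
        proof (rule Henstock_Kurzweil_Integration.integral_diff)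
          have "continuous_on {0..x} (\<lambda>y. P y * (\<kappa> * S s - (m y s - m y 0) / \<alpha>))" if "0 \<le> s" for s
            using assms that \<alpha>_pos
            by (intro continuous_intros continuous_on_subset[OF P_continuous] continuous_on_subset[OF m_continuous_x]) auto
          then show "(\<lambda>y. P y * (\<kappa> * S \<sigma> - (m y \<sigma> - m y 0) / \<alpha>)) integrable_on {0..x}"
            "(\<lambda>y. P y * (\<kappa> * S (tau a) - (m y (tau a) - m y 0) / \<alpha>)) integrable_on {0..x}"
            using \<sigma> ta by (auto intro!: integrable_continuous_real)
        qed
        also have "integral {0..x} (\<lambda>y. P y * (\<kappa> * S (tau a) - (m y (tau a) - m y 0) / \<alpha>)) = V x (tau a)"
          using Suc ta by (auto simp: a_def)
        finally show ?thesis by simp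
      qed
    qed
  qed
  moreover obtain n where "\<sigma> \<le> tau (st n)"
    using tau_st_at_top unfolding filterlim_at_top eventually_sequentially by blast
  ultimately show ?thesis using assms by auto
qed

text \<open>Along the characteristic \<open>x \<mapsto> (x, c + travel x)\<close> the unknown \<open>m\<close> cancels from the derivative
  of \<open>V\<close>, whose partial derivatives are \<open>P x * (\<kappa> * S \<sigma> - (m x \<sigma> - m x 0) / \<alpha>)\<close> and \<open>m x \<sigma>\<close>.\<close>

lemma V_characteristic:
  assumes "0 \<le> c" "x \<in> {0..L}"
  shows "((\<lambda>x. V x (c + travel x)) has_real_derivative P x * (\<kappa> * S (c + travel x) + m x 0 / \<alpha>))
    (at x within {0..L})"
proof -
  define Vx where "Vx x \<sigma> = P x * (\<kappa> * S \<sigma> - (m x \<sigma> - m x 0) / \<alpha>)" for x \<sigma>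
  have D: "((\<lambda>(x, \<sigma>). V x \<sigma>) has_derivative (\<lambda>(tx, ty). Vx y s * tx + m y s * ty)) (at (y, s) within {0..L} \<times> {0..})"
    if ys: "y \<in> {0..L}" "0 \<le> s" for y s
  proof -
    have "((\<lambda>x. V x s) has_derivative (\<lambda>tx. Vx y s * tx)) (at y within {0..L})"
    proof -
      have "continuous_on {0..L} (\<lambda>y. Vx y s)"
        unfolding Vx_def using ys \<alpha>_pos by (intro continuous_intros P_continuous m_continuous_x) auto
      from integral_has_real_derivative[OF this ys(1)]
      have "((\<lambda>x. integral {0..x} (\<lambda>y. Vx y s)) has_real_derivative Vx y s) (at y within {0..L})" .
      then have "((\<lambda>x. V x s) has_real_derivative Vx y s) (at y within {0..L})"
        by (rule has_field_derivative_transform_within[OF _ zero_less_one ys(1)])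
           (use V_eq ys in \<open>simp add: Vx_def\<close>)
      then show ?thesis by (simp add: has_field_derivative_def)
    qed
    \<comment> \<open>For joint differentiability one partial derivative has to exist in the whole
      domain and be continuous, here the one in time, passed as a bounded linear map; the other is
      needed only at the point.\<close>
    moreover have "((\<lambda>s. V x s) has_derivative blinfun_apply (blinfun_scaleR_left (m x r))) (at r within {0..})"
      if "x \<in> {0..L}" "r \<in> {0..}" for x r
      using indefinite_integral_DERIV_atLeast[OF m_continuous[OF that(1)], of r] that(2)
      unfolding V_def by (simp add: has_field_derivative_def mult_commute_abs)
    moreover have "continuous (at (y, s) within {0..L} \<times> {0..}) (\<lambda>(x, r). blinfun_scaleR_left (m x r))"
    proof -
      have "continuous_on ({0..L} \<times> {0..}) (\<lambda>q. blinfun_scaleR_left (m (fst q) (snd q)) :: real \<Rightarrow>\<^sub>L real)"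
        using m_joint_continuous
        by (intro bounded_linear.continuous_on[OF bounded_linear_blinfun_scaleR_left]) (simp add: case_prod_beta')
      then show ?thesis using ys by (simp add: continuous_on_eq_continuous_within case_prod_beta')
    qed
    ultimately have "((\<lambda>(x, \<sigma>). V x \<sigma>) has_derivative (\<lambda>(tx, ty). Vx y s * tx + blinfun_apply (blinfun_scaleR_left (m y s)) ty))
      (at (y, s) within {0..L} \<times> {0..})"
      by (rule has_derivative_partialsI) (use ys in auto)
    then show ?thesis by (simp add: mult.commute)
  qed
  define G where "G q = V (fst q) (snd q)" for q
  define G' where "G' q t = Vx (fst q) (snd q) * fst t + m (fst q) (snd q) * snd t" for q t
  have "((\<lambda>x. G (x, c + travel x)) has_derivative (\<lambda>h. G' (x, c + travel x) (h, P x / \<alpha> * h))) (at x within {0..L})"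
  proof (rule has_derivative_in_compose2[where t = "{0..L} \<times> {0..}" and g' = G' and s = "{0..L}"])
    show "(G has_derivative G' q) (at q within {0..L} \<times> {0..})" if "q \<in> {0..L} \<times> {0..}" for q
      using D[of "fst q" "snd q"] that by (auto simp: G_def[abs_def] G'_def[abs_def] case_prod_beta')
    show "(\<lambda>x. (x, c + travel x)) ` {0..L} \<subseteq> {0..L} \<times> {0..}"
      using assms travel_nonneg by auto
    show "((\<lambda>x. (x, c + travel x)) has_derivative (\<lambda>h. (h, P x / \<alpha> * h))) (at x within {0..L})"
    proof (intro has_derivative_Pair has_derivative_ident)
      have "((\<lambda>x. c + travel x) has_real_derivative P x / \<alpha>) (at x within {0..L})"
        using travel_DERIV[OF assms(2)] by (auto intro!: derivative_eq_intros)
      then show "((\<lambda>x. c + travel x) has_derivative (*) (P x / \<alpha>)) (at x within {0..L})"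
        by (simp add: has_field_derivative_def)
    qed
  qed (rule assms(2))
  then have "((\<lambda>x. V x (c + travel x)) has_derivative
     (\<lambda>h. (Vx x (c + travel x) + m x (c + travel x) * (P x / \<alpha>)) * h)) (at x within {0..L})"
    by (simp add: G_def G'_def distrib_right mult.assoc)
  moreover have "Vx x (c + travel x) + m x (c + travel x) * (P x / \<alpha>) = P x * (\<kappa> * S (c + travel x) + m x 0 / \<alpha>)"
    by (simp add: Vx_def diff_divide_distrib algebra_simps)
  ultimately show ?thesis by (simp add: has_field_derivative_def)
qed

text \<open>\<open>F\<close> is \<open>V\<close> along the characteristic minus a primitive of its
  derivative, hence constant, and at \<open>x = 0\<close> the term \<open>V\<close> vanishes. The
  initial data survive only in the last integral, which does not depend on \<sigma>.\<close>

lemma V_formula: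
  assumes "x \<in> {0..L}" "travel x \<le> \<sigma>"
  shows "V x \<sigma> = \<alpha> * \<kappa> * (integral {0..\<sigma>} S - integral {0..\<sigma> - travel x} S)
     + integral {0..x} (\<lambda>y. P y * m y 0 / \<alpha>)"
proof -
  define c where "c = \<sigma> - travel x"
  have c: "0 \<le> c" using assms by (simp add: c_def)
  define F where "F x = V x (c + travel x) - \<alpha> * \<kappa> * integral {0..c + travel x} S
     - integral {0..x} (\<lambda>y. P y * m y 0 / \<alpha>)" for x
  have "(F has_real_derivative 0) (at y within {0..L})" if y: "y \<in> {0..L}" for y
  proof -
    have "((\<lambda>x. integral {0..c + travel x} S) has_real_derivative S (c + travel y) * (P y / \<alpha>)) (at y within {0..L})"
    proof (rule DERIV_image_chain[where f = "\<lambda>x. integral {0..x} S" and g = "\<lambda>x. c + travel x", unfolded o_def])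
      show "((\<lambda>x. integral {0..x} S) has_real_derivative S (c + travel y)) (at (c + travel y) within (\<lambda>x. c + travel x) ` {0..L})"
        by (rule DERIV_subset[OF indefinite_integral_DERIV_atLeast[OF S_continuous]]) (use c travel_nonneg y in auto)
      show "((\<lambda>x. c + travel x) has_real_derivative P y / \<alpha>) (at y within {0..L})"
        using travel_DERIV[OF y] by (auto intro!: derivative_eq_intros)
    qed
    moreover have "((\<lambda>x. integral {0..x} (\<lambda>y. P y * m y 0 / \<alpha>)) has_real_derivative P y * m y 0 / \<alpha>) (at y within {0..L})"
      using y \<alpha>_pos by (intro integral_has_real_derivative continuous_intros P_continuous m_continuous_x) auto
    ultimately have "(F has_real_derivative P y * (\<kappa> * S (c + travel y) + m y 0 / \<alpha>) - \<alpha> * \<kappa> * (S (c + travel y) * (P y / \<alpha>)) - P y * m y 0 / \<alpha>)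
      (at y within {0..L})"
      unfolding F_def by (intro DERIV_diff DERIV_cmult V_characteristic c y)
    then show ?thesis using \<alpha>_pos by (simp add: algebra_simps)
  qed
  then obtain k where k: "\<And>y. y \<in> {0..L} \<Longrightarrow> F y = k"
    using has_field_derivative_zero_constant[of "{0..L}" F] by auto
  have "F 0 = - (\<alpha> * \<kappa> * integral {0..c} S)"
    using V_eq[of c 0] c L_pos by (simp add: F_def travel_0)
  with k[of x] k[of 0] assms L_pos have "F x = - (\<alpha> * \<kappa> * integral {0..c} S)" by simp
  then show ?thesis by (simp add: F_def c_def algebra_simps)
qed

text \<open>Differentiating \<open>V_formula\<close> in \<sigma> removes the initial data: past the
  travel time the mass up to \<open>x\<close> consists of inflow alone. The strict inequality leaves
  room for a two-sided derivative.\<close>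

lemma m_formula:
  assumes "x \<in> {0..L}" "travel x < \<sigma>"
  shows "m x \<sigma> = \<alpha> * \<kappa> * (S \<sigma> - S (\<sigma> - travel x))"
proof -
  have \<sigma>: "0 < \<sigma>" using assms travel_nonneg by fastforce
  have inner: "at r within {0..} = at r" if "0 < r" for r :: real
    using that by (intro at_within_interior) (auto simp: interior_real_atLeast)
  have D1: "(V x has_real_derivative m x \<sigma>) (at \<sigma>)"
    using indefinite_integral_DERIV_atLeast[OF m_continuous[OF assms(1)], of \<sigma>] \<sigma> inner[OF \<sigma>] by (simp add: V_def[abs_def])
  have DS: "((\<lambda>r. integral {0..r} S) has_real_derivative S r) (at r)" if "0 < r" for r
    using indefinite_integral_DERIV_atLeast[OF S_continuous, of r] that inner[OF that] by simp
  have "((\<lambda>r. integral {0..r - travel x} S) has_real_derivative S (\<sigma> - travel x)) (at \<sigma>)"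
  proof -
    have "((\<lambda>r. r - travel x) has_real_derivative 1) (at \<sigma>)" by (auto intro!: derivative_eq_intros)
    moreover have "((\<lambda>r. integral {0..r} S) has_real_derivative S (\<sigma> - travel x)) (at (\<sigma> - travel x))"
      using assms by (intro DS) simp
    ultimately show ?thesis
      using DERIV_chain2[where f = "\<lambda>r. integral {0..r} S" and g = "\<lambda>r. r - travel x" and x = \<sigma> and Db = 1
        and Da = "S (\<sigma> - travel x)" and s = UNIV] by simp
  qed
  then have "((\<lambda>r. \<alpha> * \<kappa> * (integral {0..r} S - integral {0..r - travel x} S) + integral {0..x} (\<lambda>y. P y * m y 0 / \<alpha>))
      has_real_derivative \<alpha> * \<kappa> * (S \<sigma> - S (\<sigma> - travel x))) (at \<sigma>)"
    using DS[OF \<sigma>] by (auto intro!: derivative_eq_intros)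
  then have "(V x has_real_derivative \<alpha> * \<kappa> * (S \<sigma> - S (\<sigma> - travel x))) (at \<sigma>)"
  proof (rule has_field_derivative_transform_within_open[where S = "{travel x<..}"])
    show "\<alpha> * \<kappa> * (integral {0..r} S - integral {0..r - travel x} S) + integral {0..x} (\<lambda>y. P y * m y 0 / \<alpha>) = V x r"
      if "r \<in> {travel x<..}" for r
      using V_formula[OF assms(1), of r] that by simp
  qed (use assms in auto)
  with D1 show ?thesis by (rule DERIV_unique)
qed

text \<open>Differentiating \<open>m_formula\<close> in \<open>x\<close> shows that both sides have
  the same primitive. The condition on \<sigma> places every position past its travel time.\<close>

lemma p_formula:
  assumes \<sigma>: "travel L < \<sigma>"
  shows "AE x in lborel. x \<in> {0<..<L} \<longrightarrow> p x (theta \<sigma>) = \<kappa> * P x * B (\<sigma> - travel x)"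
proof (rule L1_AE_eqI)
  have le: "travel x < \<sigma>" if "x \<in> {0..L}" for x using travel_mono[of x L] that \<sigma> by simp
  have \<sigma>0: "0 \<le> \<sigma>" using le[of 0] travel_0 L_pos by simp
  show "L1 L (\<lambda>x. p x (theta \<sigma>))" by (rule p_L1[OF theta_range[OF \<sigma>0]])
  have "continuous_on {0..L} (\<lambda>x. B (\<sigma> - travel x))"
    by (rule continuous_on_compose2[OF B_continuous]) (use le in \<open>auto intro!: continuous_intros travel_continuous simp: less_imp_le\<close>)
  then have c: "continuous_on {0..L} (\<lambda>x. \<kappa> * P x * B (\<sigma> - travel x))"
    by (intro continuous_intros P_continuous)
  then show "L1 L (\<lambda>x. \<kappa> * P x * B (\<sigma> - travel x))" by (rule continuous_L1)
  fix x assume x: "x \<in> {0..L}"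
  have "((\<lambda>x. m x \<sigma>) has_real_derivative \<kappa> * P y * B (\<sigma> - travel y)) (at y within {0..L})" if y: "y \<in> {0..L}" for y
  proof -
    have "((\<lambda>x. S (\<sigma> - travel x)) has_real_derivative B (\<sigma> - travel y) * - (P y / \<alpha>)) (at y within {0..L})"
    proof (rule DERIV_image_chain[where f = S and g = "\<lambda>x. \<sigma> - travel x", unfolded o_def])
      show "(S has_real_derivative B (\<sigma> - travel y)) (at (\<sigma> - travel y) within (\<lambda>x. \<sigma> - travel x) ` {0..L})"
        unfolding S_def[abs_def]
        by (rule DERIV_subset[OF indefinite_integral_DERIV_atLeast[OF B_continuous]]) (use le y in \<open>auto simp: less_imp_le\<close>)
      show "((\<lambda>x. \<sigma> - travel x) has_real_derivative - (P y / \<alpha>)) (at y within {0..L})"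
        using travel_DERIV[OF y] by (auto intro!: derivative_eq_intros)
    qed
    then have "((\<lambda>x. \<alpha> * \<kappa> * (S \<sigma> - S (\<sigma> - travel x))) has_real_derivative
       \<alpha> * \<kappa> * (0 - B (\<sigma> - travel y) * - (P y / \<alpha>))) (at y within {0..L})"
      by (intro DERIV_cmult DERIV_diff DERIV_const)
    then have "((\<lambda>x. \<alpha> * \<kappa> * (S \<sigma> - S (\<sigma> - travel x))) has_real_derivative
       \<kappa> * P y * B (\<sigma> - travel y)) (at y within {0..L})"
      using \<alpha>_pos by (simp add: algebra_simps)
    then show ?thesis
      by (rule has_field_derivative_transform_within[OF _ zero_less_one y]) (use m_formula le in simp)
  qed
  from abs_cont_eq[OF abs_cont_DERIV[OF this c] x]
  have "m x \<sigma> = m 0 \<sigma> + integral {0..x} (\<lambda>x. \<kappa> * P x * B (\<sigma> - travel x))" .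
  then show "integral {0..x} (\<lambda>x. p x (theta \<sigma>)) = integral {0..x} (\<lambda>x. \<kappa> * P x * B (\<sigma> - travel x))"
    by (simp add: m_def M_def)
qed

text \<open>By \<open>p_formula\<close> a late density is a multiple of \<open>P\<close> by past
  boundary values, and no delay exceeds \<open>travel L\<close>; so convergence of \<open>B\<close>
  acts uniformly in \<open>x\<close>.\<close>

lemma p_tendsto:
  assumes B: "(B \<longlongrightarrow> c) at_top"
  shows "((\<lambda>t. LINT x:{0<..<L}|lborel. \<bar>p x t - \<kappa> * c * P x\<bar>) \<longlongrightarrow> 0) (at_left tf)"
proof -
  define h where "h t = (LINT x:{0<..<L}|lborel. \<bar>p x t - \<kappa> * c * P x\<bar>)" for t
  \<comment> \<open>The summand 1 keeps \<open>K\<close> positive even for \<kappa> equal to 0 and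
    makes the final estimate strict.\<close>
  define K where "K = \<bar>\<kappa>\<bar> * integral {0..L} P + 1"
  have K: "0 < K" using integral_P_pos by (simp add: K_def add_nonneg_pos)
  have "\<forall>\<^sub>F \<sigma> in at_top. dist (h (theta \<sigma>)) 0 < e" if e: "0 < e" for e
  proof -
    have "0 < e / K" using e K by simp
    from tendstoD[OF B this] obtain Z where Z: "\<And>r. Z \<le> r \<Longrightarrow> \<bar>B r - c\<bar> < e / K"
      by (auto simp: eventually_at_top_linorder dist_real_def)
    have "dist (h (theta \<sigma>)) 0 < e" if \<sigma>: "max 0 Z + travel L + 1 \<le> \<sigma>" for \<sigma>
    proof -
      have \<sigma>0: "travel L < \<sigma>" "0 \<le> \<sigma>" using \<sigma> travel_L_pos by auto
      have L1p: "L1 L (\<lambda>x. p x (theta \<sigma>))" by (rule p_L1[OF theta_range[OF \<sigma>0(2)]])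
      have LP: "L1 L P" by (rule continuous_L1[OF P_continuous])
      have Ld: "L1 L (\<lambda>x. \<bar>p x (theta \<sigma>) - \<kappa> * c * P x\<bar>)"
        using L1_diff[OF L1p L1_cmult[OF LP, of "\<kappa> * c"]] unfolding L1_def by (rule set_integrable_abs)
      have "h (theta \<sigma>) \<le> (LINT x:{0<..<L}|lborel. \<bar>\<kappa>\<bar> * (e / K) * P x)"
        unfolding h_def
      proof (rule set_integral_mono_AE)
        show "set_integrable lborel {0<..<L} (\<lambda>x. \<bar>p x (theta \<sigma>) - \<kappa> * c * P x\<bar>)" using Ld by (simp add: L1_def)
        show "set_integrable lborel {0<..<L} (\<lambda>x. \<bar>\<kappa>\<bar> * (e / K) * P x)"
          using L1_cmult[OF LP, of "\<bar>\<kappa>\<bar> * (e / K)"] by (simp only: L1_def)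
        show "AE x \<in> {0<..<L} in lborel. \<bar>p x (theta \<sigma>) - \<kappa> * c * P x\<bar> \<le> \<bar>\<kappa>\<bar> * (e / K) * P x"
          using p_formula[OF \<sigma>0(1)]
        proof eventually_elim
          case (elim x)
          show ?case
          proof
            assume x: "x \<in> {0<..<L}"
            have "\<bar>p x (theta \<sigma>) - \<kappa> * c * P x\<bar> = \<bar>\<kappa>\<bar> * P x * \<bar>B (\<sigma> - travel x) - c\<bar>"
            proof -
              have "p x (theta \<sigma>) - \<kappa> * c * P x = \<kappa> * P x * (B (\<sigma> - travel x) - c)"
                using elim x by (simp add: algebra_simps)
              then show ?thesis using P_nonneg[of x] x by (simp add: abs_mult)
            qed
            also have "\<dots> \<le> \<bar>\<kappa>\<bar> * P x * (e / K)"
            proof (intro mult_left_mono)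
              have "travel x \<le> travel L" using x by (intro travel_mono) auto
              then have "Z \<le> \<sigma> - travel x" using \<sigma> max.cobounded2[of Z 0] by linarith
              then show "\<bar>B (\<sigma> - travel x) - c\<bar> \<le> e / K" using Z by (simp add: less_imp_le)
            qed (use P_nonneg[of x] x in auto)
            finally show "\<bar>p x (theta \<sigma>) - \<kappa> * c * P x\<bar> \<le> \<bar>\<kappa>\<bar> * (e / K) * P x" by (simp add: mult_ac)
          qed
        qed
      qed
      also have "\<dots> = (\<bar>\<kappa>\<bar> * integral {0..L} P) * (e / K)" using L1_LINT[OF LP] by simp
      also have "\<dots> < K * (e / K)" using e K by (intro mult_strict_right_mono) (auto simp: K_def)
      also have "\<dots> = e" using K by simp
      finally have "h (theta \<sigma>) < e" .
      moreover have "0 \<le> h (theta \<sigma>)" unfolding h_def set_lebesgue_integral_def by (intro Bochner_Integration.integral_nonneg) simp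
      ultimately show ?thesis by simp
    qed
    then show ?thesis unfolding eventually_at_top_linorder by blast
  qed
  then have "((\<lambda>\<sigma>. h (theta \<sigma>)) \<longlongrightarrow> 0) at_top" by (rule tendstoI)
  from filterlim_compose[OF this tau_at_left]
  have "((\<lambda>t. h (theta (tau t))) \<longlongrightarrow> 0) (at_left tf)" .
  moreover have "\<forall>\<^sub>F t in at_left tf. h (theta (tau t)) = h t"
    unfolding eventually_at_left_field using tf_pos theta_tau by (intro exI[of _ 0]) auto
  ultimately show ?thesis unfolding h_def[symmetric] by (rule Lim_transform_eventually)
qed

end

lemma LINT_wderiv:
  assumes u: "L1 L u" "L1 L u'" and W: "W11 L z"
    and AE: "AE x in lborel. x \<in> {0<..<L} \<longrightarrow> u x - u' x = c * wderiv L z x"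
  shows "integral {0..L} u - integral {0..L} u' = c * (LINT x:{0<..<L}|lborel. wderiv L z x)"
proof -
  have Lw: "L1 L (wderiv L z)" using W11_has_wderiv[OF W] by (simp add: has_wderiv_def)
  have "integral {0..L} u - integral {0..L} u' = integral {0..L} (\<lambda>x. u x - u' x)"
    by (rule Henstock_Kurzweil_Integration.integral_diff[symmetric]) (auto intro: L1_integrable_on u)
  also have "\<dots> = integral {0..L} (\<lambda>x. c * wderiv L z x)"
    by (rule AE_integral_cong[OF AE]) auto
  finally show ?thesis by (simp add: L1_LINT[OF Lw])
qed

section \<open>Convergence of mild solutions\<close>

locale repair = switching tf r0 + P1: decreasing_profile L P1 + P2: decreasing_profile L P2
  for tf r0 L :: real and P1 P2 :: "real \<Rightarrow> real" +
  fixes lam1 lam2 \<alpha>1 \<alpha>2 p0s :: real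
  assumes lam_pos: "0 < lam1" "0 < lam2"
    and \<alpha>_pos: "0 < \<alpha>1" "0 < \<alpha>2"
    and P1_0: "P1 0 = lam1 * p0s"
    and P2_0: "P2 0 = lam2 * (p0s + integral {0..L} P1)"
    and P_mass: "p0s + integral {0..L} P1 + integral {0..L} P2 = 1"
begin

text \<open>Reciprocals of the desired boundary data. The entering value of the weighted density is
  the current datum over the desired one, and \<open>P1 0 * \<kappa>1\<close>,
  \<open>P2 0 * \<kappa>2\<close> are again the rates \<open>lam1\<close>,
  \<open>lam2\<close>.\<close>

definition \<kappa>1 :: real where "\<kappa>1 = 1 / p0s"
definition \<kappa>2 :: real where "\<kappa>2 = 1 / (p0s + integral {0..L} P1)"

sublocale T1: transport tf r0 L P1 \<alpha>1 \<kappa>1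
  by unfold_locales (rule \<alpha>_pos)

sublocale T2: transport tf r0 L P2 \<alpha>2 \<kappa>2
  by unfold_locales (rule \<alpha>_pos)

lemma p0s_pos: "0 < p0s"
proof -
  have "0 < lam1 * p0s" using P1.P_pos[of 0] P1.L_pos unfolding P1_0 by simp
  then show ?thesis using lam_pos(1) by (rule zero_less_mult_pos)
qed

lemma p0s_P1_pos: "0 < p0s + integral {0..L} P1"
  using p0s_pos T1.integral_P_pos by simp

lemma P1_0_\<kappa>1: "P1 0 * \<kappa>1 = lam1"
  using p0s_pos by (simp add: P1_0 \<kappa>1_def)

lemma P2_0_\<kappa>2: "P2 0 * \<kappa>2 = lam2"
  using p0s_P1_pos by (simp add: P2_0 \<kappa>2_def)

lemma \<kappa>_pos: "0 < \<kappa>1" "0 < \<kappa>2"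
  using p0s_pos p0s_P1_pos by (simp_all add: \<kappa>1_def \<kappa>2_def)

abbreviation closed_loop :: "nat \<Rightarrow> state \<Rightarrow> state \<Rightarrow> bool" where
  "closed_loop \<equiv> closed_loop_op L lam1 lam2 \<alpha>1 \<alpha>2 (\<lambda>x. 1 / P1 x) (\<lambda>x. 1 / P2 x)"

end

locale repair_solution = repair +
  fixes p0 :: "real \<Rightarrow> real" and p1 p2 :: "real \<Rightarrow> real \<Rightarrow> real"
    and \<phi>0 :: real and \<phi>1 \<phi>2 :: "real \<Rightarrow> real"
  assumes mild: "mild_solution L tf r0 closed_loop (\<phi>0, \<phi>1, \<phi>2) p0 p1 p2"
    and \<phi>_L1: "L1 L \<phi>1" "L1 L \<phi>2"
    and \<phi>_mass: "\<phi>0 + integral {0..L} \<phi>1 + integral {0..L} \<phi>2 = 1"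
begin

lemma p_L1: "t \<in> {0..<tf} \<Longrightarrow> L1 L (\<lambda>x. p1 x t)" "t \<in> {0..<tf} \<Longrightarrow> L1 L (\<lambda>x. p2 x t)"
  using mild by (auto simp: mild_solution_def Let_def)

lemma p_measurable:
  "set_borel_measurable borel ({0<..<L} \<times> {0..<tf}) (\<lambda>(x, t). p1 x t)"
  "set_borel_measurable borel ({0<..<L} \<times> {0..<tf}) (\<lambda>(x, t). p2 x t)"
  using mild by (simp_all add: mild_solution_def Let_def)

lemma LINT_abs_nonneg: "0 \<le> (LINT x:{0<..<L}|lborel. \<bar>u x :: real\<bar>)"
  unfolding set_lebesgue_integral_def by (intro Bochner_Integration.integral_nonneg) simp

lemma p_continuous:
  assumes "t \<in> {0..<tf}"
  shows "((\<lambda>s. \<bar>p0 s - p0 t\<bar>) \<longlongrightarrow> 0) (at t within {0..<tf})"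
    and "((\<lambda>s. LINT x:{0<..<L}|lborel. \<bar>p1 x s - p1 x t\<bar>) \<longlongrightarrow> 0) (at t within {0..<tf})"
    and "((\<lambda>s. LINT x:{0<..<L}|lborel. \<bar>p2 x s - p2 x t\<bar>) \<longlongrightarrow> 0) (at t within {0..<tf})"
proof -
  have D: "((\<lambda>s. dist_X L (p0 s, \<lambda>x. p1 x s, \<lambda>x. p2 x s) (p0 t, \<lambda>x. p1 x t, \<lambda>x. p2 x t)) \<longlongrightarrow> 0) (at t within {0..<tf})"
    using mild assms unfolding mild_solution_def Let_def by blast
  show "((\<lambda>s. \<bar>p0 s - p0 t\<bar>) \<longlongrightarrow> 0) (at t within {0..<tf})"
    by (rule Lim_null_comparison[OF _ D], rule always_eventually) (simp add: LINT_abs_nonneg add_nonneg_nonneg)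
  show "((\<lambda>s. LINT x:{0<..<L}|lborel. \<bar>p1 x s - p1 x t\<bar>) \<longlongrightarrow> 0) (at t within {0..<tf})"
    by (rule Lim_null_comparison[OF _ D], rule always_eventually) (simp add: LINT_abs_nonneg add_nonneg_nonneg)
  show "((\<lambda>s. LINT x:{0<..<L}|lborel. \<bar>p2 x s - p2 x t\<bar>) \<longlongrightarrow> 0) (at t within {0..<tf})"
    by (rule Lim_null_comparison[OF _ D], rule always_eventually) (simp add: LINT_abs_nonneg add_nonneg_nonneg)
qed

lemma p0_continuous: "continuous_on {0..<tf} p0"
  unfolding continuous_on_def
proof
  fix t assume "t \<in> {0..<tf}"
  from p_continuous(1)[OF this] have "((\<lambda>s. p0 s - p0 t) \<longlongrightarrow> 0) (at t within {0..<tf})"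
    by (rule tendsto_rabs_zero_cancel)
  then show "(p0 \<longlongrightarrow> p0 t) (at t within {0..<tf})" by (rule LIM_zero_cancel)
qed

lemma p_mild:
  assumes "1 \<le> j" "t \<in> {st (j - 1)..st j}"
  shows "closed_loop j (LINT s:{st (j - 1)..t}|lborel. p0 s,
       \<lambda>x. LINT s:{st (j - 1)..t}|lborel. p1 x s, \<lambda>x. LINT s:{st (j - 1)..t}|lborel. p2 x s)
     (p0 t - p0 (st (j - 1)), \<lambda>x. p1 x t - p1 x (st (j - 1)), \<lambda>x. p2 x t - p2 x (st (j - 1)))"
  using mild assms unfolding mild_solution_def Let_def by blast

lemma interval_subset:
  assumes "1 \<le> j" "t \<in> {st (j - 1)..st j}"
  shows "{st (j - 1)..t} \<subseteq> {0..<tf}" "t \<in> {0..<tf}" "st (j - 1) \<in> {0..<tf}"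
  using assms st_less[of j] st_nonneg[of "j - 1"] by auto

lemma LINT_continuous:
  assumes "1 \<le> j" "t \<in> {st (j - 1)..st j}" "continuous_on {0..<tf} f"
  shows "(LINT s:{st (j - 1)..t}|lborel. f s :: real) = integral {st (j - 1)..t} f"
  using set_borel_integral_eq_integral(2)
    borel_integrable_atLeastAtMost'[OF continuous_on_subset[OF assms(3) interval_subset(1)[OF assms(1,2)]]] .

sublocale T1: transport_solution tf r0 L P1 \<alpha>1 \<kappa>1 p1 p0
proof
  fix j :: nat and t assume jt: "1 \<le> j" "t \<in> {st (j - 1)..st j}"
  have "P1 0 * \<kappa>1 * integral {st (j - 1)..t} p0 = lam1 * (LINT s:{st (j - 1)..t}|lborel. p0 s)"
    unfolding P1_0_\<kappa>1 LINT_continuous[OF jt p0_continuous] ..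
  with p_mild[OF jt] show "W11 L (\<lambda>x. 1 / P1 x * (LINT s:{st (j - 1)..t}|lborel. p1 x s)) \<and>
      trace0 L (\<lambda>x. LINT s:{st (j - 1)..t}|lborel. p1 x s) (P1 0 * \<kappa>1 * integral {st (j - 1)..t} p0) \<and>
      (AE x in lborel. x \<in> {0<..<L} \<longrightarrow> p1 x t - p1 x (st (j - 1)) =
        - real j * \<alpha>1 * wderiv L (\<lambda>x. 1 / P1 x * (LINT s:{st (j - 1)..t}|lborel. p1 x s)) x)"
    by simp
qed (use p_L1 p_measurable p_continuous p0_continuous in auto)

text \<open>The total \<open>b2\<close> satisfies a delay equation of its own, without \<open>p0\<close> and \<open>p1\<close>; once it is known to
  converge, it is the right-hand side of the delay equation for \<open>p0\<close>.\<close>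

definition b2 :: "real \<Rightarrow> real" where "b2 t = p0 t + T1.M L t"

lemma M1_continuous: "continuous_on {0..<tf} (T1.M L)"
  using T1.M_continuous_t P1.L_pos by simp

sublocale T2: transport_solution tf r0 L P2 \<alpha>2 \<kappa>2 p2 b2
proof
  show c: "continuous_on {0..<tf} b2"
    unfolding b2_def by (intro continuous_intros p0_continuous M1_continuous)
  fix j :: nat and t assume jt: "1 \<le> j" "t \<in> {st (j - 1)..st j}"
  note sub = interval_subset[OF jt]
  have "integral {st (j - 1)..t} b2 = integral {st (j - 1)..t} p0 + integral {st (j - 1)..t} (T1.M L)"
    unfolding b2_def
    by (intro Henstock_Kurzweil_Integration.integral_add integrable_continuous_real
      continuous_on_subset[OF p0_continuous sub(1)] continuous_on_subset[OF M1_continuous sub(1)])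
  \<comment> \<open>Exchanging the integrals is what makes the boundary condition of
    \<open>p2\<close>, which contains the spatial integral of a time integral, one about
    \<open>b2\<close>.\<close>
  also have "integral {st (j - 1)..t} (T1.M L) = integral {0..L} (\<lambda>y. LINT s:{st (j - 1)..t}|lborel. p1 y s)"
    using T1.time_integral_M[of "st (j - 1)" t L] sub P1.L_pos st_nonneg by simp
  also have "\<dots> = (LINT x:{0<..<L}|lborel. LINT s:{st (j - 1)..t}|lborel. p1 x s)"
    using L1_LINT[OF T1.time_integral_L1[of "st (j - 1)" t]] sub st_nonneg by simp
  finally have "P2 0 * \<kappa>2 * integral {st (j - 1)..t} b2 = lam2 * (LINT s:{st (j - 1)..t}|lborel. p0 s) +
      lam2 * (LINT x:{0<..<L}|lborel. LINT s:{st (j - 1)..t}|lborel. p1 x s)"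
    unfolding P2_0_\<kappa>2 LINT_continuous[OF jt p0_continuous] by (simp only: distrib_left)
  with p_mild[OF jt] show "W11 L (\<lambda>x. 1 / P2 x * (LINT s:{st (j - 1)..t}|lborel. p2 x s)) \<and>
      trace0 L (\<lambda>x. LINT s:{st (j - 1)..t}|lborel. p2 x s) (P2 0 * \<kappa>2 * integral {st (j - 1)..t} b2) \<and>
      (AE x in lborel. x \<in> {0<..<L} \<longrightarrow> p2 x t - p2 x (st (j - 1)) =
        - real j * \<alpha>2 * wderiv L (\<lambda>x. 1 / P2 x * (LINT s:{st (j - 1)..t}|lborel. p2 x s)) x)"
    by simp
qed (use p_L1 p_measurable p_continuous in auto)

text \<open>On each interval the increment of \<open>p0\<close> is the negative of the sum of the
  two mass increments, since all are expressed by the same integrals of weak derivatives. The value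
  1 is inherited from the initial state.\<close>

lemma mass: "t \<in> {0..<tf} \<Longrightarrow> p0 t + T1.M L t + T2.M L t = 1"
proof -
  define N where "N t = p0 t + T1.M L t + T2.M L t" for t
  have step: "N t = N (st (j - 1))" if jt: "1 \<le> j" "t \<in> {st (j - 1)..st j}" for j t
  proof -
    note sub = interval_subset[OF jt]
    let ?w1 = "wderiv L (\<lambda>x. 1 / P1 x * (LINT s:{st (j - 1)..t}|lborel. p1 x s))"
    let ?w2 = "wderiv L (\<lambda>x. 1 / P2 x * (LINT s:{st (j - 1)..t}|lborel. p2 x s))"
    have p0: "p0 t - p0 (st (j - 1)) = real j * (\<alpha>1 * (LINT x:{0<..<L}|lborel. ?w1 x) + \<alpha>2 * (LINT x:{0<..<L}|lborel. ?w2 x))"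
      using p_mild[OF jt] by simp
    have "T1.M L t - T1.M L (st (j - 1)) = - real j * \<alpha>1 * (LINT x:{0<..<L}|lborel. ?w1 x)"
      unfolding T1.M_def using T1.p_mild[OF jt] by (intro LINT_wderiv p_L1 sub) auto
    moreover have "T2.M L t - T2.M L (st (j - 1)) = - real j * \<alpha>2 * (LINT x:{0<..<L}|lborel. ?w2 x)"
      unfolding T2.M_def using T2.p_mild[OF jt] by (intro LINT_wderiv p_L1 sub) auto
    ultimately show ?thesis using p0 by (simp add: N_def algebra_simps)
  qed
  have st: "N (st n) = N 0" for n
  proof (induction n)
    case (Suc n)
    then show ?case using step[of "Suc n" "st (Suc n)"] st_mono[of n "Suc n"] by simp
  qed (simp add: st_0)
  have "N 0 = 1"
  proof -
    have "dist_X L (p0 0, \<lambda>x. p1 x 0, \<lambda>x. p2 x 0) (\<phi>0, \<phi>1, \<phi>2) = 0"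
      using mild by (simp only: mild_solution_def Let_def)
    then have 0: "p0 0 = \<phi>0" "(LINT x:{0<..<L}|lborel. \<bar>p1 x 0 - \<phi>1 x\<bar>) = 0" "(LINT x:{0<..<L}|lborel. \<bar>p2 x 0 - \<phi>2 x\<bar>) = 0"
      using LINT_abs_nonneg[of "\<lambda>x. p1 x 0 - \<phi>1 x"] LINT_abs_nonneg[of "\<lambda>x. p2 x 0 - \<phi>2 x"] by auto
    \<comment> \<open>The initial condition holds only in \<open>L^1\<close>, which is enough for
      the masses to agree.\<close>
    have eq: "integral {0..L} u = integral {0..L} v" if u: "L1 L u" and v: "L1 L v" and 0: "(LINT x:{0<..<L}|lborel. \<bar>u x - v x\<bar>) = 0" for u v
    proof -
      have d: "L1 L (\<lambda>x. u x - v x)" by (rule L1_diff[OF u v])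
      then have ad: "L1 L (\<lambda>x. \<bar>u x - v x\<bar>)" unfolding L1_def by (rule set_integrable_abs)
      have "\<bar>integral {0..L} (\<lambda>x. u x - v x)\<bar> \<le> integral {0..L} (\<lambda>x. \<bar>u x - v x\<bar>)"
        using integral_norm_bound_integral[OF L1_integrable_on[OF d] L1_integrable_on[OF ad], of 0 L] by simp
      also have "\<dots> = 0" using 0 by (simp add: L1_LINT[OF ad])
      finally have "integral {0..L} (\<lambda>x. u x - v x) = 0" by simp
      moreover have "integral {0..L} (\<lambda>x. u x - v x) = integral {0..L} u - integral {0..L} v"
        by (rule Henstock_Kurzweil_Integration.integral_diff) (auto intro: L1_integrable_on u v)
      ultimately show ?thesis by simp
    qed
    have "0 \<in> {0..<tf}" using tf_pos by simp
    then show ?thesis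
      using eq[OF p_L1(1) \<phi>_L1(1) 0(2)] eq[OF p_L1(2) \<phi>_L1(2) 0(3)] \<phi>_mass 0(1)
      by (simp add: N_def T1.M_def T2.M_def)
  qed
  moreover assume t: "t \<in> {0..<tf}"
  moreover obtain j where "1 \<le> j" "t \<in> {st (j - 1)..<st j}"
    using st_interval[of t] t by auto
  ultimately show ?thesis using step[of j t] st[of "j - 1"] by (simp add: N_def)
qed

lemma integral_window:
  fixes f :: "real \<Rightarrow> real"
  assumes "T < \<sigma>" "0 \<le> T" "continuous_on {0..} f"
  shows "integral {0..\<sigma>} f - integral {0..\<sigma> - T} f = integral {\<sigma> - T..\<sigma>} f"
  using assms by (intro integral_diff_atLeast) auto

text \<open>Here the delay coefficient times the travel time is the mass of \<open>P2\<close>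
  divided by \<open>p0s\<close> plus the mass of \<open>P1\<close>, so the limit is that denominator
  over the total desired mass 1.\<close>

lemma B2_tendsto: "(T2.B \<longlongrightarrow> p0s + integral {0..L} P1) at_top"
proof -
  have "(T2.B \<longlongrightarrow> 1 / (1 + \<alpha>2 * \<kappa>2 * T2.travel L)) at_top"
  proof (rule delay_equation_tendsto[where m = "\<lambda>_. 1" and a = "T2.travel L + 1"])
    fix \<sigma> assume \<sigma>: "T2.travel L + 1 \<le> \<sigma>"
    then have \<sigma>': "T2.travel L < \<sigma>" "0 \<le> \<sigma>" using T2.travel_L_pos by auto
    have "T2.m L \<sigma> = \<alpha>2 * \<kappa>2 * integral {\<sigma> - T2.travel L..\<sigma>} T2.B"
      using T2.m_formula[of L \<sigma>] \<sigma>' P1.L_pos T2.travel_L_pos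
        integral_window[OF \<sigma>'(1) _ T2.B_continuous] by (simp add: T2.S_def)
    moreover have "T2.B \<sigma> + T2.m L \<sigma> = 1"
      using mass[OF theta_range[OF \<sigma>'(2)]] by (simp add: T2.B_def T2.m_def b2_def)
    ultimately show "T2.B \<sigma> + \<alpha>2 * \<kappa>2 * integral {\<sigma> - T2.travel L..\<sigma>} T2.B = 1" by simp
  qed (use \<alpha>_pos \<kappa>_pos T2.travel_L_pos T2.B_continuous in auto)
  moreover have "1 / (1 + \<alpha>2 * \<kappa>2 * T2.travel L) = p0s + integral {0..L} P1"
  proof -
    have "\<alpha>2 * \<kappa>2 * T2.travel L = \<kappa>2 * integral {0..L} P2"
      using T2.travel_L by (simp add: mult_ac)
    then show ?thesis using P_mass p0s_P1_pos by (simp add: \<kappa>2_def field_simps)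
  qed
  ultimately show ?thesis by simp
qed

text \<open>The delay coefficient times the travel time is the mass of \<open>P1\<close> divided by
  \<open>p0s\<close>; the denominator of the limit is therefore the limit of \<open>T2.B\<close>
  divided by \<open>p0s\<close>.\<close>

lemma B1_tendsto: "(T1.B \<longlongrightarrow> p0s) at_top"
proof -
  have "(T1.B \<longlongrightarrow> (p0s + integral {0..L} P1) / (1 + \<alpha>1 * \<kappa>1 * T1.travel L)) at_top"
  proof (rule delay_equation_tendsto[OF _ _ _ _ _ B2_tendsto, where a = "T1.travel L + 1"])
    fix \<sigma> assume \<sigma>: "T1.travel L + 1 \<le> \<sigma>"
    then have \<sigma>': "T1.travel L < \<sigma>" "0 \<le> \<sigma>" using T1.travel_L_pos by auto
    have "T1.m L \<sigma> = \<alpha>1 * \<kappa>1 * integral {\<sigma> - T1.travel L..\<sigma>} T1.B"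
      using T1.m_formula[of L \<sigma>] \<sigma>' P1.L_pos T1.travel_L_pos
        integral_window[OF \<sigma>'(1) _ T1.B_continuous] by (simp add: T1.S_def)
    then show "T1.B \<sigma> + \<alpha>1 * \<kappa>1 * integral {\<sigma> - T1.travel L..\<sigma>} T1.B = T2.B \<sigma>"
      by (simp add: T1.B_def T2.B_def T1.m_def b2_def)
  qed (use \<alpha>_pos \<kappa>_pos T1.travel_L_pos T1.B_continuous in auto)
  moreover have "(p0s + integral {0..L} P1) / (1 + \<alpha>1 * \<kappa>1 * T1.travel L) = p0s"
  proof -
    have "\<alpha>1 * \<kappa>1 * T1.travel L = \<kappa>1 * integral {0..L} P1"
      using T1.travel_L by (simp add: mult_ac)
    then show ?thesis using p0s_pos p0s_P1_pos by (simp add: \<kappa>1_def field_simps)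
  qed
  ultimately show ?thesis by simp
qed

lemma tendsto_target:
  "((\<lambda>t. dist_X L (p0 t, \<lambda>x. p1 x t, \<lambda>x. p2 x t) (p0s, P1, P2)) \<longlongrightarrow> 0) (at_left tf)"
proof -
  have "((\<lambda>t. T1.B (tau t)) \<longlongrightarrow> p0s) (at_left tf)"
    by (rule filterlim_compose[OF B1_tendsto tau_at_left])
  moreover have "\<forall>\<^sub>F t in at_left tf. T1.B (tau t) = p0 t"
    unfolding eventually_at_left_field using tf_pos theta_tau by (intro exI[of _ 0]) (auto simp: T1.B_def)
  ultimately have "(p0 \<longlongrightarrow> p0s) (at_left tf)" by (rule Lim_transform_eventually)
  then have "((\<lambda>t. \<bar>p0 t - p0s\<bar>) \<longlongrightarrow> 0) (at_left tf)"
    by (intro tendsto_rabs_zero LIM_zero)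
  moreover have "((\<lambda>t. LINT x:{0<..<L}|lborel. \<bar>p1 x t - P1 x\<bar>) \<longlongrightarrow> 0) (at_left tf)"
    using T1.p_tendsto[OF B1_tendsto] p0s_pos by (simp add: \<kappa>1_def)
  moreover have "((\<lambda>t. LINT x:{0<..<L}|lborel. \<bar>p2 x t - P2 x\<bar>) \<longlongrightarrow> 0) (at_left tf)"
    using T2.p_tendsto[OF B2_tendsto] p0s_P1_pos by (simp add: \<kappa>2_def)
  ultimately have "((\<lambda>t. \<bar>p0 t - p0s\<bar> + (LINT x:{0<..<L}|lborel. \<bar>p1 x t - P1 x\<bar>)
      + (LINT x:{0<..<L}|lborel. \<bar>p2 x t - P2 x\<bar>)) \<longlongrightarrow> 0 + 0 + 0) (at_left tf)"
    by (intro tendsto_add)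
  then show ?thesis by simp
qed

end

section \<open>Existence of mild solutions\<close>

definition translation_continuous :: "(real \<Rightarrow> real) \<Rightarrow> bool" where
  "translation_continuous f \<longleftrightarrow> ((\<lambda>\<delta>. \<integral>x. \<bar>f (x + \<delta>) - f x\<bar> \<partial>lborel) \<longlongrightarrow> 0) (at 0)"

lemma integrable_translate:
  fixes f :: "real \<Rightarrow> real"
  assumes "integrable lborel f"
  shows "integrable lborel (\<lambda>x. f (x + \<delta>))"
  using lborel_integrable_real_affine[OF assms, of 1 \<delta>] by (simp add: add.commute)

lemma integral_translate:
  fixes f :: "real \<Rightarrow> real"
  shows "(\<integral>x. f (x + \<delta>) \<partial>lborel) = (\<integral>x. f x \<partial>lborel)"
  using lborel_integral_real_affine[of 1 f \<delta>] by (simp add: add.commute)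

text \<open>The distance between the translates of \<open>f\<close> and \<open>g\<close> equals that
  between \<open>f\<close> and \<open>g\<close>, so a uniformly good approximation costs the same
  error twice, whatever the shift.\<close>

lemma translation_continuous_approx:
  assumes f: "integrable lborel f"
    and approx: "\<And>e. 0 < e \<Longrightarrow> \<exists>g. integrable lborel g \<and> translation_continuous g \<and> (\<integral>x. \<bar>f x - g x\<bar> \<partial>lborel) \<le> e"
  shows "translation_continuous f"
  unfolding translation_continuous_def
proof (rule tendstoI)
  fix e :: real assume e: "0 < e"
  then obtain g where g: "integrable lborel g" "translation_continuous g" "(\<integral>x. \<bar>f x - g x\<bar> \<partial>lborel) \<le> e / 4"
    using approx[of "e / 4"] by auto
  have "\<forall>\<^sub>F \<delta> in at 0. (\<integral>x. \<bar>g (x + \<delta>) - g x\<bar> \<partial>lborel) < e / 4"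
    by (rule order_tendstoD(2)[OF g(2)[unfolded translation_continuous_def]]) (use e in simp)
  then show "\<forall>\<^sub>F \<delta> in at 0. dist (\<integral>x. \<bar>f (x + \<delta>) - f x\<bar> \<partial>lborel) 0 < e"
  proof eventually_elim
    case (elim \<delta>)
    note ff = f integrable_translate[OF f, of \<delta>] and gg = g(1) integrable_translate[OF g(1), of \<delta>]
    have "(\<integral>x. \<bar>f (x + \<delta>) - f x\<bar> \<partial>lborel) \<le>
      (\<integral>x. \<bar>f (x + \<delta>) - g (x + \<delta>)\<bar> + \<bar>g (x + \<delta>) - g x\<bar> + \<bar>f x - g x\<bar> \<partial>lborel)"
      using ff gg by (intro integral_mono) auto
    also have "\<dots> = (\<integral>x. \<bar>f (x + \<delta>) - g (x + \<delta>)\<bar> \<partial>lborel) + (\<integral>x. \<bar>g (x + \<delta>) - g x\<bar> \<partial>lborel)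
        + (\<integral>x. \<bar>f x - g x\<bar> \<partial>lborel)"
      using ff gg by simp
    also have "(\<integral>x. \<bar>f (x + \<delta>) - g (x + \<delta>)\<bar> \<partial>lborel) = (\<integral>x. \<bar>f x - g x\<bar> \<partial>lborel)"
      by (rule integral_translate)
    finally have "(\<integral>x. \<bar>f (x + \<delta>) - f x\<bar> \<partial>lborel) < e" using elim g(3) e by simp
    moreover have "0 \<le> (\<integral>x. \<bar>f (x + \<delta>) - f x\<bar> \<partial>lborel)" by simp
    ultimately show ?case by (simp add: dist_real_def)
  qed
qed

text \<open>For open \<open>U\<close> the indicator is lower semicontinuous, so the products of its translates with
  itself converge pointwise to it, while translation preserves its integral.\<close>

lemma translation_continuous_open:
  assumes U: "open U" "emeasure lborel U < \<infinity>"
  shows "translation_continuous (indicat_real U)"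
  unfolding translation_continuous_def tendsto_at_iff_sequentially
proof (intro allI impI)
  fix X :: "nat \<Rightarrow> real" assume X: "X \<longlonglongrightarrow> 0"
  let ?f = "indicat_real U"
  have f: "integrable lborel ?f" using U by (intro integrable_real_indicator) auto
  have prod: "integrable lborel (\<lambda>x. ?f (x + \<delta>) * ?f x)" for \<delta>
  proof (rule Bochner_Integration.integrable_bound[OF f])
    show "(\<lambda>x. ?f (x + \<delta>) * ?f x) \<in> borel_measurable lborel"
      using borel_measurable_integrable[OF f] borel_measurable_integrable[OF integrable_translate[OF f, of \<delta>]]
      by (rule borel_measurable_times[rotated])
  qed (auto simp: indicator_def)
  \<comment> \<open>For \<open>u\<close> and \<open>v\<close> in \<open>{0, 1}\<close> one has
    \<open>\<bar>u - v\<bar> = u + v - 2 * (u * v)\<close>, so only the products have to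
    converge.\<close>
  have eq: "(\<integral>x. \<bar>?f (x + \<delta>) - ?f x\<bar> \<partial>lborel) = 2 * (\<integral>x. ?f x \<partial>lborel) - 2 * (\<integral>x. ?f (x + \<delta>) * ?f x \<partial>lborel)" for \<delta>
  proof -
    have "(\<integral>x. \<bar>?f (x + \<delta>) - ?f x\<bar> \<partial>lborel) = (\<integral>x. ?f (x + \<delta>) + ?f x - 2 * (?f (x + \<delta>) * ?f x) \<partial>lborel)"
      by (intro Bochner_Integration.integral_cong) (auto simp: indicator_def)
    also have "\<dots> = (\<integral>x. ?f (x + \<delta>) \<partial>lborel) + (\<integral>x. ?f x \<partial>lborel) - 2 * (\<integral>x. ?f (x + \<delta>) * ?f x \<partial>lborel)"
      using f integrable_translate[OF f, of \<delta>] prod[of \<delta>] by simp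
    also have "(\<integral>x. ?f (x + \<delta>) \<partial>lborel) = (\<integral>x. ?f x \<partial>lborel)" by (rule integral_translate)
    finally show ?thesis by simp
  qed
  have "(\<lambda>n. \<integral>x. ?f (x + X n) * ?f x \<partial>lborel) \<longlonglongrightarrow> (\<integral>x. ?f x \<partial>lborel)"
  proof (rule integral_dominated_convergence[where w = ?f])
    show "AE x in lborel. (\<lambda>n. ?f (x + X n) * ?f x) \<longlonglongrightarrow> ?f x"
    proof (rule AE_I2, cases)
      fix x assume x: "x \<in> U"
      have "(\<lambda>n. x + X n) \<longlonglongrightarrow> x + 0" by (intro tendsto_intros X)
      then have "\<forall>\<^sub>F n in sequentially. x + X n \<in> U"
        using topological_tendstoD[OF _ U(1)] x by fastforce
      then have "\<forall>\<^sub>F n in sequentially. ?f (x + X n) * ?f x = ?f x"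
        by eventually_elim (use x in simp)
      then show "(\<lambda>n. ?f (x + X n) * ?f x) \<longlonglongrightarrow> ?f x" by (rule tendsto_eventually)
    next
      fix x assume "x \<notin> U"
      then show "(\<lambda>n. ?f (x + X n) * ?f x) \<longlonglongrightarrow> ?f x" by simp
    qed
    show "?f \<in> borel_measurable lborel" by (rule borel_measurable_integrable[OF f])
    show "(\<lambda>x. ?f (x + X n) * ?f x) \<in> borel_measurable lborel" for n
      by (rule borel_measurable_integrable[OF prod])
  qed (use f in \<open>auto simp: indicator_def\<close>)
  then have "(\<lambda>n. 2 * (\<integral>x. ?f x \<partial>lborel) - 2 * (\<integral>x. ?f (x + X n) * ?f x \<partial>lborel)) \<longlonglongrightarrow>
    2 * (\<integral>x. ?f x \<partial>lborel) - 2 * (\<integral>x. ?f x \<partial>lborel)"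
    by (intro tendsto_diff tendsto_mult tendsto_const)
  then show "((\<lambda>\<delta>. \<integral>x. \<bar>?f (x + \<delta>) - ?f x\<bar> \<partial>lborel) \<circ> X) \<longlonglongrightarrow> 0"
    by (simp add: o_def eq)
qed

text \<open>Outer regularity reduces indicators of Borel sets to open sets of finite measure; sums,
  and limits dominated by \<open>2 * \<bar>f x\<bar>\<close>, preserve the property.\<close>

lemma integrable_translation_continuous:
  assumes "integrable lborel f"
  shows "translation_continuous f"
  using assms
proof (induction f rule: integrable_induct)
  case (base A c)
  have A: "integrable lborel (indicat_real A)" using base by (intro integrable_real_indicator) auto
  have 1: "translation_continuous (indicat_real A)"
  proof (rule translation_continuous_approx[OF A])
    fix e :: real assume e: "0 < e"
    obtain U where U: "open U" "A \<subseteq> U" "emeasure lborel (U - A) \<le> e"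
      using outer_regular_lborel_le[of A e] base e by auto
    have "emeasure lborel U \<le> emeasure lborel A + emeasure lborel (U - A)"
      using U base emeasure_subadditive[of A lborel "U - A"] by (simp add: Un_absorb1)
    also have "\<dots> < \<infinity>" using base U(3) by (simp add: ennreal_add_less_top order_le_less_trans)
    finally have Uf: "emeasure lborel U < \<infinity>" .
    have "(\<integral>x. \<bar>indicat_real A x - indicat_real U x\<bar> \<partial>lborel) = (\<integral>x. indicat_real (U - A) x \<partial>lborel)"
      using U by (intro Bochner_Integration.integral_cong) (auto simp: indicator_def)
    also have "\<dots> = measure lborel (U - A)" using U base by simp
    also have "\<dots> \<le> e" using U(3) e by (simp add: measure_def enn2real_leI)
    finally show "\<exists>g. integrable lborel g \<and> translation_continuous g \<and> (\<integral>x. \<bar>indicat_real A x - g x\<bar> \<partial>lborel) \<le> e"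
      using translation_continuous_open[OF U(1) Uf] U(1) Uf
      by (intro exI[of _ "indicat_real U"]) (auto intro!: integrable_real_indicator)
  qed
  have "(\<integral>x. \<bar>indicat_real A (x + \<delta>) *\<^sub>R c - indicat_real A x *\<^sub>R c\<bar> \<partial>lborel) =
     (\<integral>x. \<bar>indicat_real A (x + \<delta>) - indicat_real A x\<bar> \<partial>lborel) * \<bar>c\<bar>" for \<delta>
    unfolding real_scaleR_def left_diff_distrib[symmetric] abs_mult by simp
  then show ?case
    using tendsto_mult_right[OF 1[unfolded translation_continuous_def], of "\<bar>c\<bar>"]
    by (simp only: translation_continuous_def mult_zero_left)
next
  case (add f g)
  have lim: "((\<lambda>\<delta>. (\<integral>x. \<bar>f (x + \<delta>) - f x\<bar> \<partial>lborel) + (\<integral>x. \<bar>g (x + \<delta>) - g x\<bar> \<partial>lborel)) \<longlongrightarrow> 0) (at 0)"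
    using tendsto_add[of _ 0 _ _ 0] add(3,4) unfolding translation_continuous_def by fastforce
  show ?case
    unfolding translation_continuous_def
  proof (rule Lim_null_comparison[OF _ lim])
    show "\<forall>\<^sub>F \<delta> in at 0. norm (\<integral>x. \<bar>f (x + \<delta>) + g (x + \<delta>) - (f x + g x)\<bar> \<partial>lborel)
        \<le> (\<integral>x. \<bar>f (x + \<delta>) - f x\<bar> \<partial>lborel) + (\<integral>x. \<bar>g (x + \<delta>) - g x\<bar> \<partial>lborel)"
    proof (rule always_eventually, rule allI)
      fix \<delta>
      note i = add(1,2) integrable_translate[OF add(1), of \<delta>] integrable_translate[OF add(2), of \<delta>]
      have "(\<integral>x. \<bar>f (x + \<delta>) + g (x + \<delta>) - (f x + g x)\<bar> \<partial>lborel) \<le>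
        (\<integral>x. \<bar>f (x + \<delta>) - f x\<bar> + \<bar>g (x + \<delta>) - g x\<bar> \<partial>lborel)"
        using i by (intro integral_mono) auto
      also have "\<dots> = (\<integral>x. \<bar>f (x + \<delta>) - f x\<bar> \<partial>lborel) + (\<integral>x. \<bar>g (x + \<delta>) - g x\<bar> \<partial>lborel)"
        using i by simp
      finally show "norm (\<integral>x. \<bar>f (x + \<delta>) + g (x + \<delta>) - (f x + g x)\<bar> \<partial>lborel)
        \<le> (\<integral>x. \<bar>f (x + \<delta>) - f x\<bar> \<partial>lborel) + (\<integral>x. \<bar>g (x + \<delta>) - g x\<bar> \<partial>lborel)" by simp
    qed
  qed
next
  case (lim f s)
  show ?case
  proof (rule translation_continuous_approx[OF lim(4)])
    fix e :: real assume e: "0 < e"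
    have "(\<lambda>i. \<integral>x. \<bar>f x - s i x\<bar> \<partial>lborel) \<longlonglongrightarrow> (\<integral>x. 0 \<partial>(lborel :: real measure))"
    proof (rule integral_dominated_convergence[where w = "\<lambda>x. 3 * \<bar>f x\<bar>"])
      show "(\<lambda>x. \<bar>f x - s i x\<bar>) \<in> borel_measurable lborel" for i
        using lim(1)[of i] lim(4) by (intro borel_measurable_integrable) auto
      show "integrable lborel (\<lambda>x. 3 * \<bar>f x\<bar>)" using lim(4) by auto
      show "AE x in lborel. (\<lambda>i. \<bar>f x - s i x\<bar>) \<longlonglongrightarrow> 0"
      proof (rule AE_I2)
        fix x :: real
        have "(\<lambda>i. s i x) \<longlonglongrightarrow> f x" using lim(2) by simp
        then have "(\<lambda>i. \<bar>f x - s i x\<bar>) \<longlonglongrightarrow> \<bar>f x - f x\<bar>" by (intro tendsto_intros)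
        then show "(\<lambda>i. \<bar>f x - s i x\<bar>) \<longlonglongrightarrow> 0" by simp
      qed
      show "AE x in lborel. norm \<bar>f x - s i x\<bar> \<le> 3 * \<bar>f x\<bar>" for i
      proof (rule AE_I2)
        fix x :: real
        have "\<bar>s i x\<bar> \<le> 2 * \<bar>f x\<bar>" using lim(3)[of x i] by simp
        then show "norm \<bar>f x - s i x\<bar> \<le> 3 * \<bar>f x\<bar>" by simp
      qed
    qed simp
    then have "\<forall>\<^sub>F i in sequentially. (\<integral>x. \<bar>f x - s i x\<bar> \<partial>lborel) < e"
      using e by (intro order_tendstoD(2)) auto
    then obtain i where "(\<integral>x. \<bar>f x - s i x\<bar> \<partial>lborel) < e"
      by (auto simp: eventually_sequentially)
    then show "\<exists>g. integrable lborel g \<and> translation_continuous g \<and> (\<integral>x. \<bar>f x - g x\<bar> \<partial>lborel) \<le> e"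
      using lim(1,5) by (intro exI[of _ "s i"]) auto
  qed
qed

section \<open>Characteristic coordinates and construction of the transported density\<close>

context transport
begin

definition P_ext :: "real \<Rightarrow> real" where "P_ext x = P (max 0 (min L x))"

text \<open>\<open>travel\<close> continued to the whole line, since the substitution rule needs two-sided derivatives.\<close>

definition G :: "real \<Rightarrow> real" where "G x = (LBINT y=0..x. P_ext y / \<alpha>)"

lemma P_ext_eq: "x \<in> {0..L} \<Longrightarrow> P_ext x = P x"
  by (simp add: P_ext_def)

lemma P_ext_continuous: "continuous_on A P_ext"
  unfolding P_ext_def
  by (rule continuous_on_compose2[OF P_continuous]) (use L_pos in \<open>auto intro!: continuous_intros\<close>)

lemma P_ext_nonneg: "0 \<le> P_ext x"
  unfolding P_ext_def using L_pos by (intro P_nonneg) auto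

lemma G_DERIV: "(G has_real_derivative P_ext x / \<alpha>) (at x)"
  unfolding G_def[abs_def] using \<alpha>_pos by (intro LBINT_DERIV continuous_intros P_ext_continuous) auto

lemma G_continuous: "continuous_on A G"
  using G_DERIV by (intro continuous_at_imp_continuous_on) (auto intro: DERIV_isCont)

lemma G_eq_travel:
  assumes "x \<in> {0..L}"
  shows "G x = travel x"
proof -
  have *: "((\<lambda>y. P_ext y / \<alpha>) has_integral (G x - G 0)) {0..x}"
    using assms G_DERIV
    by (intro fundamental_theorem_of_calculus)
      (auto simp: has_real_derivative_iff_has_vector_derivative[symmetric] intro: has_field_derivative_at_within)
  moreover have "integral {0..x} (\<lambda>y. P_ext y / \<alpha>) = travel x"
    unfolding travel_def using assms by (intro integral_cong) (simp add: P_ext_eq)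
  moreover have "G 0 = 0" by (simp add: G_def zero_ereal_def)
  ultimately show ?thesis using integral_unique[OF *] by simp
qed

lemma travel_strict_mono:
  assumes "0 \<le> x" "x < y" "y \<le> L"
  shows "travel x < travel y"
proof -
  have c: "continuous_on {x..y} (\<lambda>z. P z / \<alpha>)"
    using assms \<alpha>_pos by (intro continuous_intros continuous_on_subset[OF P_continuous]) auto
  have "integral {x..y} (\<lambda>z. P z / \<alpha>) \<noteq> 0"
  proof
    assume "integral {x..y} (\<lambda>z. P z / \<alpha>) = 0"
    then have "\<forall>z\<in>{x..y}. P z / \<alpha> = 0"
      using integral_eq_0_iff[OF c assms(2)] P_nonneg \<alpha>_pos assms by simp
    then have "P x = 0" using assms \<alpha>_pos by simp
    then show False using P_pos[of x] assms by simp
  qed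
  then have "travel y - travel x \<noteq> 0" by (subst travel_diff) (use assms in auto)
  then show ?thesis using travel_mono[of x y] assms by simp
qed

lemma travel_image: "travel ` {0..L} = {0..travel L}"
proof
  show "travel ` {0..L} \<subseteq> {0..travel L}"
    using travel_mono travel_nonneg by auto
  show "{0..travel L} \<subseteq> travel ` {0..L}"
  proof
    fix r assume "r \<in> {0..travel L}"
    then have "\<exists>x\<ge>0. x \<le> L \<and> travel x = r"
      using L_pos travel_0 by (intro IVT' travel_continuous) auto
    then show "r \<in> travel ` {0..L}" by auto
  qed
qed

lemma travel_inj: "inj_on travel {0..L}"
proof (rule inj_onI)
  fix x y assume "x \<in> {0..L}" "y \<in> {0..L}" "travel x = travel y"
  then show "x = y"
    using travel_strict_mono[of x y] travel_strict_mono[of y x] by (cases x y rule: linorder_cases) auto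
qed

definition X :: "real \<Rightarrow> real" where "X = inv_into {0..L} travel"

lemma X_travel: "x \<in> {0..L} \<Longrightarrow> X (travel x) = x"
  unfolding X_def by (rule inv_into_f_f[OF travel_inj])

lemma X_continuous: "continuous_on {0..travel L} X"
  using continuous_on_inv[OF travel_continuous, of X] X_travel by (simp add: travel_image)

lemma X_range:
  assumes "r \<in> {0<..<travel L}"
  shows "X r \<in> {0<..<L}"
proof -
  have "r \<in> travel ` {0..L}" using assms unfolding travel_image by simp
  then obtain x where x: "x \<in> {0..L}" "r = travel x" by blast
  then have "x \<noteq> 0" "x \<noteq> L" using assms travel_0 by auto
  then show ?thesis using x X_travel by auto
qed

lemma X_range_Icc:
  assumes "r \<in> {0..travel L}"
  shows "X r \<in> {0..L}"
proof -
  have "r \<in> travel ` {0..L}" using assms unfolding travel_image .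
  then show ?thesis using X_travel by auto
qed

text \<open>The initial density in the coordinate \<open>r = travel x\<close>. As \<open>dr\<close>
  is \<open>P / \<alpha>\<close> times \<open>dx\<close>, the factor \<open>\<alpha> / P\<close>
  preserves mass.\<close>

definition initial_part :: "(real \<Rightarrow> real) \<Rightarrow> real \<Rightarrow> real" where
  "initial_part \<phi> r = (if r \<in> {0<..<travel L} then \<alpha> * \<phi> (X r) / P (X r) else 0)"

text \<open>On the negative side: the weighted density enters with value \<kappa> times
  \<open>s\<close>, and passing to a density in \<open>r\<close> multiplies it by \<alpha>.\<close>

definition profile :: "(real \<Rightarrow> real) \<Rightarrow> (real \<Rightarrow> real) \<Rightarrow> real \<Rightarrow> real" where
  "profile \<phi> s r = (if r \<le> 0 then \<alpha> * \<kappa> * s (- r) else initial_part \<phi> r)"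

lemma initial_part_measurable:
  assumes "L1 L \<phi>"
  shows "initial_part \<phi> \<in> borel_measurable borel"
proof -
  define \<phi>' where "\<phi>' x = indicat_real {0<..<L} x *\<^sub>R \<phi> x" for x
  define X' where "X' r = indicat_real {0..travel L} r *\<^sub>R X r" for r
  define P' where "P' r = indicat_real {0..travel L} r *\<^sub>R P (X r)" for r
  have [measurable]: "\<phi>' \<in> borel_measurable borel"
    using borel_measurable_integrable[OF assms[unfolded L1_def set_integrable_def]] by (simp add: \<phi>'_def[abs_def])
  have [measurable]: "X' \<in> borel_measurable borel"
    unfolding X'_def[abs_def] by (intro borel_measurable_continuous_on_indicator X_continuous) simp
  have "continuous_on {0..travel L} (\<lambda>r. P (X r))"
    using X_range_Icc by (intro continuous_on_compose2[OF P_continuous X_continuous]) blast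
  then have [measurable]: "P' \<in> borel_measurable borel"
    unfolding P'_def[abs_def] by (intro borel_measurable_continuous_on_indicator) simp
  have "(\<lambda>r. if r \<in> {0<..<travel L} then \<alpha> * \<phi>' (X' r) / P' r else 0) \<in> borel_measurable borel" by measurable
  moreover have "(\<lambda>r. if r \<in> {0<..<travel L} then \<alpha> * \<phi>' (X' r) / P' r else 0) = initial_part \<phi>"
    using X_range by (auto simp: fun_eq_iff initial_part_def \<phi>'_def X'_def P'_def)
  ultimately show ?thesis by (simp only:)
qed

lemma initial_part_travel:
  assumes "x \<in> {0<..<L}"
  shows "initial_part \<phi> (travel x) * (P x / \<alpha>) = \<phi> x" "travel x \<in> {0<..<travel L}"
proof -
  show t: "travel x \<in> {0<..<travel L}"
    using assms travel_strict_mono[of 0 x] travel_strict_mono[of x L] travel_0 by auto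
  have "initial_part \<phi> (travel x) = \<alpha> * \<phi> x / P x"
    unfolding initial_part_def using t assms X_travel[of x] by simp
  then show "initial_part \<phi> (travel x) * (P x / \<alpha>) = \<phi> x"
    using P_pos[of x] assms \<alpha>_pos by simp
qed

text \<open>The substitution \<open>r = travel x\<close> preserves the \<open>L^1\<close> norm. At
  the endpoints, where it could be singular, \<open>initial_part\<close> is 0 by definition.\<close>

lemma initial_part_integrable:
  assumes \<phi>: "L1 L \<phi>"
  shows "integrable lborel (initial_part \<phi>)"
proof (rule integrableI_bounded)
  show meas: "initial_part \<phi> \<in> borel_measurable lborel" using initial_part_measurable[OF \<phi>] by simp
  let ?f = "\<lambda>r. \<bar>initial_part \<phi> r\<bar>"
  have [measurable]: "initial_part \<phi> \<in> borel_measurable borel" using initial_part_measurable[OF \<phi>] .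
  have G0: "G 0 = 0" "G L = travel L" using G_eq_travel[of 0] G_eq_travel[of L] travel_0 L_pos by auto
  have "(\<integral>\<^sup>+ r. ennreal (norm (initial_part \<phi> r)) \<partial>lborel) = (\<integral>\<^sup>+ r. ?f r * indicator {G 0..G L} r \<partial>lborel)"
    by (intro nn_integral_cong) (auto simp: G0 initial_part_def indicator_def)
  also have "\<dots> = (\<integral>\<^sup>+ x. ?f (G x) * (P_ext x / \<alpha>) * indicator {0..L} x \<partial>lborel)"
  proof (rule nn_integral_substitution)
    show "set_borel_measurable borel {G 0..G L} ?f" unfolding set_borel_measurable_def by measurable
    show "(G has_real_derivative P_ext x / \<alpha>) (at x)" for x by (rule G_DERIV)
    show "continuous_on {0..L} (\<lambda>x. P_ext x / \<alpha>)" using \<alpha>_pos by (intro continuous_intros P_ext_continuous) auto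
    show "0 \<le> P_ext x / \<alpha>" for x using P_ext_nonneg \<alpha>_pos by simp
  qed (use L_pos in auto)
  also have "\<dots> = (\<integral>\<^sup>+ x. ennreal (norm (indicat_real {0<..<L} x *\<^sub>R \<phi> x)) \<partial>lborel)"
  proof (rule nn_integral_cong)
    fix x :: real
    consider "x \<in> {0<..<L}" | "x = 0 \<or> x = L" | "x \<notin> {0..L}" by fastforce
    then show "ennreal (?f (G x) * (P_ext x / \<alpha>) * indicator {0..L} x) = ennreal (norm (indicat_real {0<..<L} x *\<^sub>R \<phi> x))"
    proof cases
      case 1
      have nn: "0 \<le> P x / \<alpha>" using P_nonneg[of x] \<alpha>_pos 1 by simp
      have "?f (G x) * (P_ext x / \<alpha>) = \<bar>initial_part \<phi> (travel x) * (P x / \<alpha>)\<bar>"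
      proof -
        have "G x = travel x" "P_ext x = P x" using 1 G_eq_travel P_ext_eq by auto
        then show ?thesis by (simp only: abs_mult abs_of_nonneg[OF nn])
      qed
      also have "\<dots> = \<bar>\<phi> x\<bar>" by (simp only: initial_part_travel(1)[OF 1])
      finally show ?thesis using 1 by simp
    qed (auto simp: G0 initial_part_def)
  qed
  also have "\<dots> < \<infinity>" using \<phi> unfolding L1_def set_integrable_def integrable_iff_bounded by blast
  finally show "(\<integral>\<^sup>+ r. ennreal (norm (initial_part \<phi> r)) \<partial>lborel) < \<infinity>" .
qed

end

text \<open>In the coordinate \<open>r = travel x\<close> the transport is a translation. It acts on \<open>profile\<close>,
  whose value at \<open>r \<le> 0\<close> encodes the boundary value entering at time \<open>- r\<close>.\<close>

locale transport_data = transport +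
  fixes \<phi> s :: "real \<Rightarrow> real"
  assumes \<phi>_L1: "L1 L \<phi>" and s_continuous: "continuous_on {0..} s"
begin

definition h :: "real \<Rightarrow> real" where "h = profile \<phi> s"

lemma h_eq: "h r = \<alpha> * \<kappa> * (indicat_real {..0} r * s (- r)) + initial_part \<phi> r"
  by (simp add: h_def profile_def initial_part_def)

lemma h_measurable [measurable]: "h \<in> borel_measurable borel"
proof -
  have "continuous_on {..0} (\<lambda>r. s (- r))"
    by (intro continuous_on_compose2[OF s_continuous] continuous_intros) auto
  then have [measurable]: "(\<lambda>r. indicat_real {..0} r * s (- r)) \<in> borel_measurable borel"
    using borel_measurable_continuous_on_indicator[of "{..0::real}" "\<lambda>r. s (- r)"] by simp
  have [measurable]: "initial_part \<phi> \<in> borel_measurable borel" by (rule initial_part_measurable[OF \<phi>_L1])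
  show ?thesis unfolding h_eq[abs_def] by measurable
qed

lemma h_set_integrable: "set_integrable lborel {a..b} h"
proof -
  have c: "continuous_on {min a 0..0} (\<lambda>r. s (- r))"
    by (intro continuous_on_compose2[OF s_continuous] continuous_intros) auto
  have "set_integrable lborel ({a..b} \<inter> {..0}) (\<lambda>r. s (- r))"
    by (rule set_integrable_subset[OF borel_integrable_atLeastAtMost'[OF c]]) auto
  then have "set_integrable lborel {a..b} (\<lambda>r. indicat_real {..0} r * s (- r))"
    by (simp only: set_integrable_def real_scaleR_def indicator_inter_arith mult.assoc)
  moreover have "set_integrable lborel {a..b} (initial_part \<phi>)"
    unfolding set_integrable_def by (intro integrable_mult_indicator initial_part_integrable \<phi>_L1) simp
  ultimately show ?thesis
    unfolding h_eq[abs_def] by (intro set_integral_add set_integrable_mult_right) auto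
qed

lemma h_integrable_on: "h integrable_on {a..b}"
  by (rule set_borel_integral_eq_integral(1)[OF h_set_integrable])

text \<open>The primitive of \<open>h\<close> with value 0 at 0: on the positive axis it is
  cumulated initial mass, on the negative axis minus the cumulated inflow.\<close>

definition H :: "real \<Rightarrow> real" where
  "H r = (if 0 \<le> r then integral {0..r} h else - integral {r..0} h)"

lemma H_diff:
  assumes "a \<le> b"
  shows "H b - H a = integral {a..b} h"
proof -
  have c: "integral {u..v} h + integral {v..w} h = integral {u..w} h" if "u \<le> v" "v \<le> w" for u v w
    using that by (intro Henstock_Kurzweil_Integration.integral_combine h_integrable_on) auto
  consider "0 \<le> a" | "a < 0" "0 \<le> b" | "b < 0" by linarith
  then show ?thesis
  proof cases
    case 1 then show ?thesis using c[of 0 a b] assms by (simp add: H_def)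
  next
    case 2 then show ?thesis using c[of a 0 b] by (simp add: H_def)
  next
    case 3 then show ?thesis using c[of a b 0] assms by (simp add: H_def)
  qed
qed

lemma H_neg:
  assumes "0 \<le> r"
  shows "H (- r) = - \<alpha> * \<kappa> * integral {0..r} s"
proof (cases "r = 0")
  case False
  have "integral {- r..0} h = integral {- r..0} (\<lambda>x. \<alpha> * \<kappa> * s (- x))"
    by (rule integral_cong) (simp add: h_def profile_def)
  also have "\<dots> = integral {0..r} (\<lambda>y. \<alpha> * \<kappa> * s y)"
    using Henstock_Kurzweil_Integration.integral_reflect_real[of r 0 "\<lambda>y. \<alpha> * \<kappa> * s y"] by simp
  finally show ?thesis using False assms by (simp add: H_def)
qed (simp add: H_def)

lemma H_pos:
  assumes "0 \<le> r"
  shows "H r = integral {0..r} (initial_part \<phi>)"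
proof -
  have "integral {0..r} h = integral {0..r} (initial_part \<phi>)"
    by (rule integral_spike[of "{0}"]) (auto simp: h_def profile_def)
  then show ?thesis using assms by (simp add: H_def)
qed

text \<open>The translated profile pulled back to the position \<open>x\<close>, with Jacobian
  \<open>P_ext x / \<alpha>\<close>; \<sigma> is the autonomous time.\<close>

definition q :: "real \<Rightarrow> real \<Rightarrow> real" where
  "q x \<sigma> = P_ext x / \<alpha> * h (G x - \<sigma>)"

lemma q_measurable: "(\<lambda>(x, \<sigma>). q x \<sigma>) \<in> borel_measurable (borel \<Otimes>\<^sub>M borel)"
proof -
  have [measurable]: "P_ext \<in> borel_measurable borel" "G \<in> borel_measurable borel"
    using P_ext_continuous G_continuous by (auto intro: borel_measurable_continuous_onI)
  show ?thesis unfolding q_def by measurable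
qed

lemma q_initial:
  assumes "x \<in> {0<..<L}"
  shows "q x 0 = \<phi> x"
  using initial_part_travel(1)[OF assms, of \<phi>] initial_part_travel(2)[OF assms] assms
  by (simp add: q_def G_eq_travel P_ext_eq h_def profile_def mult.commute)

lemma
  shows q_L1: "L1 L (\<lambda>x. q x \<sigma>)"
    and q_integral: "x \<in> {0..L} \<Longrightarrow> integral {0..x} (\<lambda>y. q y \<sigma>) = H (travel x - \<sigma>) - H (- \<sigma>)"
proof -
  have key: "set_integrable lborel {0..x} (\<lambda>y. q y \<sigma>)"
    "integral {0..x} (\<lambda>y. q y \<sigma>) = H (travel x - \<sigma>) - H (- \<sigma>)" if x: "x \<in> {0..L}" for x
  proof -
    let ?g = "\<lambda>y. G y - \<sigma>"
    have DG: "(?g has_real_derivative P_ext y / \<alpha>) (at y)" for y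
      using G_DERIV[of y] by (auto intro!: derivative_eq_intros)
    have cP: "continuous_on {0..x} (\<lambda>y. P_ext y / \<alpha>)" using \<alpha>_pos by (intro continuous_intros P_ext_continuous) auto
    have nn: "0 \<le> P_ext y / \<alpha>" for y using P_ext_nonneg \<alpha>_pos by simp
    have x0: "0 \<le> x" using x by simp
    note sub = integral_substitution[OF h_set_integrable DG cP nn x0]
    have q: "q y \<sigma> = h (?g y) * (P_ext y / \<alpha>)" for y by (simp add: q_def)
    show i: "set_integrable lborel {0..x} (\<lambda>y. q y \<sigma>)" using sub(1) by (simp only: q)
    have "integral {0..x} (\<lambda>y. q y \<sigma>) = (LINT y:{0..x}|lborel. q y \<sigma>)"
      by (rule set_borel_integral_eq_integral(2)[OF i, symmetric])
    also have "\<dots> = (LBINT y. h (?g y) * (P_ext y / \<alpha>) * indicator {0..x} y)"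
      unfolding set_lebesgue_integral_def q by (simp add: mult.commute)
    also have "\<dots> = (LBINT z. h z * indicator {?g 0..?g x} z)" by (rule sub(2)[symmetric])
    also have "\<dots> = (LINT z:{?g 0..?g x}|lborel. h z)"
      unfolding set_lebesgue_integral_def by (simp add: mult.commute)
    also have "\<dots> = integral {?g 0..?g x} h" by (rule set_borel_integral_eq_integral(2)[OF h_set_integrable])
    also have "\<dots> = H (travel x - \<sigma>) - H (- \<sigma>)"
      using H_diff[of "?g 0" "?g x"] G_eq_travel[of 0] G_eq_travel[of x] travel_0 travel_nonneg[OF x] x L_pos by simp
    finally show "integral {0..x} (\<lambda>y. q y \<sigma>) = H (travel x - \<sigma>) - H (- \<sigma>)" .
  qed
  show "L1 L (\<lambda>x. q x \<sigma>)"
    unfolding L1_def by (rule set_integrable_subset[OF key(1)[of L]]) (use L_pos in auto)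
  show "integral {0..x} (\<lambda>y. q y \<sigma>) = H (travel x - \<sigma>) - H (- \<sigma>)" if "x \<in> {0..L}"
    by (rule key(2)[OF that])
qed

text \<open>In the coordinate \<open>r\<close> the distance is that of two translates of
  \<open>h\<close> over \<open>{0..travel L}\<close>. For times within 1 of \<sigma> only a bounded
  piece of \<open>h\<close> is visible, so \<open>h\<close> can be cut off to an integrable
  \<open>F\<close>, whose translates are continuous in the mean.\<close>

lemma q_continuous:
  assumes \<sigma>: "0 \<le> \<sigma>"
  shows "((\<lambda>r. LINT x:{0<..<L}|lborel. \<bar>q x r - q x \<sigma>\<bar>) \<longlongrightarrow> 0) (at \<sigma> within {0..})"
proof -
  define F where "F r = indicat_real {- \<sigma> - 1..travel L} r * h r" for r
  have F: "integrable lborel F"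
    using h_set_integrable unfolding F_def[abs_def] set_integrable_def by simp
  define W where "W \<delta> = (\<integral>x. \<bar>F (x + \<delta>) - F x\<bar> \<partial>lborel)" for \<delta>
  have "(W \<longlongrightarrow> 0) (at 0)"
    using integrable_translation_continuous[OF F] by (simp add: translation_continuous_def W_def[abs_def])
  moreover have W0: "W 0 = 0" by (simp add: W_def)
  ultimately have "isCont W 0" by (simp add: isCont_def)
  moreover have "((\<lambda>r. \<sigma> - r) \<longlongrightarrow> 0) (at \<sigma> within {0..})"
    by (auto intro!: tendsto_eq_intros)
  ultimately have lim: "((\<lambda>r. W (\<sigma> - r)) \<longlongrightarrow> 0) (at \<sigma> within {0..})"
    using isCont_tendsto_compose[of 0 W "\<lambda>r. \<sigma> - r"] W0 by simp
  show ?thesis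
  proof (rule Lim_null_comparison[OF _ lim])
    have "norm (LINT x:{0<..<L}|lborel. \<bar>q x r - q x \<sigma>\<bar>) \<le> W (\<sigma> - r)" if r: "0 \<le> r" "\<bar>r - \<sigma>\<bar> < 1" for r
    proof -
      define k where "k z = \<bar>h (z - r) - h (z - \<sigma>)\<bar>" for z
      have FF: "integrable lborel (\<lambda>z. \<bar>F (z - r) - F (z - \<sigma>)\<bar>)"
        using integrable_translate[OF F, of "- r"] integrable_translate[OF F, of "- \<sigma>"] by simp
      have Fk: "\<bar>F (z - r) - F (z - \<sigma>)\<bar> = k z" if "z \<in> {0..travel L}" for z
        using that r \<sigma> by (auto simp: F_def k_def indicator_def)
      have k0: "0 \<le> k z" for z by (simp add: k_def)
      have [measurable]: "k \<in> borel_measurable borel" unfolding k_def[abs_def] by measurable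
      have ki: "integrable lborel (\<lambda>z. indicat_real {0..travel L} z *\<^sub>R k z)"
      proof (rule Bochner_Integration.integrable_bound[OF FF])
        show "AE z in lborel. norm (indicat_real {0..travel L} z *\<^sub>R k z) \<le> norm \<bar>F (z - r) - F (z - \<sigma>)\<bar>"
          using k0 by (intro AE_I2) (simp add: indicator_def Fk)
      qed measurable
      have G0: "G 0 = 0" "G L = travel L" using G_eq_travel[of 0] G_eq_travel[of L] travel_0 L_pos by auto
      have kG: "set_integrable lborel {G 0..G L} k" using ki by (simp add: set_integrable_def G0)
      have cP: "continuous_on {0..L} (\<lambda>y. P_ext y / \<alpha>)" using \<alpha>_pos by (intro continuous_intros P_ext_continuous) auto
      have nn: "0 \<le> P_ext y / \<alpha>" for y using P_ext_nonneg \<alpha>_pos by simp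
      have L0: "0 \<le> L" using L_pos by simp
      note sub = integral_substitution[OF kG G_DERIV cP nn L0]
      have kq: "k (G x) * (P_ext x / \<alpha>) = \<bar>q x r - q x \<sigma>\<bar>" for x
      proof -
        have "q x r - q x \<sigma> = P_ext x / \<alpha> * (h (G x - r) - h (G x - \<sigma>))"
          by (simp only: q_def right_diff_distrib)
        then show ?thesis by (simp only: k_def abs_mult abs_of_nonneg[OF nn] mult.commute)
      qed
      have d: "L1 L (\<lambda>x. \<bar>q x r - q x \<sigma>\<bar>)"
        using L1_diff[OF q_L1[of r] q_L1[of \<sigma>]] unfolding L1_def by (rule set_integrable_abs)
      have "(LINT x:{0<..<L}|lborel. \<bar>q x r - q x \<sigma>\<bar>) = integral {0..L} (\<lambda>x. \<bar>q x r - q x \<sigma>\<bar>)"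
        by (rule L1_LINT[OF d])
      also have "\<dots> = (LINT x:{0..L}|lborel. k (G x) * (P_ext x / \<alpha>))"
        unfolding set_borel_integral_eq_integral(2)[OF sub(1)] by (simp only: kq)
      also have "\<dots> = (LBINT x. k (G x) * (P_ext x / \<alpha>) * indicator {0..L} x)"
        unfolding set_lebesgue_integral_def by (simp add: mult.commute)
      also have "\<dots> = (LBINT z. k z * indicator {G 0..G L} z)" by (rule sub(2)[symmetric])
      also have "\<dots> \<le> (LBINT z. \<bar>F (z - r) - F (z - \<sigma>)\<bar>)"
        by (rule integral_mono_AE'[OF FF]) (use Fk in \<open>auto simp: indicator_def G0\<close>)
      also have "\<dots> = (LBINT z. (\<lambda>z. \<bar>F (z + (\<sigma> - r)) - F z\<bar>) (z + - \<sigma>))"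
        by (simp add: algebra_simps)
      also have "\<dots> = W (\<sigma> - r)" unfolding W_def by (rule integral_translate)
      finally have "(LINT x:{0<..<L}|lborel. \<bar>q x r - q x \<sigma>\<bar>) \<le> W (\<sigma> - r)" .
      moreover have "0 \<le> (LINT x:{0<..<L}|lborel. \<bar>q x r - q x \<sigma>\<bar>)"
        unfolding set_lebesgue_integral_def by (intro Bochner_Integration.integral_nonneg) simp
      ultimately show ?thesis by simp
    qed
    then show "\<forall>\<^sub>F r in at \<sigma> within {0..}. norm (LINT x:{0<..<L}|lborel. \<bar>q x r - q x \<sigma>\<bar>) \<le> W (\<sigma> - r)"
      unfolding eventually_at by (intro exI[of _ 1]) (auto simp: dist_real_def)
  qed
qed

text \<open>At a fixed position time enters the argument of \<open>h\<close> affinely with slope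
  \<open>- real j\<close>, so integration over time produces increments of \<open>H\<close>. This is
  the gain of regularity that brings time integrals into the domain of the operator.\<close>

lemma q_time_integral:
  assumes j: "1 \<le> j" and t: "t \<in> {st (j - 1)..st j}"
  shows "(LINT r:{st (j - 1)..t}|lborel. q x (tau r)) =
    P_ext x / (\<alpha> * real j) * (H (G x - tau (st (j - 1))) - H (G x - tau t))"
proof -
  define a where "a = st (j - 1)"
  have at: "a \<le> t" using t by (simp add: a_def)
  have j0: "0 < real j" using j by simp
  have tau: "tau r = tau a + real j * (r - a)" if "r \<in> {a..t}" for r
    using tau_piece[OF j, of r] that t by (simp add: a_def)
  have tt: "tau t = tau a + real j * (t - a)" using tau[of t] at by simp
  define c where "c = G x - tau a + real j * a"
  define f where "f z = indicat_real {G x - tau t..G x - tau a} z * h z" for z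
  have f: "f (c + - real j * r) = indicat_real {a..t} r * h (G x - tau r)" for r
  proof -
    have e: "c + - real j * r = G x - tau a - real j * (r - a)" by (simp add: c_def right_diff_distrib)
    have "c + - real j * r \<in> {G x - tau t..G x - tau a} \<longleftrightarrow> real j * (r - a) \<le> real j * (t - a) \<and> 0 \<le> real j * (r - a)"
      unfolding tt by (auto simp: c_def right_diff_distrib)
    then have mem: "c + - real j * r \<in> {G x - tau t..G x - tau a} \<longleftrightarrow> r \<in> {a..t}"
      using j0 by (auto simp: zero_le_mult_iff)
    show ?thesis
    proof (cases "r \<in> {a..t}")
      case True
      then have "c + - real j * r = G x - tau r" using e tau[OF True] by simp
      then show ?thesis unfolding f_def using mem True by (simp only: indicator_simps)
    next
      case False
      then show ?thesis unfolding f_def using mem by (simp only: indicator_simps) simp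
    qed
  qed
  have "H (G x - tau a) - H (G x - tau t) = integral {G x - tau t..G x - tau a} h"
    using tt at j0 by (intro H_diff) simp
  also have "\<dots> = (\<integral>z. f z \<partial>lborel)"
    unfolding f_def set_borel_integral_eq_integral(2)[OF h_set_integrable, symmetric] set_lebesgue_integral_def by simp
  also have "\<dots> = real j * (\<integral>r. indicat_real {a..t} r * h (G x - tau r) \<partial>lborel)"
    using lborel_integral_real_affine[of "- real j" f c] j0 unfolding f by simp
  finally have "(\<integral>r. indicat_real {a..t} r * h (G x - tau r) \<partial>lborel) = (H (G x - tau a) - H (G x - tau t)) / real j"
    using j0 by simp
  then have "(LINT r:{a..t}|lborel. h (G x - tau r)) = (H (G x - tau a) - H (G x - tau t)) / real j"
    by (simp add: set_lebesgue_integral_def)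
  then show ?thesis unfolding q_def a_def[symmetric] by simp
qed

text \<open>Division by \<open>P\<close> leaves \<open>u\<close>, an increment of \<open>H\<close>,
  whose derivative in \<open>x\<close> is the density increment over
  \<open>- real j * \<alpha>\<close>. Its value at 0 is the inflow recorded by \<open>H\<close> on
  the negative axis.\<close>

lemma q_mild:
  assumes j: "1 \<le> j" and t: "t \<in> {st (j - 1)..st j}"
  defines "a \<equiv> st (j - 1)" and "Z \<equiv> \<lambda>x. LINT r:{st (j - 1)..t}|lborel. q x (tau r)"
  shows "W11 L (\<lambda>x. 1 / P x * Z x)"
    and "trace0 L Z (P 0 * \<kappa> * integral {a..t} (\<lambda>r. s (tau r)))"
    and "AE x in lborel. x \<in> {0<..<L} \<longrightarrow> q x (tau t) - q x (tau a) = - real j * \<alpha> * wderiv L (\<lambda>x. 1 / P x * Z x) x"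
proof -
  have j0: "0 < real j" using j by simp
  have at: "a \<in> {0..<tf}" "t \<in> {0..<tf}" "a \<le> t"
    using t st_less[of j] st_less[of "j - 1"] st_nonneg[of "j - 1"] by (auto simp: a_def)
  define u where "u x = (H (travel x - tau a) - H (travel x - tau t)) / (\<alpha> * real j)" for x
  define v where "v x = 1 / (\<alpha> * real j) * (q x (tau a) - q x (tau t))" for x
  have v: "L1 L v" unfolding v_def by (intro L1_cmult L1_diff q_L1)
  have u: "abs_cont L u v"
    unfolding abs_cont_def
  proof (intro conjI ballI)
    fix x assume x: "x \<in> {0..L}"
    have "integral {0..x} v = 1 / (\<alpha> * real j) * (integral {0..x} (\<lambda>y. q y (tau a)) - integral {0..x} (\<lambda>y. q y (tau t)))"
      unfolding v_def using x L1_integrable_on[OF q_L1, of 0 x]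
      by (simp add: Henstock_Kurzweil_Integration.integral_diff del: times_divide_eq_left)
    also have "\<dots> = u x - u 0"
      unfolding q_integral[OF x] u_def travel_0 by (simp add: diff_divide_distrib)
    finally show "u x = u 0 + integral {0..x} v" by simp
  qed (rule v)
  have Z: "Z x = P x * u x" if "x \<in> {0..L}" for x
    using q_time_integral[OF j t, of x] G_eq_travel[OF that] P_ext_eq[OF that]
    by (simp add: Z_def u_def a_def)
  have gZ: "1 / P x * Z x = u x" if "x \<in> {0<..<L}" for x
    using Z[of x] P_pos[of x] that by simp
  have AE: "AE x in lborel. x \<in> {0<..<L} \<longrightarrow> u x = 1 / P x * Z x"
    by (intro AE_I2 impI) (simp only: gZ)
  have L1gZ: "L1 L (\<lambda>x. 1 / P x * Z x)"
  proof -
    have "L1 L u" by (rule continuous_L1[OF abs_cont_continuous[OF u]])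
    then show ?thesis
      unfolding L1_def by (rule set_integrable_cong[THEN iffD1, rotated -1]) (simp_all only: gZ)
  qed
  note W = abs_cont_W11[OF u AE L1gZ L_pos]
  show "W11 L (\<lambda>x. 1 / P x * Z x)" by (rule W(1))
  show "AE x in lborel. x \<in> {0<..<L} \<longrightarrow> q x (tau t) - q x (tau a) = - real j * \<alpha> * wderiv L (\<lambda>x. 1 / P x * Z x) x"
    using W(2) by eventually_elim (use j0 \<alpha>_pos in \<open>simp add: v_def field_simps\<close>)
  show "trace0 L Z (P 0 * \<kappa> * integral {a..t} (\<lambda>r. s (tau r)))"
    unfolding trace0_def
  proof (intro exI conjI)
    show "continuous_on {0..L} (\<lambda>x. P x * u x)"
      by (intro continuous_intros P_continuous abs_cont_continuous[OF u])
    show "AE x in lborel. x \<in> {0<..<L} \<longrightarrow> P x * u x = Z x" using Z by (intro AE_I2) simp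
    have ta: "0 \<le> tau a" "0 \<le> tau t" "tau a \<le> tau t"
      using tau_nonneg at tau_increasing[of a t] by auto
    have "H (- tau a) - H (- tau t) = \<alpha> * \<kappa> * (integral {0..tau t} s - integral {0..tau a} s)"
      using H_neg ta by (simp add: algebra_simps)
    also have "integral {0..tau t} s - integral {0..tau a} s = integral {tau a..tau t} s"
      by (rule integral_diff_atLeast[OF s_continuous ta(1,3)])
    also have "integral {tau a..tau t} s = integral {tau a..tau t} (\<lambda>\<sigma>. s (tau (theta \<sigma>)))"
      by (rule integral_cong) (use ta tau_theta in simp)
    also have "\<dots> = real j * integral {a..t} (\<lambda>r. s (tau r))"
    proof -
      have "continuous_on {0..<tf} (\<lambda>r. s (tau r))"
        by (rule continuous_on_compose2[OF s_continuous continuous_on_subset[OF tau_continuous]])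
          (use tau_nonneg in auto)
      from integral_theta[OF this j t] show ?thesis by (simp add: a_def)
    qed
    finally show "P 0 * u 0 = P 0 * \<kappa> * integral {a..t} (\<lambda>r. s (tau r))"
      using j0 \<alpha>_pos by (simp add: u_def travel_0)
  qed
qed

end

text \<open>The mass present at time \<sigma> is the initial mass \<open>R \<sigma>\<close> that has
  not yet left plus the inflow of the last \<open>travel L\<close> units of time. Prescribing
  \<open>s\<close> plus this mass to be \<open>k\<close> therefore says that the primitive
  \<open>I\<close> of \<open>s\<close> solves the delay equation with inhomogeneity
  \<open>k - R\<close>.\<close>

lemma (in transport) boundary_exists:
  assumes \<phi>: "L1 L \<phi>" and k: "continuous_on {0..} k"
  obtains s where "continuous_on {0..} s"
    "\<And>\<sigma>. 0 \<le> \<sigma> \<Longrightarrow> s \<sigma> + integral {0..L} (\<lambda>x. transport_data.q L P \<alpha> \<kappa> \<phi> s x \<sigma>) = k \<sigma>"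
proof -
  define T where "T = travel L"
  have T: "0 < T" using travel_L_pos by (simp add: T_def)
  define R where "R \<sigma> = integral {0..max 0 (T - \<sigma>)} (initial_part \<phi>)" for \<sigma>
  have "initial_part \<phi> integrable_on {0..T}"
  proof (rule set_borel_integral_eq_integral(1))
    show "set_integrable lborel {0..T} (initial_part \<phi>)"
      unfolding set_integrable_def by (intro integrable_mult_indicator initial_part_integrable \<phi>) simp
  qed
  then have "continuous_on {0..T} (\<lambda>r. integral {0..r} (initial_part \<phi>))"
    by (rule indefinite_integral_continuous_1)
  then have "continuous_on {0..} R"
    unfolding R_def by (rule continuous_on_compose2) (use T in \<open>auto intro!: continuous_intros\<close>)
  then have "continuous_on {0..} (\<lambda>\<sigma>. k \<sigma> - R \<sigma>)" by (intro continuous_intros k)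
  from delay_equation_exists[OF T this, where \<beta> = "\<alpha> * \<kappa>"]
  obtain I where I: "\<And>x. x \<le> 0 \<Longrightarrow> I x = 0" "continuous_on UNIV I"
    "\<And>x. 0 \<le> x \<Longrightarrow> (I has_real_derivative (k x - R x - \<alpha> * \<kappa> * (I x - I (x - T)))) (at x within {0..})"
    by metis
  define s where "s x = k x - R x - \<alpha> * \<kappa> * (I x - I (x - T))" for x
  have s: "continuous_on {0..} s"
    unfolding s_def using \<open>continuous_on {0..} R\<close>
    by (intro continuous_intros k continuous_on_compose2[OF I(2)]) auto
  have Is: "I x = integral {0..x} s" if "0 \<le> x" for x
  proof -
    have "(s has_integral (I x - I 0)) {0..x}"
    proof (rule fundamental_theorem_of_calculus[OF that])
      fix y assume "y \<in> {0..x}"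
      then show "(I has_vector_derivative s y) (at y within {0..x})"
        using has_field_derivative_subset[OF I(3)[of y], of "{0..x}"]
        by (auto simp: s_def has_real_derivative_iff_has_vector_derivative)
    qed
    then show ?thesis using I(1)[of 0] by (simp add: integral_unique)
  qed
  interpret D: transport_data tf r0 L P \<alpha> \<kappa> \<phi> s
    by unfold_locales (rule \<phi>, rule s)
  show ?thesis
  proof (rule that[OF s])
    fix \<sigma> :: real assume \<sigma>: "0 \<le> \<sigma>"
    have "D.H (T - \<sigma>) = R \<sigma> - \<alpha> * \<kappa> * I (\<sigma> - T)"
    proof (cases "\<sigma> \<le> T")
      case True
      then show ?thesis using D.H_pos[of "T - \<sigma>"] I(1)[of "\<sigma> - T"] by (simp add: R_def)
    next
      case False
      then show ?thesis using D.H_neg[of "\<sigma> - T"] Is[of "\<sigma> - T"] by (simp add: R_def)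
    qed
    moreover have "D.H (- \<sigma>) = - \<alpha> * \<kappa> * I \<sigma>" using D.H_neg[OF \<sigma>] Is[OF \<sigma>] by simp
    ultimately have "s \<sigma> + (D.H (travel L - \<sigma>) - D.H (- \<sigma>)) = k \<sigma>"
      by (simp add: s_def T_def algebra_simps)
    then show "s \<sigma> + integral {0..L} (\<lambda>x. D.q x \<sigma>) = k \<sigma>"
      using D.q_integral[of L \<sigma>] L_pos by simp
  qed
qed

context transport_data
begin

lemma q_tau_L1: "L1 L (\<lambda>x. q x (tau t))"
  by (rule q_L1)

lemma q_tau_measurable: "set_borel_measurable borel ({0<..<L} \<times> {0..<tf}) (\<lambda>(x, t). q x (tau t))"
proof -
  define tau' where "tau' t = indicat_real {0..<tf} t *\<^sub>R tau t" for t
  have [measurable]: "tau' \<in> borel_measurable borel"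
    unfolding tau'_def[abs_def]
    by (intro borel_measurable_continuous_on_indicator continuous_on_subset[OF tau_continuous]) auto
  note q_measurable[measurable]
  have "(\<lambda>(x, t). indicat_real {0<..<L} x * indicat_real {0..<tf} t * (\<lambda>(x, \<sigma>). q x \<sigma>) (x, tau' t)) \<in> borel_measurable (borel \<Otimes>\<^sub>M borel)"
    by measurable
  moreover have "(\<lambda>(x, t). indicat_real {0<..<L} x * indicat_real {0..<tf} t * (\<lambda>(x, \<sigma>). q x \<sigma>) (x, tau' t)) =
     (\<lambda>z. indicat_real ({0<..<L} \<times> {0..<tf}) z *\<^sub>R (case z of (x, t) \<Rightarrow> q x (tau t)))"
    by (auto simp: fun_eq_iff indicator_def tau'_def)
  ultimately show ?thesis unfolding set_borel_measurable_def borel_prod by simp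
qed

lemma tau_continuous_within: "t \<in> {0..<tf} \<Longrightarrow> continuous (at t within {0..<tf}) tau"
proof -
  have "continuous_on {0..<tf} tau" by (rule continuous_on_subset[OF tau_continuous]) auto
  then show "t \<in> {0..<tf} \<Longrightarrow> continuous (at t within {0..<tf}) tau"
    by (simp add: continuous_on_eq_continuous_within)
qed

lemma tau_image: "tau ` {0..<tf} \<subseteq> {0..}"
  using tau_nonneg by auto

lemma q_tau_continuous:
  assumes "t \<in> {0..<tf}"
  shows "((\<lambda>r. LINT x:{0<..<L}|lborel. \<bar>q x (tau r) - q x (tau t)\<bar>) \<longlongrightarrow> 0) (at t within {0..<tf})"
proof -
  define W where "W r = (LINT x:{0<..<L}|lborel. \<bar>q x r - q x (tau t)\<bar>)" for r
  have W0: "W (tau t) = 0" by (simp add: W_def)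
  have "(W \<longlongrightarrow> W (tau t)) (at (tau t) within {0..})"
    unfolding W0 unfolding W_def by (rule q_continuous[OF tau_nonneg[OF assms]])
  then have "continuous (at (tau t) within {0..}) W" by (simp add: continuous_within)
  then have "continuous (at (tau t) within tau ` {0..<tf}) W"
    by (rule continuous_within_subset) (rule tau_image)
  from continuous_within_compose2[OF tau_continuous_within[OF assms] this]
  have "((\<lambda>r. W (tau r)) \<longlongrightarrow> 0) (at t within {0..<tf})" by (simp add: continuous_within W0)
  then show ?thesis by (simp add: W_def)
qed

lemma s_tau_continuous: "continuous_on {0..<tf} (\<lambda>t. s (tau t))"
  by (rule continuous_on_compose2[OF s_continuous continuous_on_subset[OF tau_continuous] tau_image]) auto

lemma q_solution: "transport_solution tf r0 L P \<alpha> \<kappa> (\<lambda>x t. q x (tau t)) (\<lambda>t. s (tau t))"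
  by unfold_locales
    (use q_tau_L1 q_tau_measurable q_tau_continuous s_tau_continuous q_mild in auto)

end

section \<open>Coupling of the two constructed components\<close>

context repair
begin

text \<open>The coupling is triangular: the constant total \<open>c\<close> determines
  \<open>s2\<close>, and \<open>s2\<close> determines \<open>s1\<close>, which is \<open>p0\<close>
  in the autonomous time. The equation for \<open>p0\<close> is then a consequence of the two
  balances and the equations of the densities.\<close>

lemma mild_solution_exists:
  assumes \<phi>: "L1 L \<phi>1" "L1 L \<phi>2"
  shows "\<exists>p0 p1 p2. mild_solution L tf r0 closed_loop (\<phi>0, \<phi>1, \<phi>2) p0 p1 p2"
proof -
  define c where "c = \<phi>0 + integral {0..L} \<phi>1 + integral {0..L} \<phi>2"
  obtain s2 where s2: "continuous_on {0..} s2"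
    "\<And>\<sigma>. 0 \<le> \<sigma> \<Longrightarrow> s2 \<sigma> + integral {0..L} (\<lambda>x. transport_data.q L P2 \<alpha>2 \<kappa>2 \<phi>2 s2 x \<sigma>) = c"
    using T2.boundary_exists[OF \<phi>(2), of "\<lambda>_. c"] by (metis continuous_on_const)
  obtain s1 where s1: "continuous_on {0..} s1"
    "\<And>\<sigma>. 0 \<le> \<sigma> \<Longrightarrow> s1 \<sigma> + integral {0..L} (\<lambda>x. transport_data.q L P1 \<alpha>1 \<kappa>1 \<phi>1 s1 x \<sigma>) = s2 \<sigma>"
    using T1.boundary_exists[OF \<phi>(1) s2(1)] by metis
  interpret D1: transport_data tf r0 L P1 \<alpha>1 \<kappa>1 \<phi>1 s1 by unfold_locales (rule \<phi>, rule s1)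
  interpret D2: transport_data tf r0 L P2 \<alpha>2 \<kappa>2 \<phi>2 s2 by unfold_locales (rule \<phi>, rule s2)
  define p0 where "p0 t = s1 (tau t)" for t
  define p1 where "p1 x t = D1.q x (tau t)" for x t
  define p2 where "p2 x t = D2.q x (tau t)" for x t
  interpret S1: transport_solution tf r0 L P1 \<alpha>1 \<kappa>1 p1 p0
    using D1.q_solution by (simp only: p0_def[abs_def] p1_def[abs_def])
  interpret S2: transport_solution tf r0 L P2 \<alpha>2 \<kappa>2 p2 "\<lambda>t. s2 (tau t)"
    using D2.q_solution by (simp only: p2_def[abs_def])
  have mass1: "p0 t + S1.M L t = s2 (tau t)" if "t \<in> {0..<tf}" for t
    using s1(2)[OF tau_nonneg[OF that]] by (simp add: p0_def p1_def S1.M_def)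
  have mass2: "s2 (tau t) + S2.M L t = c" if "t \<in> {0..<tf}" for t
    using s2(2)[OF tau_nonneg[OF that]] by (simp add: p2_def S2.M_def)
  have initial: "integral {0..L} (\<lambda>x. p1 x 0) = integral {0..L} \<phi>1" "integral {0..L} (\<lambda>x. p2 x 0) = integral {0..L} \<phi>2"
    using D1.q_initial D2.q_initial
    by (auto intro!: AE_integral_cong[of L] AE_I2 simp: p1_def p2_def tau_0)
  have t0: "0 \<in> {0..<tf}" using tf_pos by simp
  \<comment> \<open>The initial value of \<open>p0\<close> was never imposed; it comes out of the
    balance at time 0 because \<open>c\<close> contains \<open>\<phi>0\<close>.\<close>
  have p0_0: "p0 0 = \<phi>0"
    using mass1[OF t0] mass2[OF t0] initial by (simp add: S1.M_def S2.M_def c_def)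
  have "mild_solution L tf r0 closed_loop (\<phi>0, \<phi>1, \<phi>2) p0 p1 p2"
    unfolding mild_solution_def Let_def
  proof (intro conjI ballI allI impI)
    show "in_X L (p0 t, \<lambda>x. p1 x t, \<lambda>x. p2 x t)" if "t \<in> {0..<tf}" for t
      using S1.p_L1[OF that] S2.p_L1[OF that] by simp
    show "set_borel_measurable borel ({0<..<L} \<times> {0..<tf}) (\<lambda>(x, t). p1 x t)" by (rule S1.p_measurable)
    show "set_borel_measurable borel ({0<..<L} \<times> {0..<tf}) (\<lambda>(x, t). p2 x t)" by (rule S2.p_measurable)
    show "((\<lambda>s. dist_X L (p0 s, \<lambda>x. p1 x s, \<lambda>x. p2 x s) (p0 t, \<lambda>x. p1 x t, \<lambda>x. p2 x t)) \<longlongrightarrow> 0) (at t within {0..<tf})"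
      if t: "t \<in> {0..<tf}" for t
    proof -
      have "(p0 \<longlongrightarrow> p0 t) (at t within {0..<tf})"
        using S1.b_continuous t by (simp add: continuous_on_def)
      then have "((\<lambda>s. \<bar>p0 s - p0 t\<bar>) \<longlongrightarrow> 0) (at t within {0..<tf})"
        by (intro tendsto_rabs_zero LIM_zero)
      from tendsto_add[OF tendsto_add[OF this S1.p_continuous[OF t]] S2.p_continuous[OF t]]
      show ?thesis by simp
    qed
    have zero: "(LINT x:{0<..<L}|lborel. \<bar>u x - v x\<bar>) = 0" if "\<And>x. x \<in> {0<..<L} \<Longrightarrow> u x = v x" for u v :: "real \<Rightarrow> real"
      unfolding set_lebesgue_integral_def
      by (rule integral_eq_zero_AE, rule AE_I2) (use that in \<open>simp add: indicator_def\<close>)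
    have "(LINT x:{0<..<L}|lborel. \<bar>p1 x 0 - \<phi>1 x\<bar>) = 0" "(LINT x:{0<..<L}|lborel. \<bar>p2 x 0 - \<phi>2 x\<bar>) = 0"
      using D1.q_initial D2.q_initial by (auto intro!: zero simp: p1_def p2_def tau_0)
    then show "dist_X L (p0 0, \<lambda>x. p1 x 0, \<lambda>x. p2 x 0) (\<phi>0, \<phi>1, \<phi>2) = 0"
      by (simp add: p0_0)
    fix j :: nat and t assume jt: "1 \<le> j" "t \<in> {st (j - 1)..st j}"
    define a where "a = st (j - 1)"
    have a: "0 \<le> a" "a \<le> t" "t < tf" "a \<in> {0..<tf}" "t \<in> {0..<tf}" "{a..t} \<subseteq> {0..<tf}"
      using jt(2) st_less[of j] st_nonneg[of "j - 1"] by (auto simp: a_def)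
    define Z1 where "Z1 x = (LINT r:{a..t}|lborel. p1 x r)" for x
    define Z2 where "Z2 x = (LINT r:{a..t}|lborel. p2 x r)" for x
    note m1 = S1.p_mild[OF jt, folded a_def, folded Z1_def]
    note m2 = S2.p_mild[OF jt, folded a_def, folded Z2_def]
    have LINT_p0: "(LINT r:{a..t}|lborel. p0 r) = integral {a..t} p0"
      by (rule set_borel_integral_eq_integral(2)[OF borel_integrable_atLeastAtMost'])
        (rule continuous_on_subset[OF S1.b_continuous a(6)])
    have tr1: "trace0 L Z1 (lam1 * (LINT r:{a..t}|lborel. p0 r))"
      using m1 unfolding P1_0_\<kappa>1 LINT_p0 by blast
    have cM: "continuous_on {a..t} (S1.M L)"
      by (rule continuous_on_subset[OF S1.M_continuous_t a(6)]) (use P1.L_pos in simp)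
    have "integral {a..t} (\<lambda>r. s2 (tau r)) = integral {a..t} (\<lambda>r. p0 r + S1.M L r)"
      by (rule integral_cong) (use a mass1 in auto)
    also have "\<dots> = integral {a..t} p0 + integral {a..t} (S1.M L)"
      by (intro Henstock_Kurzweil_Integration.integral_add integrable_continuous_real cM
        continuous_on_subset[OF S1.b_continuous a(6)])
    also have "integral {a..t} (S1.M L) = integral {0..L} Z1"
      using S1.time_integral_M[OF a(1,3), of L] P1.L_pos by (simp add: Z1_def[abs_def])
    also have "\<dots> = (LINT x:{0<..<L}|lborel. Z1 x)"
      using L1_LINT[OF S1.time_integral_L1[OF a(1,3)]] by (simp add: Z1_def[abs_def])
    finally have "lam2 * integral {a..t} (\<lambda>r. s2 (tau r)) =
        lam2 * (LINT r:{a..t}|lborel. p0 r) + lam2 * (LINT x:{0<..<L}|lborel. Z1 x)"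
      unfolding LINT_p0 by (simp only: distrib_left)
    then have tr2: "trace0 L Z2 (lam2 * (LINT r:{a..t}|lborel. p0 r) + lam2 * (LINT x:{0<..<L}|lborel. Z1 x))"
      using m2 unfolding P2_0_\<kappa>2 by simp
    have "S1.M L t - S1.M L a = - real j * \<alpha>1 * (LINT x:{0<..<L}|lborel. wderiv L (\<lambda>x. 1 / P1 x * Z1 x) x)"
      unfolding S1.M_def using m1 by (intro LINT_wderiv S1.p_L1 a) auto
    moreover have "S2.M L t - S2.M L a = - real j * \<alpha>2 * (LINT x:{0<..<L}|lborel. wderiv L (\<lambda>x. 1 / P2 x * Z2 x) x)"
      unfolding S2.M_def using m2 by (intro LINT_wderiv S2.p_L1 a) auto
    moreover have "p0 t - p0 a = - (S1.M L t - S1.M L a) - (S2.M L t - S2.M L a)"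
      using mass1[OF a(4)] mass1[OF a(5)] mass2[OF a(4)] mass2[OF a(5)] by simp
    ultimately have w0: "p0 t - p0 a = real j * (\<alpha>1 * (LINT x:{0<..<L}|lborel. wderiv L (\<lambda>x. 1 / P1 x * Z1 x) x)
        + \<alpha>2 * (LINT x:{0<..<L}|lborel. wderiv L (\<lambda>x. 1 / P2 x * Z2 x) x))"
      by (simp add: algebra_simps)
    have "closed_loop j (LINT r:{a..t}|lborel. p0 r, Z1, Z2)
       (p0 t - p0 a, \<lambda>x. p1 x t - p1 x a, \<lambda>x. p2 x t - p2 x a)"
      unfolding closed_loop_op.simps using m1 m2 tr1 tr2 w0 by blast
    then show "closed_loop j (LINT s:{st (j - 1)..t}|lborel. p0 s,
       \<lambda>x. LINT s:{st (j - 1)..t}|lborel. p1 x s, \<lambda>x. LINT s:{st (j - 1)..t}|lborel. p2 x s)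
       (p0 t - p0 (st (j - 1)), \<lambda>x. p1 x t - p1 x (st (j - 1)), \<lambda>x. p2 x t - p2 x (st (j - 1)))"
      by (simp only: a_def Z1_def[abs_def] Z2_def[abs_def])
  qed
  then show ?thesis by blast
qed

end

section \<open>Feedback law, existence and convergence combined\<close>

lemma feedback_form_feedback_rate:
  assumes "decreasing_profile L P1" "decreasing_profile L P2"
  shows "feedback_form L lam2 \<alpha>1 \<alpha>2 (\<lambda>x. 1 / P1 x) (\<lambda>x. 1 / P2 x)
    (decreasing_profile.feedback_rate L P1 \<alpha>1 lam2) (decreasing_profile.feedback_rate L P2 \<alpha>2 0)"
  unfolding feedback_form_def decreasing_profile.feedback_rate_def[OF assms(1)]
    decreasing_profile.feedback_rate_def[OF assms(2)] by simp

lemma LINT_abs_nonneg_eq: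
  assumes u: "L1 L u" and "AE x in lborel. x \<in> {0<..<L} \<longrightarrow> 0 \<le> u x"
  shows "(LINT x:{0<..<L}|lborel. \<bar>u x\<bar>) = integral {0..L} u"
proof -
  have "(LINT x:{0<..<L}|lborel. \<bar>u x\<bar>) = (LINT x:{0<..<L}|lborel. u x)"
  proof (rule AE_LINT_cong[OF _ _ u])
    show "AE x in lborel. x \<in> {0<..<L} \<longrightarrow> \<bar>u x\<bar> = u x" using assms(2) by eventually_elim auto
    show "L1 L (\<lambda>x. \<bar>u x\<bar>)" using u unfolding L1_def by (rule set_integrable_abs)
  qed
  then show ?thesis by (simp add: L1_LINT[OF u])
qed

theorem theorem3p1:
  fixes L lam1 lam2 tf r0 \<alpha>1 \<alpha>2 \<epsilon> :: real
    and \<phi>0 p0s :: real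
    and \<phi>1 \<phi>2 p1s p2s g1 g2 :: "real \<Rightarrow> real"
  assumes "0 < L" "0 < lam1" "0 < lam2" "0 < tf"
    and "in_X L (\<phi>0, \<phi>1, \<phi>2)" "nonneg_X L (\<phi>0, \<phi>1, \<phi>2)" "norm_X L (\<phi>0, \<phi>1, \<phi>2) = 1"
    and "in_X L (p0s, p1s, p2s)" "nonneg_X L (p0s, p1s, p2s)" "norm_X L (p0s, p1s, p2s) = 1"
    and "W11 L p1s" "W11 L p2s" "continuous_on {0..L} p1s" "continuous_on {0..L} p2s"
    and "p1s 0 = lam1 * p0s"
    and "p2s 0 = lam2 * p0s + lam2 * (LINT x:{0<..<L}|lborel. p1s x)"
    and "p1s L = 0" "p2s L = 0"
    and "p0s = 1 - ((LINT x:{0<..<L}|lborel. p1s x) + (LINT x:{0<..<L}|lborel. p2s x))"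
    and "\<forall>x\<in>{0..L}. 0 \<le> p1s x" "\<forall>x\<in>{0..L}. 0 \<le> p2s x"
    and "0 < \<epsilon>"
    and "AE x in lborel. x \<in> {0<..<L} \<longrightarrow> wderiv L p1s x \<le> - \<epsilon>"
    and "AE x in lborel. x \<in> {0<..<L} \<longrightarrow> wderiv L p2s x < 0"
    and "g1 = (\<lambda>x. 1 / p1s x)" "g2 = (\<lambda>x. 1 / p2s x)"
    and "r0 = 6 * tf / pi\<^sup>2"
    and "0 < \<alpha>1" "0 < \<alpha>2"
    and "\<alpha>1 \<ge> max (lam2 / \<epsilon> * (p1s 0)\<^sup>2) (p1s 0)" "\<alpha>2 \<ge> p2s 0"
  shows "\<exists>\<mu>1 \<mu>2. feedback_form L lam2 \<alpha>1 \<alpha>2 g1 g2 \<mu>1 \<mu>2 \<and>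
    (\<forall>j\<ge>1. \<forall>z w. controlled_op L lam1 lam2 g1 g2 \<mu>1 \<mu>2 j z w \<longleftrightarrow>
                   closed_loop_op L lam1 lam2 \<alpha>1 \<alpha>2 g1 g2 j z w) \<and>
    (\<exists>p0 p1 p2. mild_solution L tf r0 (controlled_op L lam1 lam2 g1 g2 \<mu>1 \<mu>2) (\<phi>0, \<phi>1, \<phi>2) p0 p1 p2) \<and>
    (\<forall>p0 p1 p2. mild_solution L tf r0 (controlled_op L lam1 lam2 g1 g2 \<mu>1 \<mu>2) (\<phi>0, \<phi>1, \<phi>2) p0 p1 p2 \<longrightarrow>
       ((\<lambda>t. dist_X L (p0 t, \<lambda>x. p1 x t, \<lambda>x. p2 x t) (p0s, p1s, p2s)) \<longlongrightarrow> 0) (at_left tf))"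
proof -
  have "AE x in lborel. x \<in> {0<..<L} \<longrightarrow> wderiv L p1s x < 0"
    using assms(23) by eventually_elim (use \<open>0 < \<epsilon>\<close> in auto)
  then have dp1: "decreasing_profile L p1s"
    by unfold_locales (use assms in auto)
  have dp2: "decreasing_profile L p2s"
    by unfold_locales (use assms in auto)
  interpret P1: decreasing_profile L p1s by (rule dp1)
  interpret P2: decreasing_profile L p2s by (rule dp2)
  have LINT: "(LINT x:{0<..<L}|lborel. p1s x) = integral {0..L} p1s" "(LINT x:{0<..<L}|lborel. p2s x) = integral {0..L} p2s"
    using L1_LINT[OF continuous_L1[OF assms(13)]] L1_LINT[OF continuous_L1[OF assms(14)]] by auto
  have sw: "switching tf r0" by unfold_locales (rule assms, rule assms)
  have "p2s 0 = lam2 * (p0s + integral {0..L} p1s)"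
    using assms(16) unfolding LINT by (simp only: distrib_left)
  moreover have "p0s + integral {0..L} p1s + integral {0..L} p2s = 1"
    using assms(19) unfolding LINT by simp
  ultimately interpret repair tf r0 L p1s p2s lam1 lam2 \<alpha>1 \<alpha>2 p0s
    by (intro repair.intro repair_axioms.intro sw dp1 dp2 assms(2,3,15,28,29))
  have \<phi>: "L1 L \<phi>1" "L1 L \<phi>2" using assms(5) by auto
  \<comment> \<open>Non-negativity turns the norm of the initial state into its mass.\<close>
  have mass: "\<phi>0 + integral {0..L} \<phi>1 + integral {0..L} \<phi>2 = 1"
  proof -
    have "AE x in lborel. x \<in> {0<..<L} \<longrightarrow> 0 \<le> \<phi>1 x" "AE x in lborel. x \<in> {0<..<L} \<longrightarrow> 0 \<le> \<phi>2 x"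
      using assms(6) by (auto simp: nonneg_X_def elim: eventually_mono)
    from LINT_abs_nonneg_eq[OF \<phi>(1) this(1)] LINT_abs_nonneg_eq[OF \<phi>(2) this(2)]
    show ?thesis using assms(6,7) by (simp add: nonneg_X_def)
  qed
  \<comment> \<open>The two operators are equal as relations, so mild solutions of the controlled
    system and of the closed loop are the same objects.\<close>
  have op: "controlled_op L lam1 lam2 g1 g2 (P1.feedback_rate \<alpha>1 lam2) (P2.feedback_rate \<alpha>2 0) = closed_loop"
    unfolding assms(25,26) by (intro ext controlled_op_iff_closed_loop_op dp1 dp2)
  have ff: "feedback_form L lam2 \<alpha>1 \<alpha>2 g1 g2 (P1.feedback_rate \<alpha>1 lam2) (P2.feedback_rate \<alpha>2 0)"
    unfolding assms(25,26) by (rule feedback_form_feedback_rate[OF dp1 dp2])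
  have conv: "((\<lambda>t. dist_X L (p0 t, \<lambda>x. p1 x t, \<lambda>x. p2 x t) (p0s, p1s, p2s)) \<longlongrightarrow> 0) (at_left tf)"
    if "mild_solution L tf r0 closed_loop (\<phi>0, \<phi>1, \<phi>2) p0 p1 p2" for p0 p1 p2
  proof -
    interpret repair_solution tf r0 L p1s p2s lam1 lam2 \<alpha>1 \<alpha>2 p0s p0 p1 p2 \<phi>0 \<phi>1 \<phi>2
      by unfold_locales (rule that, rule \<phi>, rule \<phi>, rule mass)
    show ?thesis by (rule tendsto_target)
  qed
  show ?thesis
  proof (rule exI[of _ "P1.feedback_rate \<alpha>1 lam2"], rule exI[of _ "P2.feedback_rate \<alpha>2 0"], unfold op, intro conjI allI impI)
    show "closed_loop j z w = closed_loop_op L lam1 lam2 \<alpha>1 \<alpha>2 g1 g2 j z w" for j z w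
      by (simp only: assms(25,26))
  qed (rule ff, rule mild_solution_exists[OF \<phi>], rule conv)
qed

end
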